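(* Suppose that the following holds (the RHF conjecture): if the Riemann Hypothesis is false, then $\zeta(s)=0$ for infinitely many $s\in\mathbb{C}$ with $1/2<\Re s<1$. Then $\dim(\mathcal{N}^\perp)$ is either $0$ or $\infty$.
   Context: $\zeta$ is the Riemann zeta function. $H^2$ is the Hardy-Hilbert space of the unit disk $\mathbb{D}$. For $k\ge2$, $$h_k(z)=\frac{1}{1-z}\log\left(\frac{1+z+\dots+z^{k-1}}{k}\right),\quad z\in\mathbb{D},$$ with the holomorphic branch of the logarithm on $\mathbb{D}$ equal to $-\log k\in\mathbb{R}$ at $z=0$; each $h_k$ is known to belong to $H^2$. $\mathcal{N}$ is the linear span of $\{h_k:k\ge2\}$, and $\mathcal{N}^\perp$ is its orthogonal complement in $H^2$. *)

theory Defs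
  imports
    "HOL-Complex_Analysis.Complex_Analysis"
    "HOL-Library.Function_Algebras"
    "HOL-Library.Extended_Nat"
begin

text \<open>
  The analytic continuation of the Dirichlet series to the plane minus its pole.  The
  value \<open>0\<close> at the pole is a mere convention that makes the description unique.
\<close>

definition zeta :: "complex \<Rightarrow> complex" where
  "zeta = (THE f. f holomorphic_on (- {1}) \<and>
                  (\<forall>s. Re s > 1 \<longrightarrow> f s = (\<Sum>n. 1 / of_nat (Suc n) powr s)) \<and>
                  f 1 = 0)"

text \<open>The point \<open>s = 1\<close> is excluded because \<^const>\<open>zeta\<close> has a conventional value there.\<close>

definition nontrivial_zeta_zero :: "complex \<Rightarrow> bool" where
  "nontrivial_zeta_zero s \<longleftrightarrow>
     s \<noteq> 1 \<and> zeta s = 0 \<and> \<not> (\<exists>n::nat. n \<ge> 1 \<and> s = - 2 * of_nat n)"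

definition riemann_hypothesis :: bool where
  "riemann_hypothesis \<longleftrightarrow> (\<forall>s. nontrivial_zeta_zero s \<longrightarrow> Re s = 1 / 2)"

definition RHF_conjecture :: bool where
  "RHF_conjecture \<longleftrightarrow>
     (\<not> riemann_hypothesis \<longrightarrow> infinite {s. zeta s = 0 \<and> 1 / 2 < Re s \<and> Re s < 1})"

text \<open>
  Functions on the unit disk are total functions that vanish outside the disk, so that
  equality of functions is equality on the disk.  Addition is the pointwise one of
  \<^theory>\<open>HOL-Library.Function_Algebras\<close>.
\<close>

abbreviation unit_disk :: "complex set" where
  "unit_disk \<equiv> ball 0 1"

definition fun_scale :: "complex \<Rightarrow> (complex \<Rightarrow> complex) \<Rightarrow> complex \<Rightarrow> complex" where
  "fun_scale c f = (\<lambda>z. c * f z)"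

interpretation fun_vs: vector_space fun_scale
  by unfold_locales (auto simp: fun_scale_def fun_eq_iff algebra_simps)

definition taylor_coeff :: "(complex \<Rightarrow> complex) \<Rightarrow> nat \<Rightarrow> complex" where
  "taylor_coeff f n = (deriv ^^ n) f 0 / fact n"

definition H2 :: "(complex \<Rightarrow> complex) set" where
  "H2 = {f. f holomorphic_on unit_disk \<and> (\<forall>z. z \<notin> unit_disk \<longrightarrow> f z = 0) \<and>
            summable (\<lambda>n. (cmod (taylor_coeff f n))\<^sup>2)}"

definition H2_inner :: "(complex \<Rightarrow> complex) \<Rightarrow> (complex \<Rightarrow> complex) \<Rightarrow> complex" where
  "H2_inner f g = (\<Sum>n. taylor_coeff f n * cnj (taylor_coeff g n))"

definition H2_orthogonal :: "(complex \<Rightarrow> complex) set \<Rightarrow> (complex \<Rightarrow> complex) set" where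
  "H2_orthogonal S = {f \<in> H2. \<forall>g\<in>S. H2_inner f g = 0}"

definition h_log :: "nat \<Rightarrow> complex \<Rightarrow> complex" where
  "h_log k = (THE L. L holomorphic_on unit_disk \<and>
                     (\<forall>z\<in>unit_disk. exp (L z) = (\<Sum>j<k. z ^ j) / of_nat k) \<and>
                     L 0 = of_real (- ln (real k)) \<and>
                     (\<forall>z. z \<notin> unit_disk \<longrightarrow> L z = 0))"

definition h_fun :: "nat \<Rightarrow> complex \<Rightarrow> complex" where
  "h_fun k = (\<lambda>z. if z \<in> unit_disk then 1 / (1 - z) * h_log k z else 0)"

definition N_space :: "(complex \<Rightarrow> complex) set" where
  "N_space = fun_vs.span {h_fun k | k. k \<ge> 2}"

text \<open>
  The library's \<^const>\<open>vector_space.dim\<close> is \<open>0\<close> on infinite-dimensional spaces, whence the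
  case distinction.
\<close>

definition cdim :: "(complex \<Rightarrow> complex) set \<Rightarrow> enat" where
  "cdim V = (if \<exists>B. finite B \<and> V \<subseteq> fun_vs.span B then enat (fun_vs.dim V) else \<infinity>)"

end

theory Submission
  imports Defs
begin

text \<open>
  Let \<open>f\<close> be in \<open>H\<^sup>2\<close> and let \<open>G(n)\<close> be the sum of its first \<open>n\<close> Taylor coefficients.  The
  Taylor coefficients of \<open>h\<^sub>k\<close> are \<open>- log k\<close> plus the partial sums of
  \<open>b\<^sub>k(m) = (1 - k [k | m]) / m\<close>, so Abel summation turns \<open>f \<bottom> h\<^sub>k\<close> into \<open>\<Sum>\<^sub>m b\<^sub>k(m) G(m) = 0\<close>
  (lemmas \<open>h_coeff_abel_summation\<close> and \<open>H2_orthogonal_N_space_iff\<close>).  For \<open>G(m) = m\<^bsup>1 - \<rho>\<^esup>\<close>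
  this sum is \<open>(1 - k\<^bsup>1 - \<rho>\<^esup>) \<zeta>(\<rho>)\<close>, so that every zero \<open>\<rho> \<noteq> 1\<close> of zeta with real part above
  \<open>1/2\<close> yields an element of the orthogonal complement.  Different zeros yield different
  characters, which are linearly independent: infinitely many zeros make the complement
  infinite-dimensional (\<open>infinite_zeros_imp_cdim_infinite\<close>).

  It remains to find one such zero if the complement is finite-dimensional and non-zero; then
  the Riemann Hypothesis fails and the conjecture supplies infinitely many.  Since
  \<open>b\<^bsub>nk\<^esub>(m) - b\<^sub>n(m)\<close> equals \<open>b\<^sub>k(m / n)\<close> if \<open>n\<close> divides \<open>m\<close> and vanishes otherwise, the
  complement is invariant under the commuting dilations \<open>G(m) \<mapsto> G(n m)\<close>
  (\<open>eta_annihilator_dilate\<close>).  In finite dimension these have a common eigenvector, and the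
  eigenvector equation says that \<open>\<lambda>(n) = G(n) / G(1)\<close> is completely multiplicative.  The
  increments of \<open>\<lambda>\<close> are the Taylor coefficients of an \<open>H\<^sup>2\<close> function, hence square-summable, and
  this makes \<open>\<lambda>\<close> rigid.  If \<open>|\<lambda>(p)| < 1\<close> for a single \<open>p\<close>, then \<open>\<Sum> \<lambda>(n) / n\<close> converges absolutely
  (\<open>summable_of_cmod_less_1\<close>), is non-zero by the Euler product
  (\<open>sum_multiplicative_neq_0\<close>), and the orthogonality relations
  \<open>(1 - \<lambda>(k)) \<Sum> \<lambda>(n) / n = 0\<close> are contradictory.  Otherwise \<open>|\<lambda>| \<ge> 1\<close> everywhere, and then
  \<open>\<lambda>(a) / \<lambda>(b)\<close> is close to 1 whenever \<open>a / b\<close> is (\<open>ratio_tendsto_1\<close>), which forces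
  \<open>\<lambda>(n) = n\<^sup>s\<close> (\<open>ratio_continuous_imp_powr\<close>).  Square-summability gives \<open>Re s < 1/2\<close>, and the
  orthogonality relations give \<open>\<zeta>(1 - s) = 0\<close>.

  The analytic continuation of the zeta function to the punctured plane, on which the meaning
  of \<^const>\<open>zeta\<close> rests, is established along the way (\<open>zeta_characterization\<close>).
\<close>

section \<open>Square-summable sequences\<close>

abbreviation incr :: "(nat \<Rightarrow> complex) \<Rightarrow> nat \<Rightarrow> complex" where
  "incr G n \<equiv> G (Suc n) - G n"

definition square_summable :: "(nat \<Rightarrow> complex) \<Rightarrow> bool" where
  "square_summable c \<longleftrightarrow> summable (\<lambda>n. (cmod (c n))\<^sup>2)"

lemma sum_cmod_le_sqrt_card:
  fixes c :: "nat \<Rightarrow> complex"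
  assumes "finite I"
  shows "(\<Sum>i\<in>I. cmod (c i)) \<le> sqrt (real (card I)) * sqrt (\<Sum>i\<in>I. (cmod (c i))\<^sup>2)"
proof -
  have "(\<Sum>i\<in>I. cmod (c i) * 1)\<^sup>2 \<le> (\<Sum>i\<in>I. (cmod (c i))\<^sup>2) * (\<Sum>i\<in>I. 1\<^sup>2)"
    by (rule Cauchy_Schwarz_ineq_sum)
  hence "(\<Sum>i\<in>I. cmod (c i))\<^sup>2 \<le> real (card I) * (\<Sum>i\<in>I. (cmod (c i))\<^sup>2)"
    by (simp add: mult.commute)
  thus ?thesis
    by (metis real_le_rsqrt real_sqrt_mult)
qed

lemma square_summable_sum_le:
  assumes "square_summable c" "finite I"
  shows "(\<Sum>i\<in>I. cmod (c i)) \<le> sqrt (real (card I)) * sqrt (\<Sum>n. (cmod (c n))\<^sup>2)"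
proof -
  have "(\<Sum>i\<in>I. (cmod (c i))\<^sup>2) \<le> (\<Sum>n. (cmod (c n))\<^sup>2)"
    using assms by (intro sum_le_suminf) (auto simp: square_summable_def)
  hence "sqrt (real (card I)) * sqrt (\<Sum>i\<in>I. (cmod (c i))\<^sup>2)
         \<le> sqrt (real (card I)) * sqrt (\<Sum>n. (cmod (c n))\<^sup>2)"
    by (intro mult_left_mono) auto
  with sum_cmod_le_sqrt_card[OF assms(2), of c] show ?thesis by linarith
qed

lemma square_summable_imp_tendsto_0:
  assumes "square_summable c" shows "c \<longlonglongrightarrow> 0"
proof -
  have "(\<lambda>n. (cmod (c n))\<^sup>2) \<longlonglongrightarrow> 0"
    using summable_LIMSEQ_zero[OF assms[unfolded square_summable_def]] .
  hence "(\<lambda>n. sqrt ((cmod (c n))\<^sup>2)) \<longlonglongrightarrow> sqrt 0" by (rule tendsto_real_sqrt)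
  thus ?thesis by (simp add: tendsto_norm_zero_iff)
qed

lemma square_summable_shift:
  "square_summable c \<Longrightarrow> square_summable (\<lambda>n. c (n + k))"
  unfolding square_summable_def by (rule summable_ignore_initial_segment)

text \<open>
  Cauchy--Schwarz gives \<open>O(\<surd>N)\<close>; applying it only to a tail, whose square sum is
  small, improves this to \<open>o(\<surd>N)\<close>.
\<close>

lemma square_summable_partial_sums:
  assumes "square_summable c"
  shows "(\<lambda>N. (\<Sum>n<N. c n) / of_real (sqrt (real N))) \<longlonglongrightarrow> 0"
proof (rule tendsto_norm_zero_cancel, rule LIMSEQ_I)
  fix e :: real assume e: "e > 0"
  have sm: "summable (\<lambda>n. (cmod (c n))\<^sup>2)" using assms by (simp add: square_summable_def)
  define E where "E M = (\<Sum>n. (cmod (c (n + M)))\<^sup>2)" for M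
  have "E \<longlonglongrightarrow> 0" unfolding E_def by (rule suminf_exist_split2[OF sm])
  hence "(\<lambda>M. sqrt (E M)) \<longlonglongrightarrow> sqrt 0" by (rule tendsto_real_sqrt)
  then obtain M where M: "sqrt (E M) < e / 2"
    using e order_tendstoD(2)[of "\<lambda>M. sqrt (E M)" 0 sequentially "e/2"]
    by (auto simp: eventually_sequentially)
  define K where "K = cmod (\<Sum>n<M. c n)"
  have "(\<lambda>N. K / sqrt (real N)) \<longlonglongrightarrow> 0" by real_asymp
  then obtain N0 where N0: "\<And>N. N \<ge> N0 \<Longrightarrow> K / sqrt (real N) < e / 2"
    using e order_tendstoD(2)[of "\<lambda>N. K / sqrt (real N)" 0 sequentially "e/2"]
    by (auto simp: eventually_sequentially)
  show "\<exists>no. \<forall>N\<ge>no. norm (cmod ((\<Sum>n<N. c n) / of_real (sqrt (real N))) - 0) < e"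
  proof (intro exI[of _ "Suc (max M N0)"] allI impI)
    fix N assume N: "N \<ge> Suc (max M N0)"
    have "(\<Sum>n<N. c n) = (\<Sum>n<M. c n) + (\<Sum>n<N-M. c (n + M))"
      using N sum.atLeastLessThan_concat[of 0 M N c] sum.shift_bounds_nat_ivl[of c 0 M "N-M"]
      by (simp add: lessThan_atLeast0)
    hence "cmod (\<Sum>n<N. c n) \<le> K + (\<Sum>n<N-M. cmod (c (n + M)))"
      unfolding K_def by (metis add_left_mono norm_sum norm_triangle_le)
    also have "(\<Sum>n<N-M. cmod (c (n + M))) \<le> sqrt (real (N-M)) * sqrt (E M)"
      unfolding E_def
      using square_summable_sum_le[OF square_summable_shift[OF assms, of M], of "{..<N-M}"] by simp
    also have "\<dots> \<le> sqrt (real N) * sqrt (E M)"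
      unfolding E_def
      by (intro mult_right_mono) (auto intro!: suminf_nonneg summable_ignore_initial_segment sm)
    finally have "cmod (\<Sum>n<N. c n) / sqrt (real N) \<le> K / sqrt (real N) + sqrt (E M)"
      using N by (simp add: field_simps)
    also have "\<dots> < e" using N0[of N] N M by linarith
    finally show "norm (cmod ((\<Sum>n<N. c n) / of_real (sqrt (real N))) - 0) < e"
      by (simp add: norm_divide)
  qed
qed

lemma square_summable_add:
  assumes "square_summable c" "square_summable d"
  shows "square_summable (\<lambda>n. c n + d n)"
  unfolding square_summable_def
proof (rule summable_comparison_test')
  show "summable (\<lambda>n. 2 * (cmod (c n))\<^sup>2 + 2 * (cmod (d n))\<^sup>2)"
    using assms by (intro summable_add summable_mult) (auto simp: square_summable_def)
  fix n
  have "(cmod (c n + d n))\<^sup>2 \<le> (cmod (c n) + cmod (d n))\<^sup>2"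
    by (intro power_mono norm_triangle_ineq) auto
  moreover have "0 \<le> (cmod (c n) - cmod (d n))\<^sup>2" by simp
  ultimately show "norm ((cmod (c n + d n))\<^sup>2) \<le> 2 * (cmod (c n))\<^sup>2 + 2 * (cmod (d n))\<^sup>2"
    by (simp add: power2_diff power2_sum)
qed

lemma square_summable_scale: "square_summable c \<Longrightarrow> square_summable (\<lambda>n. a * c n)"
  unfolding square_summable_def norm_mult power_mult_distrib by (rule summable_mult)

section \<open>Multiplicative functions with square-summable increments\<close>

text \<open>
  A multiplicative distance.  The bound \<open>exp e - 1\<close> is chosen so that errors add up under
  composition, and both quotients are controlled so that the relation is symmetric.
\<close>

definition ratio_close :: "real \<Rightarrow> complex \<Rightarrow> complex \<Rightarrow> bool" where
  "ratio_close e x y \<longleftrightarrow> x \<noteq> 0 \<and> y \<noteq> 0 \<and>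
     cmod (x / y - 1) \<le> exp e - 1 \<and> cmod (y / x - 1) \<le> exp e - 1"

lemma ratio_close_refl: "x \<noteq> 0 \<Longrightarrow> e \<ge> 0 \<Longrightarrow> ratio_close e x x"
  by (simp add: ratio_close_def)

lemma ratio_close_sym: "ratio_close e x y \<Longrightarrow> ratio_close e y x"
  by (auto simp: ratio_close_def)

lemma ratio_close_mono: "ratio_close e x y \<Longrightarrow> e \<le> e' \<Longrightarrow> ratio_close e' x y"
  by (auto simp: ratio_close_def intro: order_trans)

lemma ratio_close_mult_left: "ratio_close e x y \<Longrightarrow> c \<noteq> 0 \<Longrightarrow> ratio_close e (c * x) (c * y)"
  by (auto simp: ratio_close_def)

lemma cmod_mult_minus_1_le:
  assumes "cmod (u - 1) \<le> exp a - 1" "cmod (v - 1) \<le> exp b - 1"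
  shows "cmod (u * v - 1) \<le> exp (a + b) - 1"
proof -
  have "cmod v \<le> exp b" using norm_triangle_ineq[of "v - 1" 1] assms(2) by simp
  have "u * v - 1 = (u - 1) * v + (v - 1)" by (simp add: algebra_simps)
  also have "cmod \<dots> \<le> cmod (u - 1) * cmod v + cmod (v - 1)"
    by (metis norm_mult norm_triangle_ineq)
  also have "\<dots> \<le> (exp a - 1) * exp b + (exp b - 1)"
    using assms \<open>cmod v \<le> exp b\<close> order_trans[OF norm_ge_zero assms(1)]
    by (intro add_mono mult_mono) auto
  finally show ?thesis by (simp add: algebra_simps exp_add)
qed

lemma ratio_close_trans:
  assumes "ratio_close a x y" "ratio_close b y z"
  shows "ratio_close (a + b) x z"
proof -
  have nz: "x \<noteq> 0" "y \<noteq> 0" "z \<noteq> 0" using assms by (auto simp: ratio_close_def)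
  have "cmod (x / y * (y / z) - 1) \<le> exp (a + b) - 1" "cmod (y / x * (z / y) - 1) \<le> exp (a + b) - 1"
    using assms unfolding ratio_close_def by (blast intro: cmod_mult_minus_1_le)+
  thus ?thesis using nz by (simp add: ratio_close_def)
qed

text \<open>
  For values of modulus at least 1 the absolute increments also bound the relative ones.  This
  is where the lower bound on the multiplicative function enters.
\<close>

lemma ratio_close_step:
  assumes "cmod x \<ge> 1" "cmod y \<ge> 1"
  shows "ratio_close (cmod (x - y)) x y"
proof -
  have nz: "x \<noteq> 0" "y \<noteq> 0" using assms by auto
  have "cmod (u / v - 1) \<le> exp (cmod (u - v)) - 1" if "cmod v \<ge> 1" for u v
  proof -
    have "cmod (u / v - 1) = cmod (u - v) / cmod v"
      using that by (subst norm_divide[symmetric], intro arg_cong[of _ _ cmod]) (auto simp: diff_divide_distrib)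
    also have "\<dots> \<le> cmod (u - v)" using that
      by (simp add: divide_le_eq mult_right_le_one_le mult_left_le_one_le)
        (metis norm_ge_zero mult_le_cancel_left1 linorder_not_le)
    also have "\<dots> \<le> exp (cmod (u - v)) - 1" using exp_ge_add_one_self[of "cmod (u - v)"] by linarith
    finally show ?thesis .
  qed
  from this[of y x] this[of x y] show ?thesis
    using nz assms by (simp add: ratio_close_def norm_minus_commute)
qed

lemma ratio_close_interval:
  assumes "\<And>n. n \<ge> 1 \<Longrightarrow> cmod (lam n) \<ge> 1" "1 \<le> u" "u \<le> v"
  shows "ratio_close (\<Sum>m=u..<v. cmod (incr lam m)) (lam v) (lam u)"
  using assms(3)
proof (induction v rule: dec_induct)
  case base
  then show ?case using assms(1)[OF assms(2)] by (auto intro!: ratio_close_refl)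
next
  case (step n)
  have "ratio_close (cmod (incr lam n)) (lam (Suc n)) (lam n)"
    using assms(1)[of n] assms(1)[of "Suc n"] step assms(2) by (intro ratio_close_step) auto
  from ratio_close_trans[OF this step.IH] show ?case using step.hyps by (simp add: add.commute)
qed

text \<open>
  A bound for the relative error that is made when \<open>lam N\<close> is replaced by
  \<open>lam 2 ^ j * lam (N div 2 ^ j)\<close>: each halving costs at most one increment.
\<close>

definition halving_cost :: "(nat \<Rightarrow> complex) \<Rightarrow> nat \<Rightarrow> nat \<Rightarrow> real" where
  "halving_cost lam j N = (\<Sum>i<j. cmod (incr lam (2 * (N div 2 ^ Suc i))))"

lemma halving_cost_Suc:
  "halving_cost lam (Suc j) N = cmod (incr lam (2 * (N div 2))) + halving_cost lam j (N div 2)"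
  unfolding halving_cost_def
  by (subst sum.lessThan_Suc_shift) (simp only: power_Suc div_mult2_eq power_0 mult_1_right div_by_1)

lemma halving_cost_nonneg: "halving_cost lam j N \<ge> 0"
  unfolding halving_cost_def by (intro sum_nonneg) auto

lemma ratio_close_halving:
  assumes big: "\<And>n. n \<ge> 1 \<Longrightarrow> cmod (lam n) \<ge> 1"
    and mult: "\<And>m n. m \<ge> 1 \<Longrightarrow> n \<ge> 1 \<Longrightarrow> lam (m * n) = lam m * lam n"
  shows "2 ^ j \<le> N \<Longrightarrow> ratio_close (halving_cost lam j N) (lam N) (lam 2 ^ j * lam (N div 2 ^ j))"
proof (induction j arbitrary: N)
  case 0
  then show ?case using big[of N] by (auto simp: halving_cost_def intro!: ratio_close_refl)
next
  case (Suc j)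
  have N2: "2 ^ j \<le> N div 2" using Suc.prems by (simp add: less_eq_div_iff_mult_less_eq mult.commute)
  hence pos: "1 \<le> N div 2" by (metis one_le_numeral one_le_power order_trans)
  have "ratio_close (cmod (incr lam (2 * (N div 2)))) (lam N) (lam (2 * (N div 2)))"
  proof (cases "even N")
    case True
    then show ?thesis using big[of N] Suc.prems pos by (auto intro!: ratio_close_refl)
  next
    case False
    then have "N = Suc (2 * (N div 2))" by presburger
    moreover have "ratio_close (cmod (incr lam (2 * (N div 2)))) (lam (Suc (2 * (N div 2)))) (lam (2 * (N div 2)))"
      using pos by (intro ratio_close_step big) auto
    ultimately show ?thesis by metis
  qed
  moreover have "lam (2 * (N div 2)) = lam 2 * lam (N div 2)" using pos by (intro mult) auto
  moreover have "lam 2 \<noteq> 0" using big[of 2] by auto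
  ultimately have "ratio_close (cmod (incr lam (2 * (N div 2))) + halving_cost lam j (N div 2))
     (lam N) (lam 2 * (lam 2 ^ j * lam (N div 2 div 2 ^ j)))"
    using ratio_close_mult_left[OF Suc.IH[OF N2]] by (auto intro: ratio_close_trans)
  thus ?case by (simp add: halving_cost_Suc div_mult2_eq mult.assoc)
qed

lemma sum_div2:
  fixes f :: "nat \<Rightarrow> real"
  shows "(\<Sum>N = 2*a..<2*b. f (N div 2)) = 2 * (\<Sum>v = a..<b. f v)"
proof (cases "a \<le> b")
  case True
  then show ?thesis
  proof (induction b rule: dec_induct)
    case (step n)
    have "{2*a..<2 * Suc n} = insert (Suc (2*n)) (insert (2*n) {2*a..<2*n})" using step by auto
    thus ?case using step by (simp add: algebra_simps)
  qed simp
qed simp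

lemma sum_inverse_sqrt2_powers_le: "(\<Sum>i<j. (1 / sqrt 2) ^ i) \<le> (4::real)"
proof -
  have r: "1 / sqrt 2 \<le> (3/4::real)"
  proof -
    have "4 / 3 \<le> sqrt (2::real)" by (rule real_le_rsqrt) (simp add: power2_eq_square)
    thus ?thesis by (simp add: field_simps)
  qed
  have "(\<Sum>i<j. (1 / sqrt 2) ^ i) \<le> (\<Sum>i<j. (3/4::real) ^ i)"
    by (intro sum_mono power_mono r) auto
  also have "\<dots> \<le> (\<Sum>i. (3/4::real) ^ i)" by (intro sum_le_suminf) auto
  also have "\<dots> = 4" by (subst suminf_geometric) auto
  finally show ?thesis .
qed

text \<open>
  A single value of the cost need not be small, as the increments are merely square-summable.
  On average over \<open>N\<close> in \<open>[2 ^ j M, 2 ^ j 4 M)\<close>, however, the cost is \<open>O(1 / \<surd>M)\<close>, uniformly in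
  \<open>j\<close>: by Cauchy--Schwarz the average of an increment over a block of length \<open>X\<close> is
  \<open>O(1 / \<surd>X)\<close>, and the block lengths form a geometric progression.
\<close>

lemma halving_cost_sum_le:
  assumes "square_summable (incr lam)"
  shows "(\<Sum>N = 2^j*M..<2^j*(4*M). halving_cost lam j N)
     \<le> 2 ^ j * (4 * sqrt (3 * real M) * sqrt (\<Sum>n. (cmod (incr lam n))\<^sup>2))"
proof -
  define E where "E = sqrt (\<Sum>n. (cmod (incr lam n))\<^sup>2)"
  have E0: "E \<ge> 0" unfolding E_def using assms
    by (intro real_sqrt_ge_zero suminf_nonneg) (auto simp: square_summable_def)
  have "(\<Sum>N = 2^j*M..<2^j*(4*M). halving_cost lam j N)
     \<le> 2 ^ j * (sqrt (3 * real M) * E * (\<Sum>i<j. (1 / sqrt 2) ^ i))"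
  proof (induction j)
    case 0
    then show ?case by (simp add: halving_cost_def)
  next
    case (Suc j)
    have "(\<Sum>N = 2^Suc j*M..<2^Suc j*(4*M). halving_cost lam (Suc j) N)
       = (\<Sum>N = 2*(2^j*M)..<2*(2^j*(4*M)). cmod (incr lam (2 * (N div 2))) + halving_cost lam j (N div 2))"
      by (simp add: halving_cost_Suc mult.assoc)
    also have "\<dots> = 2 * (\<Sum>v = 2^j*M..<2^j*(4*M). cmod (incr lam (2 * v)) + halving_cost lam j v)"
      by (rule sum_div2)
    also have "\<dots> = 2 * (\<Sum>v = 2^j*M..<2^j*(4*M). cmod (incr lam (2 * v)))
        + 2 * (\<Sum>v = 2^j*M..<2^j*(4*M). halving_cost lam j v)"
      by (simp add: sum.distrib algebra_simps)
    also have "(\<Sum>v = 2^j*M..<2^j*(4*M). cmod (incr lam (2 * v)))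
       = (\<Sum>u\<in>(*) 2 ` {2^j*M..<2^j*(4*M)}. cmod (incr lam u))"
      by (subst sum.reindex) (auto simp: inj_on_def)
    also have "\<dots> \<le> sqrt (real (card ((*) 2 ` {2^j*M..<2^j*(4*M)}))) * E"
      unfolding E_def by (intro square_summable_sum_le assms) auto
    also have "card ((*) (2::nat) ` {2^j*M..<2^j*(4*M)}) = 2^j * (3 * M)"
      by (subst card_image) (auto simp: inj_on_def algebra_simps)
    also have "sqrt (real (2^j * (3 * M))) = 2 ^ j * (sqrt (3 * real M) * (1 / sqrt 2) ^ j)"
    proof -
      have "(2::real) ^ j = sqrt 2 ^ j * sqrt 2 ^ j" by (simp flip: power_mult_distrib)
      thus ?thesis by (simp add: real_sqrt_mult real_sqrt_power power_divide field_simps)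
    qed
    finally show ?case using Suc.IH by (simp add: algebra_simps)
  qed
  also have "\<dots> \<le> 2 ^ j * (sqrt (3 * real M) * E * 4)"
    by (intro mult_left_mono sum_inverse_sqrt2_powers_le) (use E0 in auto)
  finally show ?thesis by (simp add: E_def algebra_simps)
qed

text \<open>
  Compare \<open>lam a / lam b\<close> with \<open>lam N' / lam N\<close> for a large \<open>N\<close> and \<open>N' = a N div b\<close>: the two
  quotients differ little, since \<open>a N\<close> and \<open>b N'\<close> are less than \<open>b\<close> apart and the increments tend
  to 0.  Dividing \<open>N\<close> and \<open>N'\<close> by a power of 2 brings them down to a size about \<open>M\<close> that depends
  only on \<open>\<epsilon>\<close>; if \<open>a / b\<close> is within \<open>1 / (2 M)\<close> of 1, the resulting integers differ by at most 2.
  The cost of the halvings is small for a suitable \<open>N\<close>, because it is small on average.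
\<close>

lemma ratio_tendsto_1:
  fixes lam :: "nat \<Rightarrow> complex" and \<epsilon> :: real
  assumes big: "\<And>n. n \<ge> 1 \<Longrightarrow> cmod (lam n) \<ge> 1"
    and mult: "\<And>m n. m \<ge> 1 \<Longrightarrow> n \<ge> 1 \<Longrightarrow> lam (m * n) = lam m * lam n"
    and ss: "square_summable (incr lam)"
    and \<epsilon>: "\<epsilon> > 0"
  obtains \<delta> where "\<delta> > 0"
    "\<And>a b::nat. 1 \<le> b \<Longrightarrow> b \<le> a \<Longrightarrow> real a \<le> (1 + \<delta>) * real b \<Longrightarrow> cmod (lam a / lam b - 1) \<le> \<epsilon>"
proof -
  define \<eta> where "\<eta> = ln (1 + \<epsilon>) / 3"
  have \<eta>: "\<eta> > 0" using \<epsilon> by (simp add: \<eta>_def)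
  define E where "E = sqrt (\<Sum>n. (cmod (incr lam n))\<^sup>2)"
  have small: "\<exists>M. \<forall>m\<ge>M. cmod (incr lam m) \<le> c" if "c > 0" for c
    using LIMSEQ_D[OF square_summable_imp_tendsto_0[OF ss] that] by (auto intro: less_imp_le)
  obtain M1 where M1: "\<And>m. m \<ge> M1 \<Longrightarrow> cmod (incr lam m) \<le> \<eta> / 2" using small[of "\<eta>/2"] \<eta> by auto
  have "(\<lambda>M. 8 * sqrt (3 * real M) * E / real M) \<longlonglongrightarrow> 0" by real_asymp
  then obtain M2 where M2: "\<And>M. M \<ge> M2 \<Longrightarrow> 8 * sqrt (3 * real M) * E / real M < \<eta>"
    using \<eta> order_tendstoD(2)[of "\<lambda>M. 8 * sqrt (3 * real M) * E / real M" 0 sequentially \<eta>]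
    by (auto simp: eventually_sequentially)
  define M where "M = max 1 (max M1 M2)"
  have M: "M \<ge> 1" "M \<ge> M1" "M \<ge> M2" by (auto simp: M_def)
  define \<delta> where "\<delta> = 1 / (2 * real M)"
  have \<delta>: "\<delta> > 0" "\<delta> \<le> 1" using M by (auto simp: \<delta>_def field_simps)
  have "cmod (lam a / lam b - 1) \<le> \<epsilon>"
    if ab: "1 \<le> b" "b \<le> a" "real a \<le> (1 + \<delta>) * real b" for a b :: nat
  proof -
    \<comment> \<open>This bound depends on \<open>b\<close>; it only influences how large \<open>N\<close> is taken.\<close>
    obtain X0 where X0: "\<And>m. m \<ge> X0 \<Longrightarrow> cmod (incr lam m) \<le> \<eta> / b"
      using small[of "\<eta> / b"] \<eta> ab by auto
    obtain j where j: "X0 < 2 ^ j" using less_exp by blast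
    define X where "X = 2 ^ j * M"
    have X: "X \<ge> X0" "X \<ge> 1" "2 ^ j \<le> X"
      using j M by (auto simp: X_def intro: order_trans[of _ "2^j"])
    define \<phi> where "\<phi> N = a * N div b" for N
    define hc where "hc = halving_cost lam j"
    have \<phi>_le: "b * \<phi> N \<le> a * N" "a * N < b * \<phi> N + b" for N
      unfolding \<phi>_def using ab(1) dividend_less_div_times[of b "a * N"]
      by (auto simp: algebra_simps)
    have \<phi>_ge: "N \<le> \<phi> N" for N
      unfolding \<phi>_def using ab by (simp add: less_eq_div_iff_mult_less_eq mult.commute)
    have \<phi>_le2: "real (\<phi> N) \<le> (1 + \<delta>) * real N" for N
    proof -
      have "real b * real (\<phi> N) \<le> real a * real N"
        using \<phi>_le(1)[of N] by (metis of_nat_le_iff of_nat_mult)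
      also have "\<dots> \<le> (1 + \<delta>) * real b * real N" using ab(3) by (intro mult_right_mono) auto
      finally show ?thesis using ab(1) by (simp add: mult.assoc mult.left_commute)
    qed
    \<comment> \<open>Injectivity lets the average over \<open>\<phi> N\<close> be bounded by the average over all integers.\<close>
    have "strict_mono \<phi>"
    proof (rule strict_monoI)
      fix m n :: nat assume "m < n"
      hence "a * m + a \<le> a * n" by (metis Suc_leI mult_Suc_right mult_le_mono2 add.commute)
      hence "b * \<phi> m + b \<le> a * n" using \<phi>_le(1)[of m] ab(2) by linarith
      hence "b * \<phi> m < b * \<phi> n" using \<phi>_le(2)[of n] by linarith
      thus "\<phi> m < \<phi> n" by simp
    qed
    define S where "S = (\<Sum>N = X..<4*X. hc N)"
    have S: "S \<le> 2 ^ j * (4 * sqrt (3 * real M) * E)"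
      using halving_cost_sum_le[OF ss, of j M] by (simp add: S_def X_def hc_def E_def mult.left_commute)
    have hc0: "hc N \<ge> 0" for N by (simp add: hc_def halving_cost_nonneg)
    have "(\<Sum>N = X..<2*X. hc N + hc (\<phi> N)) = (\<Sum>N = X..<2*X. hc N) + (\<Sum>N\<in>\<phi> ` {X..<2*X}. hc N)"
      using \<open>strict_mono \<phi>\<close>
      by (subst sum.reindex) (auto simp: sum.distrib strict_mono_imp_inj_on)
    also have "\<dots> \<le> S + S"
    proof (unfold S_def, intro add_mono sum_mono2)
      show "\<phi> ` {X..<2*X} \<subseteq> {X..<4*X}"
      proof (intro image_subsetI)
        fix N assume N: "N \<in> {X..<2*X}"
        have "real (\<phi> N) \<le> 2 * real N"
          using \<phi>_le2[of N] mult_right_mono[of "1 + \<delta>" 2 "real N"] \<delta> by linarith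
        also have "\<dots> < real (4 * X)" using N by auto
        finally have "\<phi> N < 4 * X" by linarith
        thus "\<phi> N \<in> {X..<4*X}" using \<phi>_ge[of N] N by auto
      qed
    qed (auto simp: hc0)
    finally have sum_le: "(\<Sum>N = X..<2*X. hc N + hc (\<phi> N)) \<le> S + S" .
    have "\<exists>N\<in>{X..<2*X}. hc N + hc (\<phi> N) \<le> \<eta>"
    proof (rule ccontr)
      assume "\<not> ?thesis"
      hence "(\<Sum>N = X..<2*X. \<eta>) \<le> (\<Sum>N = X..<2*X. hc N + hc (\<phi> N))"
        by (intro sum_mono) (auto simp: not_le intro: less_imp_le)
      also have "\<dots> \<le> 2 ^ j * (8 * sqrt (3 * real M) * E)" using sum_le S by simp
      also have "\<dots> < 2 ^ j * (\<eta> * real M)"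
        using M2[OF M(3)] M(1) by (simp add: field_simps)
      finally show False by (simp add: X_def mult.commute mult.left_commute)
    qed
    then obtain N where N: "X \<le> N" "N < 2 * X" "hc N + hc (\<phi> N) \<le> \<eta>" by auto
    have N1: "1 \<le> N" "1 \<le> \<phi> N" using X N \<phi>_ge[of N] by auto
    define u v where "u = N div 2 ^ j" and "v = \<phi> N div 2 ^ j"
    have uM: "M \<le> u" using N(1) unfolding u_def X_def
      by (simp add: less_eq_div_iff_mult_less_eq mult.commute)
    have uv: "u \<le> v" unfolding u_def v_def by (intro div_le_mono \<phi>_ge)
    have "v \<le> u + 2"
    proof -
      have "real v * 2 ^ j \<le> real (\<phi> N)"
        by (metis v_def of_nat_le_iff of_nat_mult of_nat_numeral of_nat_power div_times_less_eq_dividend)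
      also have "\<dots> \<le> real N + \<delta> * real N" using \<phi>_le2[of N] by (simp add: algebra_simps)
      also have "\<dots> \<le> real N + \<delta> * (2 * real X)" using N \<delta> by (intro add_left_mono mult_left_mono) auto
      also have "\<dots> = real N + 2 ^ j" using M by (simp add: \<delta>_def X_def)
      also have "real N < (real u + 1) * 2 ^ j"
      proof -
        have "N < 2 ^ j * u + 2 ^ j" unfolding u_def
          using dividend_less_div_times[of "2^j" N] by (simp add: algebra_simps)
        hence "real N < real (2 ^ j * u + 2 ^ j)" by (simp only: of_nat_less_iff)
        thus ?thesis by (simp add: algebra_simps)
      qed
      finally have "real v * 2 ^ j < (real u + 2) * 2 ^ j" by (simp add: algebra_simps)
      hence "real v < real u + 2" by simp
      thus ?thesis by linarith
    qed
    have c3: "ratio_close \<eta> (lam v) (lam u)"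
    proof -
      have "(\<Sum>m = u..<v. cmod (incr lam m)) \<le> real (card {u..<v}) * (\<eta> / 2)"
        using uM M by (intro sum_bounded_above M1) auto
      also have "\<dots> \<le> 2 * (\<eta> / 2)" using \<open>v \<le> u + 2\<close> \<eta> by (intro mult_right_mono) auto
      finally show ?thesis
        using ratio_close_interval[of lam u v] big uM M uv by (auto intro: ratio_close_mono)
    qed
    have c1: "ratio_close \<eta> (lam (a * N)) (lam (b * \<phi> N))"
    proof -
      have pos: "1 \<le> b * \<phi> N" using ab N1 by (metis mult_le_mono nat_mult_1)
      have XX: "X0 \<le> b * \<phi> N" using X(1) N(1) \<phi>_ge[of N] ab(1)
        by (metis le_trans mult_le_mono nat_mult_1)
      have "(\<Sum>m = b * \<phi> N..<a * N. cmod (incr lam m)) \<le> real (card {b * \<phi> N..<a * N}) * (\<eta> / b)"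
        using XX by (intro sum_bounded_above X0) auto
      also have "\<dots> \<le> b * (\<eta> / b)" using \<phi>_le(2)[of N] \<eta> by (intro mult_right_mono) auto
      also have "\<dots> = \<eta>" using ab by simp
      finally show ?thesis
        using ratio_close_interval[of lam "b * \<phi> N" "a * N"] big pos \<phi>_le(1)[of N]
        by (auto intro: ratio_close_mono)
    qed
    have L: "lam 2 ^ j \<noteq> 0" "lam b \<noteq> 0" "lam N \<noteq> 0" using big[of 2] big[of b] big[of N] ab N1 by auto
    have "ratio_close (hc (\<phi> N)) (lam (\<phi> N)) (lam 2 ^ j * lam v)"
      unfolding hc_def v_def using X N \<phi>_ge[of N] by (intro ratio_close_halving big mult) auto
    also note ratio_close_trans[OF this ratio_close_mult_left[OF c3 L(1)]]
    moreover have "ratio_close (hc N) (lam N) (lam 2 ^ j * lam u)"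
      unfolding hc_def u_def using X N by (intro ratio_close_halving big mult) auto
    ultimately have "ratio_close (hc (\<phi> N) + \<eta> + hc N) (lam (\<phi> N)) (lam N)"
      by (blast intro: ratio_close_trans ratio_close_sym)
    from ratio_close_mult_left[OF this L(2)]
    have "ratio_close (\<eta> + (hc (\<phi> N) + \<eta> + hc N)) (lam a * lam N) (lam b * lam N)"
      using ratio_close_trans[OF c1[unfolded mult[OF le_trans[OF ab(1,2)] N1(1)] mult[OF ab(1) N1(2)]]]
      by blast
    hence "ratio_close (3 * \<eta>) (lam a * lam N) (lam b * lam N)"
      by (rule ratio_close_mono) (use N(3) in auto)
    hence "cmod (lam a / lam b - 1) \<le> exp (3 * \<eta>) - 1"
      using L by (simp add: ratio_close_def)
    thus ?thesis using \<epsilon> by (simp add: \<eta>_def)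
  qed
  with \<delta>(1) that show ?thesis by blast
qed

lemma multiplicative_power:
  fixes lam :: "nat \<Rightarrow> complex"
  assumes "\<And>m n. m \<ge> 1 \<Longrightarrow> n \<ge> 1 \<Longrightarrow> lam (m * n) = lam m * lam n" "lam 1 = 1" "n \<ge> 1"
  shows "lam (n ^ k) = lam n ^ k"
proof (induction k)
  case (Suc k)
  have "n ^ k \<ge> 1" using assms(3) by simp
  thus ?case using Suc assms(1)[of n "n^k"] assms(3) by simp
qed (use assms in simp)

text \<open>
  A character of the positive rationals that is continuous at 1 is a power.  Take
  \<open>r = 1 + 1 / n\<close> as unit of length and write \<open>lam (n + 1) / lam n = r\<^bsup>s n\<^esup>\<close> by means of the
  principal logarithm.  Every \<open>q\<close> lies between two consecutive powers of \<open>r\<close>, so \<open>lam q\<close> is close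
  to \<open>q\<^bsup>s n\<^esup>\<close>.  The exponents \<open>s n\<close> are bounded and hence have a limit point.
\<close>

lemma ratio_continuous_imp_powr:
  fixes lam :: "nat \<Rightarrow> complex"
  assumes nz: "\<And>n. n \<ge> 1 \<Longrightarrow> lam n \<noteq> 0"
    and mult: "\<And>m n. m \<ge> 1 \<Longrightarrow> n \<ge> 1 \<Longrightarrow> lam (m * n) = lam m * lam n"
    and one: "lam 1 = 1"
    and cont: "\<And>\<epsilon>. \<epsilon> > 0 \<Longrightarrow> \<exists>\<delta>>0. \<forall>a b. 1 \<le> b \<longrightarrow> b \<le> a \<longrightarrow> real a \<le> (1 + \<delta>) * real b \<longrightarrow>
                  cmod (lam a / lam b - 1) \<le> \<epsilon>"
  shows "\<exists>s. \<forall>n\<ge>1. lam n = of_nat n powr s"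
proof -
  note pw = multiplicative_power[of lam, OF mult one]
  define \<nu> where "\<nu> n = Ln (lam (Suc n) / lam n)" for n
  define l where "l n = ln (1 + 1 / real n)" for n
  define s where "s n = \<nu> n / of_real (l n)" for n
  have l_pos: "l n > 0" if "n \<ge> 1" for n using that by (auto simp: l_def intro!: ln_gt_zero)
  have exp_l: "exp (real k * l n) = real (Suc n ^ k) / real (n ^ k)" if "n \<ge> 1" for k n
  proof -
    have "exp (real k * l n) = (1 + 1 / real n) ^ k"
      using that by (simp add: l_def exp_of_nat_mult add_pos_nonneg)
    also have "1 + 1 / real n = real (Suc n) / real n" using that by (simp add: field_simps)
    finally show ?thesis by (simp add: power_divide)
  qed
  have exp_\<nu>: "exp (of_nat k * \<nu> n) = lam (Suc n ^ k) / lam (n ^ k)" if "n \<ge> 1" for k n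
    using that nz[of n] nz[of "Suc n"] by (simp add: \<nu>_def exp_of_nat_mult pw power_divide)
  have l_lim: "l \<longlonglongrightarrow> 0" unfolding l_def by real_asymp
  obtain \<delta> where \<delta>: "\<delta> > 0" and \<delta>':
    "\<And>a b. 1 \<le> b \<Longrightarrow> b \<le> a \<Longrightarrow> real a \<le> (1 + \<delta>) * real b \<Longrightarrow> cmod (lam a / lam b - 1) \<le> 1 / 8"
    using cont[of "1/8"] by auto
  define D where "D = ln (1 + \<delta>)"
  have D: "D > 0" using \<delta> by (simp add: D_def)
  have ev1: "\<forall>\<^sub>F n in sequentially. l n < D / 2"
    using order_tendstoD(2)[OF l_lim, of "D/2"] D by simp
  \<comment> \<open>As long as \<open>r ^ k\<close> stays near 1, so does \<open>exp (k \<nu>)\<close>; moving in small steps, \<open>k \<nu>\<close> cannot jump to another period of exp.\<close>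
  have bnd: "cmod (s n) \<le> 1 / D" if n: "n \<ge> 1" "l n < D / 2" for n
  proof -
    have near: "cmod (exp (of_nat k * \<nu> n) - 1) \<le> 1 / 8" if "real k * l n \<le> D" for k
    proof -
      have "exp (real k * l n) \<le> exp D" using that by simp
      hence "real (Suc n ^ k) / real (n ^ k) \<le> 1 + \<delta>" using exp_l[OF n(1), of k] \<delta> by (simp add: D_def)
      hence "real (Suc n ^ k) \<le> (1 + \<delta>) * real (n ^ k)" using n(1) by (simp add: field_simps)
      thus ?thesis unfolding exp_\<nu>[OF n(1)] using n(1)
        by (intro \<delta>') (auto intro: power_mono)
    qed
    have Ln_small: "cmod z \<le> 1 / 4" if "cmod (exp z - 1) \<le> 1 / 8" "cmod z \<le> 1" for z
    proof -
      have "\<bar>Im z\<bar> \<le> 1" using abs_Im_le_cmod[of z] that(2) by linarith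
      hence "Ln (exp z) = z" using pi_gt3 by (intro Ln_exp) auto
      hence "cmod z = cmod (Ln (1 + (exp z - 1)))" by simp
      also have "\<dots> \<le> 2 * cmod (exp z - 1)" using that by (intro norm_Ln_le) auto
      finally show ?thesis using that by simp
    qed
    have \<nu>1: "cmod (\<nu> n) \<le> 1 / 4"
    proof -
      have "real 1 * l n \<le> D" using n D by simp
      from near[OF this] have *: "cmod (lam (Suc n) / lam n - 1) \<le> 1 / 8"
        using exp_\<nu>[OF n(1), of 1] by simp
      have "cmod (\<nu> n) = cmod (Ln (1 + (lam (Suc n) / lam n - 1)))" by (simp add: \<nu>_def)
      also have "\<dots> \<le> 2 * cmod (lam (Suc n) / lam n - 1)" using * by (intro norm_Ln_le) auto
      finally show ?thesis using * by simp
    qed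
    have k\<nu>: "real k * l n \<le> D \<Longrightarrow> cmod (of_nat k * \<nu> n) \<le> 1 / 4" for k
    proof (induction k)
      case (Suc k)
      have "real k * l n \<le> D" using Suc.prems l_pos[OF n(1)] by (simp add: algebra_simps)
      from Suc.IH[OF this] \<nu>1 have "cmod (of_nat k * \<nu> n + \<nu> n) \<le> 1 / 4 + 1 / 4"
        by (intro norm_triangle_le add_mono)
      hence "cmod (of_nat (Suc k) * \<nu> n) \<le> 1" by (simp add: algebra_simps)
      thus ?case using near[OF Suc.prems] Ln_small by blast
    qed simp
    define K where "K = nat \<lfloor>D / l n\<rfloor>"
    have K: "real K \<le> D / l n" "D / l n < real K + 1"
      using D l_pos[OF n(1)] by (auto simp: K_def)
    have Kl: "real K * l n \<le> D" "D < real K * l n + l n"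
      using K l_pos[OF n(1)] by (auto simp: field_simps)
    have "cmod (s n) * (real K * l n) = cmod (of_nat K * \<nu> n)"
      using l_pos[OF n(1)] by (simp add: s_def norm_divide norm_mult)
    also have "\<dots> \<le> 1 / 4" by (rule k\<nu>[OF Kl(1)])
    finally have "cmod (s n) * (real K * l n) \<le> 1 / 4" .
    moreover have "cmod (s n) * (D / 2) \<le> cmod (s n) * (real K * l n)"
      using Kl n by (intro mult_left_mono) auto
    ultimately have "cmod (s n) * (D / 2) \<le> 1 / 4" by linarith
    thus ?thesis using D by (simp add: field_simps)
  qed
  obtain n0 where n0: "\<And>n. n \<ge> n0 \<Longrightarrow> l n < D / 2" using ev1 by (auto simp: eventually_sequentially)
  define t where "t n = s (n + Suc n0)" for n
  have "\<forall>n. t n \<in> cball 0 (1 / D)"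
    using bnd n0 by (auto simp: t_def)
  then obtain z r where r: "strict_mono r" "(t \<circ> r) \<longlonglongrightarrow> z"
    using compact_cball[of "0::complex" "1/D"] unfolding compact_def by blast
  have "lam q = of_nat q powr z" if q: "q \<ge> 1" for q
  proof -
    define k where "k n = nat \<lfloor>ln (real q) / l n\<rfloor>" for n
    have k: "real (k n) * l n \<le> ln (real q)" "ln (real q) < real (k n) * l n + l n" if "n \<ge> 1" for n
    proof -
      have "real (k n) \<le> ln (real q) / l n" "ln (real q) / l n < real (k n) + 1"
        using q l_pos[OF that] by (auto simp: k_def)
      thus "real (k n) * l n \<le> ln (real q)" "ln (real q) < real (k n) * l n + l n"
        using l_pos[OF that] by (auto simp: field_simps)
    qed
    have kl: "(\<lambda>n. real (k n) * l n) \<longlonglongrightarrow> ln (real q)"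
    proof (rule tendsto_sandwich[of "\<lambda>n. ln (real q) - l n" _ _ "\<lambda>n. ln (real q)"])
      show "(\<lambda>n. ln (real q) - l n) \<longlonglongrightarrow> ln (real q)"
        using tendsto_diff[OF tendsto_const l_lim, of "ln (real q)"] by simp
      show "\<forall>\<^sub>F n in sequentially. ln (real q) - l n \<le> real (k n) * l n"
        using k(2) by (intro eventually_sequentiallyI[of 1]) (simp add: diff_le_eq less_imp_le)
      show "\<forall>\<^sub>F n in sequentially. real (k n) * l n \<le> ln (real q)"
        using k(1) by (intro eventually_sequentiallyI[of 1]) simp
    qed simp
    have lim1: "(\<lambda>n. lam q / exp (of_nat (k n) * \<nu> n)) \<longlonglongrightarrow> 1"
    proof (rule LIMSEQ_I)
      fix e :: real assume "e > 0"
      then obtain \<gamma> where \<gamma>: "\<gamma> > 0" and \<gamma>':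
        "\<And>a b. 1 \<le> b \<Longrightarrow> b \<le> a \<Longrightarrow> real a \<le> (1 + \<gamma>) * real b \<Longrightarrow> cmod (lam a / lam b - 1) \<le> e / 2"
        using cont[of "e/2"] by auto
      obtain n1 where n1: "1 / \<gamma> < real n1" using reals_Archimedean2 by blast
      show "\<exists>no. \<forall>n\<ge>no. cmod (lam q / exp (of_nat (k n) * \<nu> n) - 1) < e"
      proof (intro exI[of _ "Suc n1"] allI impI)
        fix n assume "n \<ge> Suc n1"
        hence n: "n \<ge> 1" "1 / real n \<le> \<gamma>" using n1 \<gamma> by (auto simp: field_simps intro: less_imp_le)
          (smt (verit) of_nat_mono mult_left_mono Suc_leD)
        have "real (Suc n ^ k n) / real (n ^ k n) \<le> real q"
          using k(1)[OF n(1)] q exp_l[OF n(1), of "k n"] by (metis exp_le_cancel_iff exp_ln of_nat_0_less_iff less_le_trans zero_less_one)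
        hence ge: "Suc n ^ k n \<le> q * n ^ k n"
          using n(1) by (simp add: divide_le_eq flip: of_nat_mult of_nat_power) 
        have "real q < exp (real (k n) * l n) * exp (l n)"
          using k(2)[OF n(1)] q by (metis exp_add exp_less_cancel_iff exp_ln of_nat_0_less_iff less_le_trans zero_less_one)
        also have "exp (l n) = 1 + 1 / real n" using n(1) by (simp add: l_def add_pos_nonneg)
        also have "exp (real (k n) * l n) * (1 + 1 / real n) \<le> exp (real (k n) * l n) * (1 + \<gamma>)"
          using n by (intro mult_left_mono) auto
        finally have "real q < real (Suc n ^ k n) / real (n ^ k n) * (1 + \<gamma>)"
          using exp_l[OF n(1)] by simp
        hence "real (q * n ^ k n) \<le> (1 + \<gamma>) * real (Suc n ^ k n)"
          using n(1) by (simp add: field_simps)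
        from \<gamma>'[OF _ ge this] have "cmod (lam (q * n ^ k n) / lam (Suc n ^ k n) - 1) \<le> e / 2" by simp
        also have "lam (q * n ^ k n) / lam (Suc n ^ k n) = lam q / exp (of_nat (k n) * \<nu> n)"
          using n(1) q by (simp add: exp_\<nu> mult)
        finally show "cmod (lam q / exp (of_nat (k n) * \<nu> n) - 1) < e" using \<open>e > 0\<close> by simp
      qed
    qed
    define R where "R n = r n + Suc n0" for n
    have R: "strict_mono R" using r(1) by (auto simp: R_def strict_mono_def)
    have eq: "of_nat (k (R n)) * \<nu> (R n) = t (r n) * of_real (real (k (R n)) * l (R n))" for n
      using l_pos[of "R n"] by (simp add: t_def s_def R_def)
    have "(\<lambda>n. of_nat (k (R n)) * \<nu> (R n)) \<longlonglongrightarrow> z * of_real (ln (real q))"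
      unfolding eq using r(2) LIMSEQ_subseq_LIMSEQ[OF kl R]
      by (intro tendsto_mult tendsto_of_real) (auto simp: o_def)
    hence "(\<lambda>n. lam q / exp (of_nat (k (R n)) * \<nu> (R n))) \<longlonglongrightarrow> lam q / exp (z * of_real (ln (real q)))"
      by (intro tendsto_divide[OF tendsto_const] tendsto_exp) auto
    moreover have "(\<lambda>n. lam q / exp (of_nat (k (R n)) * \<nu> (R n))) \<longlonglongrightarrow> 1"
      using LIMSEQ_subseq_LIMSEQ[OF lim1 R] by (simp add: o_def)
    ultimately have "lam q / exp (z * of_real (ln (real q))) = 1" by (rule LIMSEQ_unique)
    hence "lam q = exp (z * of_real (ln (real q)))" by simp
    also have "\<dots> = of_nat q powr z" using q by (simp add: powr_def Ln_of_nat)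
    finally show ?thesis .
  qed
  thus ?thesis by blast
qed

section \<open>Absolutely convergent sums of multiplicative functions\<close>

lemma incr_shift_le:
  fixes lam :: "nat \<Rightarrow> complex"
  shows "cmod (lam (n + i)) \<le> cmod (lam n) + (\<Sum>j<i. cmod (incr lam (n + j)))"
proof (induction i)
  case (Suc i)
  have "cmod (lam (n + Suc i)) \<le> cmod (lam (n + i)) + cmod (incr lam (n + i))"
    using norm_triangle_ineq[of "lam (n+i)" "incr lam (n+i)"] by simp
  with Suc show ?case by simp
qed simp

lemma summable_inverse_mult_square_summable:
  assumes "square_summable c"
  shows "summable (\<lambda>n. cmod (c n) / real n)"
proof (rule summable_comparison_test')
  have "summable (\<lambda>n. 1 / real n ^ 2)" using inverse_power_summable[of 2, where 'a=real]
    by (simp add: inverse_eq_divide)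
  thus "summable (\<lambda>n. (cmod (c n))\<^sup>2 + 1 / real n ^ 2)"
    using assms by (intro summable_add) (auto simp: square_summable_def)
  fix n :: nat
  have "0 \<le> (cmod (c n) - 1 / real n)\<^sup>2" by simp
  hence "2 * (cmod (c n) / real n) \<le> (cmod (c n))\<^sup>2 + 1 / real n ^ 2"
    by (simp add: power2_diff power_divide)
  moreover have "0 \<le> cmod (c n) / real n" by simp
  ultimately have "cmod (c n) / real n \<le> (cmod (c n))\<^sup>2 + 1 / real n ^ 2" by linarith
  thus "norm (cmod (c n) / real n) \<le> (cmod (c n))\<^sup>2 + 1 / real n ^ 2" by simp
qed

lemma sum_mult_group:
  fixes f :: "nat \<Rightarrow> real"
  shows "(\<Sum>n=p..<p*N. f n) = (\<Sum>m=1..<N. \<Sum>i<p. f (p * m + i))"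
proof (induction N)
  case (Suc N)
  show ?case
  proof (cases "N = 0")
    case False
    have "(\<Sum>n=p..<p*Suc N. f n) = (\<Sum>n=p..<p*N. f n) + (\<Sum>n=p*N..<p*N+p. f n)"
      using False by (subst sum.atLeastLessThan_concat) (auto simp: algebra_simps)
    also have "(\<Sum>n=p*N..<p*N+p. f n) = (\<Sum>i<p. f (p * N + i))"
      using sum.shift_bounds_nat_ivl[of f 0 "p*N" p] by (simp add: lessThan_atLeast0 add.commute)
    finally show ?thesis using Suc False by simp
  qed simp
qed simp

text \<open>
  Let \<open>T N\<close> be the sum of \<open>cmod (lam n) / n\<close> over \<open>1 \<le> n < N\<close>.  Up to increments, whose
  contribution is bounded because the increments divided by \<open>n\<close> are absolutely
  summable, the \<open>p\<close> terms with \<open>n div p = m\<close> have total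
  \<open>cmod (lam p) * cmod (lam m) / m\<close>.  Hence \<open>T N \<le> T (p N) \<le> C + cmod (lam p) * T N\<close>, which
  bounds \<open>T\<close>.
\<close>

lemma summable_of_cmod_less_1:
  fixes lam :: "nat \<Rightarrow> complex"
  assumes mult: "\<And>m n. m \<ge> 1 \<Longrightarrow> n \<ge> 1 \<Longrightarrow> lam (m * n) = lam m * lam n"
    and ss: "square_summable (incr lam)"
    and p: "p \<ge> 1" "cmod (lam p) < 1"
  shows "summable (\<lambda>n. cmod (lam n) / real n)"
proof -
  define T where "T N = (\<Sum>n=1..<N. cmod (lam n) / real n)" for N
  define C where "C = (\<Sum>n. cmod (incr lam n) / real n)"
  have smC: "summable (\<lambda>n. cmod (incr lam n) / real n)"
    by (rule summable_inverse_mult_square_summable[OF ss])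
  have T_mono: "T m \<le> T n" if "m \<le> n" for m n
    unfolding T_def using that by (intro sum_mono2) auto
  have rec: "T (p * N) \<le> T p + cmod (lam p) * T N + 2 * p * C" if "N \<ge> 1" for N
  proof -
    have step: "(\<Sum>i<p. cmod (lam (p * m + i)) / real (p * m + i))
       \<le> cmod (lam p) * (cmod (lam m) / real m) + 2 * p * (\<Sum>i<p. cmod (incr lam (p * m + i)) / real (p * m + i))"
      if m: "m \<ge> 1" for m
    proof -
      define I where "I = (\<Sum>i<p. cmod (incr lam (p * m + i)))"
      have pm: "real (p * m) > 0" using m p by simp
      have "(\<Sum>i<p. cmod (lam (p * m + i)) / real (p * m + i)) \<le> (\<Sum>i<p. (cmod (lam p) * cmod (lam m) + I) / real (p * m))"
      proof (intro sum_mono frac_le)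
        fix i assume i: "i \<in> {..<p}"
        have "(\<Sum>j<i. cmod (incr lam (p * m + j))) \<le> I"
          unfolding I_def using i by (intro sum_mono2) auto
        thus "cmod (lam (p * m + i)) \<le> cmod (lam p) * cmod (lam m) + I"
          using incr_shift_le[of lam "p*m" i] mult[OF p(1) m] by (simp add: norm_mult)
      qed (use pm in \<open>auto simp: I_def intro!: add_nonneg_nonneg sum_nonneg\<close>)
      also have "\<dots> = cmod (lam p) * (cmod (lam m) / real m) + p * (I / real (p * m))"
        using p m by (simp add: field_simps)
      also have "I / real (p * m) = (\<Sum>i<p. cmod (incr lam (p * m + i)) / real (p * m))"
        unfolding I_def by (rule sum_divide_distrib)
      also have "\<dots> \<le> (\<Sum>i<p. 2 * (cmod (incr lam (p * m + i)) / real (p * m + i)))"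
      proof (rule sum_mono)
        fix i assume "i \<in> {..<p}"
        hence "p * m + i \<le> 2 * (p * m)" using m
          by (metis add_left_mono lessThan_iff less_imp_le mult_2 mult_le_mono2 nat_mult_1_right order_trans)
        hence le: "real (p * m + i) \<le> 2 * real (p * m)" by (metis of_nat_le_iff of_nat_mult of_nat_numeral)
        show "cmod (incr lam (p * m + i)) / real (p * m) \<le> 2 * (cmod (incr lam (p * m + i)) / real (p * m + i))"
          using mult_left_mono[OF le, of "cmod (incr lam (p * m + i))"] pm by (simp add: field_simps)
      qed
      finally show ?thesis using p by (simp add: sum_distrib_left mult_left_mono algebra_simps)
    qed
    have group: "(\<Sum>n=p..<p*N. cmod (incr lam n) / real n)
        = (\<Sum>m=1..<N. \<Sum>i<p. cmod (incr lam (p * m + i)) / real (p * m + i))"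
      by (rule sum_mult_group)
    have "T (p * N) = T p + (\<Sum>n=p..<p*N. cmod (lam n) / real n)"
      unfolding T_def using p that by (subst sum.atLeastLessThan_concat) auto
    moreover have "(\<Sum>n=p..<p*N. cmod (lam n) / real n) \<le> cmod (lam p) * T N + real (2 * p) * C"
    proof -
      have "(\<Sum>n=p..<p*N. cmod (lam n) / real n) = (\<Sum>m=1..<N. \<Sum>i<p. cmod (lam (p * m + i)) / real (p * m + i))"
        by (rule sum_mult_group)
      also have "\<dots> \<le> (\<Sum>m=1..<N. cmod (lam p) * (cmod (lam m) / real m) + 2 * p * (\<Sum>i<p. cmod (incr lam (p * m + i)) / real (p * m + i)))"
        by (intro sum_mono step) auto
      also have "\<dots> = cmod (lam p) * T N + 2 * p * (\<Sum>n=p..<p*N. cmod (incr lam n) / real n)"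
        by (simp only: T_def sum.distrib group sum_distrib_left[symmetric])
      also have "\<dots> \<le> cmod (lam p) * T N + real (2 * p) * C"
        unfolding C_def by (intro add_left_mono mult_left_mono sum_le_suminf smC) auto
      finally show ?thesis .
    qed
    ultimately show ?thesis by simp
  qed
  define B where "B = (T p + 2 * p * C) / (1 - cmod (lam p))"
  have bound: "T N \<le> B" if "N \<ge> 1" for N
  proof -
    have "T N \<le> T (p * N)" using p by (intro T_mono) simp
    with rec[OF that] have "T N * (1 - cmod (lam p)) \<le> T p + 2 * p * C" by (simp add: algebra_simps)
    thus ?thesis using p by (simp add: B_def field_simps)
  qed
  show ?thesis
  proof (rule summableI_nonneg_bounded)
    fix N :: nat
    have "(\<Sum>n<N. cmod (lam n) / real n) \<le> T (Suc N)"
    proof -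
      have "(\<Sum>n<N. cmod (lam n) / real n) = (\<Sum>n\<in>{..<N} - {0}. cmod (lam n) / real n)"
        by (intro sum.mono_neutral_right) auto
      also have "\<dots> \<le> T (Suc N)" unfolding T_def by (intro sum_mono2) auto
      finally show ?thesis .
    qed
    also have "\<dots> \<le> B" by (rule bound) simp
    finally show "(\<Sum>n<N. cmod (lam n) / real n) \<le> B" .
  qed simp
qed

lemma has_sum_multiples:
  fixes f :: "nat \<Rightarrow> complex"
  assumes p: "p \<ge> 1" and f: "\<And>m. m \<ge> 1 \<Longrightarrow> f (p * m) = c * f m"
    and A: "A \<subseteq> {1..}" "(f has_sum S) A"
  shows "(f has_sum (c * S)) ((*) p ` A)"
proof -
  have "((\<lambda>m. c * f m) has_sum (c * S)) A" by (rule has_sum_cmult_right[OF A(2)])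
  hence "((f \<circ> (*) p) has_sum (c * S)) A"
    by (rule has_sum_cong[THEN iffD1, rotated]) (use A f in \<open>auto simp: o_def\<close>)
  thus ?thesis using p by (subst has_sum_reindex) (auto simp: inj_on_def)
qed

text \<open>
  The Euler product, argued by contradiction.  If the sum over a set \<open>A\<close> vanishes, so does the
  sum over the multiples \<open>p A\<close>.  Starting from all positive integers and sieving by one prime at a
  time, one finds that the sum over the integers without prime factors up to \<open>k\<close> vanishes for every
  \<open>k\<close>.  But for large \<open>k\<close> it consists of the term 1 and a part of a small tail.
\<close>

lemma sum_multiplicative_neq_0:
  fixes f :: "nat \<Rightarrow> complex"
  assumes mult: "\<And>m n. m \<ge> 1 \<Longrightarrow> n \<ge> 1 \<Longrightarrow> f (m * n) = f m * f n" and one: "f 1 = 1"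
    and sm: "summable (\<lambda>n. cmod (f n))" and f0: "f 0 = 0"
  shows "(\<Sum>n. f n) \<noteq> 0"
proof
  assume zero: "(\<Sum>n. f n) = 0"
  define A where "A k = {n::nat. n \<ge> 1 \<and> (\<forall>p. prime p \<longrightarrow> p dvd n \<longrightarrow> k < p)}" for k
  have A0: "A 0 = {1..}" by (auto simp: A_def prime_gt_0_nat)
  have "(f has_sum 0) UNIV"
    using norm_summable_imp_has_sum[OF sm] summable_sums[OF summable_norm_cancel[OF sm]] zero by simp
  hence A0_sum: "(f has_sum 0) (A 0)"
    by (rule has_sum_cong_neutral[THEN iffD1, rotated -1]) (auto simp: A0 f0 not_le)
  have all: "(f has_sum 0) (A k)" for k
  proof (induction k)
    case (Suc k)
    show ?case
    proof (cases "prime (Suc k)")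
      case False
      hence "k < p \<longleftrightarrow> Suc k < p" if "prime p" for p
        using that by (cases "p = Suc k") auto
      hence "A (Suc k) = A k" unfolding A_def by blast
      thus ?thesis using Suc by simp
    next
      case True
      have eq: "A (Suc k) = A k - (*) (Suc k) ` A k"
      proof (intro set_eqI iffI)
        fix n assume n: "n \<in> A (Suc k)"
        hence "\<not> Suc k dvd n" using True unfolding A_def by blast
        hence "n \<notin> (*) (Suc k) ` A k" by (metis dvd_triv_left imageE)
        moreover have "n \<in> A k" using n unfolding A_def by (simp add: Suc_lessD)
        ultimately show "n \<in> A k - (*) (Suc k) ` A k" by blast
      next
        fix n assume n: "n \<in> A k - (*) (Suc k) ` A k"
        have "\<not> Suc k dvd n"
        proof
          assume "Suc k dvd n"
          then obtain m where m: "n = Suc k * m" by blast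
          have "m \<ge> 1" using n m unfolding A_def by (cases m) auto
          moreover have "\<forall>p. prime p \<longrightarrow> p dvd m \<longrightarrow> k < p"
            using n m unfolding A_def by (auto simp del: mult_Suc intro: dvd_mult)
          ultimately have "m \<in> A k" unfolding A_def by blast
          thus False using n m by blast
        qed
        show "n \<in> A (Suc k)" unfolding A_def
        proof (clarify, intro conjI allI impI)
          show "n \<ge> 1" using n by (simp add: A_def)
          fix p assume "prime p" "p dvd n"
          moreover have "p \<noteq> Suc k" using \<open>p dvd n\<close> \<open>\<not> Suc k dvd n\<close> by blast
          moreover have "k < p" using n \<open>prime p\<close> \<open>p dvd n\<close> by (simp add: A_def)
          ultimately show "Suc k < p" by linarith
        qed
      qed
      have sub: "(*) (Suc k) ` A k \<subseteq> A k"
      proof (intro image_subsetI)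
        fix m assume m: "m \<in> A k"
        show "Suc k * m \<in> A k" unfolding A_def
        proof (clarify, intro conjI allI impI)
          show "1 \<le> Suc k * m" using m by (simp add: A_def)
          fix p assume p: "prime p" "p dvd Suc k * m"
          hence "p dvd Suc k \<or> p dvd m" by (metis prime_dvd_mult_iff)
          thus "k < p"
          proof
            assume "p dvd Suc k"
            hence "p = Suc k" using p True by (metis primes_dvd_imp_eq)
            thus ?thesis by simp
          qed (use m p in \<open>auto simp: A_def\<close>)
        qed
      qed
      have "(f has_sum (f (Suc k) * 0)) ((*) (Suc k) ` A k)"
        by (intro has_sum_multiples Suc mult) (auto simp: A_def)
      hence "(f has_sum (0 - 0)) (A k - (*) (Suc k) ` A k)"
        by (intro has_sum_Diff Suc sub) simp
      thus ?thesis by (simp add: eq)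
    qed
  qed (rule A0_sum)
  have "(\<lambda>k. \<Sum>n. cmod (f (n + k))) \<longlonglongrightarrow> 0" by (rule suminf_exist_split2[OF sm])
  then obtain k where k: "(\<Sum>n. cmod (f (n + k))) < 1" "k \<ge> 2"
    using order_tendstoD(2)[of "\<lambda>k. \<Sum>n. cmod (f (n + k))" 0 sequentially 1]
    by (auto simp: eventually_sequentially) (metis max.cobounded1 max.cobounded2)
  have one_in: "1 \<in> A k" by (auto simp: A_def)
  have sub: "A k - {1} \<subseteq> {k..}"
  proof
    fix n assume n: "n \<in> A k - {1}"
    then obtain p where "prime p" "p dvd n" using prime_factor_nat[of n] by auto
    moreover have "n \<ge> 1" "\<forall>p. prime p \<longrightarrow> p dvd n \<longrightarrow> k < p" using n by (auto simp: A_def)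
    ultimately have "k < p" "p \<le> n" using dvd_imp_le[of p n] by auto
    thus "n \<in> {k..}" by simp
  qed
  have s1: "(f has_sum (0 - f 1)) (A k - {1})"
    by (intro has_sum_Diff all) (use one_in has_sum_finite[of "{1}" f] in auto)
  have s2: "((\<lambda>n. cmod (f n)) has_sum (\<Sum>n. cmod (f (n + k)))) {k..}"
  proof -
    have sm': "summable (\<lambda>n. cmod (f (n + k)))" using sm by (rule summable_ignore_initial_segment)
    have "((\<lambda>n. cmod (f (n + k))) has_sum (\<Sum>n. cmod (f (n + k)))) UNIV"
      using norm_summable_imp_has_sum[of "\<lambda>n. cmod (f (n + k))"] sm' summable_sums[OF sm'] by simp
    hence "((\<lambda>n. cmod (f n)) \<circ> (\<lambda>n. n + k) has_sum (\<Sum>n. cmod (f (n + k)))) UNIV" by (simp add: o_def)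
    hence "((\<lambda>n. cmod (f n)) has_sum (\<Sum>n. cmod (f (n + k)))) (range (\<lambda>n. n + k))"
      by (subst has_sum_reindex) auto
    also have "range (\<lambda>n. n + k) = {k..}" by (auto simp: image_iff) (metis le_add_diff_inverse2)
    finally show ?thesis .
  qed
  have "((\<lambda>n. cmod (f n)) summable_on (A k - {1}))"
    using s2 sub summable_on_subset_banach has_sum_imp_summable by blast
  then obtain S where S: "((\<lambda>n. cmod (f n)) has_sum S) (A k - {1})" by (auto simp: summable_on_def)
  have "cmod (0 - f 1) \<le> S"
    using norm_infsum_le[OF s1 S] by simp
  also have "S \<le> (\<Sum>n. cmod (f (n + k)))"
    by (rule has_sum_mono2[OF S s2 sub]) auto
  finally show False using k one by simp
qed

section \<open>Analytic continuation of the zeta function\<close>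

definition zeta_series :: "complex \<Rightarrow> complex" where
  "zeta_series s = (\<Sum>n. 1 / of_nat (Suc n) powr s)"

lemma cmod_of_nat_powr: "cmod (of_nat n powr s) = real n powr Re s"
  by (subst norm_powr_real_powr) auto

lemma summable_inverse_powr: "\<sigma> > 1 \<Longrightarrow> summable (\<lambda>n. 1 / real (Suc n) powr \<sigma>)"
proof -
  assume "\<sigma> > 1"
  hence "summable (\<lambda>n. real n powr (-\<sigma>))" by (subst summable_real_powr_iff) auto
  hence "summable (\<lambda>n. real (Suc n) powr (-\<sigma>))" by (subst summable_Suc_iff)
  thus ?thesis by (simp add: powr_minus_divide)
qed

lemma zeta_series_summable:
  assumes "Re s > 1"
  shows "summable (\<lambda>n. cmod (1 / of_nat (Suc n) powr s))"
    "(\<lambda>n. 1 / of_nat (Suc n) powr s) sums zeta_series s"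
proof -
  show *: "summable (\<lambda>n. cmod (1 / of_nat (Suc n) powr s))"
    using summable_inverse_powr[OF assms] by (simp add: norm_divide cmod_of_nat_powr del: of_nat_Suc)
  show "(\<lambda>n. 1 / of_nat (Suc n) powr s) sums zeta_series s"
    unfolding zeta_series_def by (rule summable_sums[OF summable_norm_cancel[OF *]])
qed

lemma holomorphic_suminf:
  fixes f :: "nat \<Rightarrow> complex \<Rightarrow> complex"
  assumes S: "open S" and hol: "\<And>n. f n holomorphic_on S"
    and bound: "\<And>x. x \<in> S \<Longrightarrow> \<exists>d h. 0 < d \<and> summable h \<and>
                   (\<forall>\<^sub>F n in sequentially. \<forall>y\<in>ball x d \<inter> S. norm (f n y) \<le> h n)"
  shows "(\<lambda>x. \<Sum>n. f n x) holomorphic_on S" "\<And>x. x \<in> S \<Longrightarrow> summable (\<lambda>n. f n x)"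
proof -
  have "\<And>n x. x \<in> S \<Longrightarrow> (f n has_field_derivative deriv (f n) x) (at x)"
    using hol S holomorphic_derivI by blast
  from series_and_derivative_comparison_local[OF S this bound]
  obtain g g' where g: "\<And>x. x \<in> S \<Longrightarrow> (\<lambda>n. f n x) sums g x"
    "\<And>x. x \<in> S \<Longrightarrow> (g has_field_derivative g' x) (at x)" by meson
  have "g holomorphic_on S" using g(2) S by (auto simp: holomorphic_on_open)
  moreover have "(\<Sum>n. f n x) = g x" if "x \<in> S" for x using g(1)[OF that] by (simp add: sums_iff)
  ultimately show "(\<lambda>x. \<Sum>n. f n x) holomorphic_on S" by (simp cong: holomorphic_cong)
  show "summable (\<lambda>n. f n x)" if "x \<in> S" for x using g(1)[OF that] by (simp add: sums_iff)
qed

lemma open_Re_gt: "open {s. Re s > c}"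
  by (rule open_halfspace_Re_gt)

lemma zeta_series_holomorphic: "zeta_series holomorphic_on {s. Re s > 1}"
  unfolding zeta_series_def[abs_def]
proof (rule holomorphic_suminf(1)[OF open_Re_gt])
  show "(\<lambda>s. 1 / of_nat (Suc n) powr s) holomorphic_on {s. 1 < Re s}" for n
    by (intro holomorphic_intros) auto
  fix s :: complex assume "s \<in> {s. 1 < Re s}"
  hence s: "Re s > 1" by simp
  define \<sigma> where "\<sigma> = (1 + Re s) / 2"
  show "\<exists>d h. 0 < d \<and> summable h \<and> (\<forall>\<^sub>F n in sequentially. \<forall>y\<in>ball s d \<inter> {s. 1 < Re s}. norm (1 / of_nat (Suc n) powr y) \<le> h n)"
  proof (intro exI conjI always_eventually allI ballI)
    show "summable (\<lambda>n. 1 / real (Suc n) powr \<sigma>)" by (rule summable_inverse_powr) (use s in \<open>simp add: \<sigma>_def\<close>)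
    show "(Re s - 1) / 2 > 0" using s by simp
    fix n y assume y: "y \<in> ball s ((Re s - 1) / 2) \<inter> {s. 1 < Re s}"
    have "\<bar>Re s - Re y\<bar> < (Re s - 1) / 2" using y abs_Re_le_cmod[of "s - y"] by (auto simp: dist_norm)
    hence "\<sigma> \<le> Re y" by (simp add: \<sigma>_def field_simps abs_if split: if_splits)
    thus "norm (1 / of_nat (Suc n) powr y) \<le> 1 / real (Suc n) powr \<sigma>"
      by (auto simp: norm_divide cmod_of_nat_powr simp del: of_nat_Suc intro!: frac_le powr_mono)
  qed
qed

lemma inverse_powr_le:
  assumes "2 \<le> n" "0 \<le> \<tau>"
  shows "1 / real n powr (\<sigma> + \<tau>) \<le> (1 / 2) powr \<tau> * (1 / real n powr \<sigma>)"
proof -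
  have "2 powr \<tau> \<le> real n powr \<tau>" using assms by (intro powr_mono2) auto
  hence "1 / real n powr \<tau> \<le> 1 / 2 powr \<tau>" using assms by (intro frac_le) auto
  thus ?thesis using assms
    by (auto simp: powr_add powr_divide divide_simps mult_le_cancel_right)
qed

lemma zeta_series_minus_1:
  assumes "Re s > 1"
  shows "(\<lambda>n. 1 / of_nat (n + 2) powr s) sums (zeta_series s - 1)"
proof -
  have "(\<lambda>n. 1 / of_nat (Suc (Suc n)) powr s) sums (zeta_series s - 1 / of_nat (Suc 0) powr s)"
    using zeta_series_summable(2)[OF assms] by (subst sums_Suc_iff) simp
  thus ?thesis by (simp add: numeral_2_eq_2 add.commute)
qed

definition zeta2 :: real where "zeta2 = (\<Sum>n. 1 / real (n + 2) powr 2)"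

lemma cmod_zeta_series_minus_1:
  assumes "Re s \<ge> 2"
  shows "cmod (zeta_series s - 1) \<le> (1 / 2) powr (Re s - 2) * zeta2"
proof -
  have sm: "summable (\<lambda>n. 1 / real (n + 2) powr 2)"
    using summable_ignore_initial_segment[OF summable_inverse_powr[of 2], of 1] by (simp add: add.commute)
  have "norm (\<Sum>n. 1 / of_nat (n + 2) powr s) \<le> (\<Sum>n. (1 / 2) powr (Re s - 2) * (1 / real (n + 2) powr 2))"
  proof (rule norm_suminf_le)
    fix n
    show "norm (1 / of_nat (n + 2) powr s) \<le> (1 / 2) powr (Re s - 2) * (1 / real (n + 2) powr 2)"
      using inverse_powr_le[of "n + 2" "Re s - 2" 2] assms
      by (simp only: norm_divide norm_one cmod_of_nat_powr) simp
  qed (intro summable_mult sm)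
  also have "\<dots> = (1 / 2) powr (Re s - 2) * zeta2"
    unfolding zeta2_def by (rule suminf_mult[OF sm])
  also have "(\<Sum>n. 1 / of_nat (n + 2) powr s) = zeta_series s - 1"
    using zeta_series_minus_1[of s] assms by (simp only: sums_iff)
  finally show ?thesis .
qed

lemma cmod_pochhammer_le: "cmod s \<le> r \<Longrightarrow> cmod (pochhammer s k) \<le> pochhammer r k"
proof (induction k)
  case (Suc k)
  have "cmod (s + of_nat k) \<le> r + real k"
    using norm_triangle_ineq[of s "of_nat k"] Suc.prems by simp
  thus ?case using Suc by (auto simp: pochhammer_Suc norm_mult intro!: mult_mono order_trans[OF norm_ge_zero])
qed simp

lemma pochhammer_summable:
  fixes r :: real
  shows "summable (\<lambda>k. pochhammer r k / fact k * (1 / 2) ^ k)"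
proof -
  have "(\<lambda>k. ((-r) gchoose k) * (-(1/2)) ^ k) sums (1 + (-(1/2))) powr (-r)"
    by (rule gen_binomial_real) auto
  moreover have "((-r) gchoose k) * (-(1/2)) ^ k = pochhammer r k / fact k * (1 / 2) ^ k" for k
  proof -
    have "(- 1) ^ k * (- (1 / 2)) ^ k = (1 / 2 :: real) ^ k" by (simp flip: power_mult_distrib)
    thus ?thesis by (simp only: gbinomial_pochhammer minus_minus times_divide_eq_left times_divide_eq_right mult.commute mult.assoc mult.left_commute)
  qed
  ultimately show ?thesis by (simp add: sums_iff)
qed

text \<open>
  The binomial series of \<open>(1 - 1 / n)\<^bsup>1 - s\<^esup>\<close>, without its constant term.  Its left-hand side
  consists of terms \<open>n\<^bsup>- s - k\<^esup>\<close> and its right-hand side telescopes in \<open>n\<close>; summation over \<open>n\<close>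
  gives the functional relation below between the values of zeta at \<open>s, s + 1, s + 2, \<dots>\<close>.
\<close>

lemma binomial_telescope:
  fixes s :: complex
  assumes "n \<ge> 2"
  shows "(\<lambda>k. (s - 1) * pochhammer s k / fact (Suc k) * (1 / of_nat n powr (s + of_nat k)))
     sums (of_nat (n - 1) powr (1 - s) - of_nat n powr (1 - s))"
proof -
  define x :: complex where "x = 1 / of_nat n"
  have nz: "of_nat n \<noteq> (0::complex)" using assms by simp
  have "cmod (- x) < 1" using assms by (simp add: x_def norm_divide)
  hence "(\<lambda>j. ((1 - s) gchoose j) * (- x) ^ j) sums (1 + - x) powr (1 - s)"
    by (rule gen_binomial_complex)
  moreover have "((1 - s) gchoose j) * (- x) ^ j = pochhammer (s - 1) j / fact j * x ^ j" for j
  proof -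
    have "(- 1) ^ j * (- x) ^ j = x ^ j" by (simp flip: power_mult_distrib)
    thus ?thesis by (simp add: gbinomial_pochhammer mult.commute)
  qed
  ultimately have "(\<lambda>j. pochhammer (s - 1) j / fact j * x ^ j) sums (1 - x) powr (1 - s)" by simp
  hence "(\<lambda>k. pochhammer (s - 1) (Suc k) / fact (Suc k) * x ^ Suc k) sums
      ((1 - x) powr (1 - s) - pochhammer (s - 1) 0 / fact 0 * x ^ 0)"
    by (subst sums_Suc_iff) (simp only: diff_add_cancel)
  hence "(\<lambda>k. pochhammer (s - 1) (Suc k) / fact (Suc k) * x ^ Suc k) sums ((1 - x) powr (1 - s) - 1)"
    by (simp only: pochhammer_0 fact_0 power_0 div_by_1 mult_1_left)
  hence "(\<lambda>k. of_nat n powr (1 - s) * (pochhammer (s - 1) (Suc k) / fact (Suc k) * x ^ Suc k))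
       sums (of_nat n powr (1 - s) * ((1 - x) powr (1 - s) - 1))"
    by (rule sums_mult)
  moreover have "of_nat n powr (1 - s) * (pochhammer (s - 1) (Suc k) / fact (Suc k) * x ^ Suc k)
      = (s - 1) * pochhammer s k / fact (Suc k) * (1 / of_nat n powr (s + of_nat k))" for k
  proof -
    have "of_nat n powr (1 - s) * x ^ Suc k = 1 / of_nat n powr (s + of_nat k)"
      using nz by (simp add: x_def powr_add powr_diff power_divide)
    moreover have "pochhammer (s - 1) (Suc k) = (s - 1) * pochhammer s k"
      by (simp add: pochhammer_rec)
    moreover have "of_nat n powr (1 - s) * (pochhammer (s - 1) (Suc k) / fact (Suc k) * x ^ Suc k)
        = pochhammer (s - 1) (Suc k) / fact (Suc k) * (of_nat n powr (1 - s) * x ^ Suc k)"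
      by (rule mult.left_commute)
    ultimately show ?thesis by (simp only:)
  qed
  moreover have "of_nat n powr (1 - s) * ((1 - x) powr (1 - s) - 1) = of_nat (n - 1) powr (1 - s) - of_nat n powr (1 - s)"
  proof -
    have "of_nat n powr (1 - s) * (1 - x) powr (1 - s) = (of_nat n * (1 - x)) powr (1 - s)"
      using assms by (subst powr_times_real) (auto simp: x_def field_simps)
    also have "of_nat n * (1 - x) = of_nat (n - 1)" using assms by (simp add: x_def field_simps of_nat_diff)
    finally show ?thesis by (simp add: algebra_simps)
  qed
  ultimately show ?thesis by simp
qed

lemma sum_zeta_series_eq_1:
  assumes s: "Re s > 1"
  shows "(\<lambda>k. (s - 1) * pochhammer s k / fact (Suc k) * (zeta_series (s + of_nat k) - 1)) sums 1"
proof -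
  define c where "c k = (s - 1) * pochhammer s k / fact (Suc k)" for k
  define a where "a k N = c k * (\<Sum>n<N. 1 / of_nat (n + 2) powr (s + of_nat k))" for k N
  define B where "B = (\<Sum>n. 1 / real (n + 2) powr Re s)"
  define P where "P k = pochhammer (cmod s) k / fact k * (1 / 2) ^ k" for k
  have smB: "summable (\<lambda>n. 1 / real (n + 2) powr Re s)"
    using summable_ignore_initial_segment[OF summable_inverse_powr[OF s], of 1] by (simp add: add.commute)
  have p0: "pochhammer (cmod s) k \<ge> 0" for k
    by (rule order_trans[OF norm_ge_zero cmod_pochhammer_le[OF order_refl]])
  have bound: "cmod (a k N) \<le> cmod (s - 1) * B * P k" for k N
  proof -
    have "cmod (\<Sum>n<N. 1 / of_nat (n + 2) powr (s + of_nat k)) \<le> (\<Sum>n<N. (1 / 2) ^ k * (1 / real (n + 2) powr Re s))"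
    proof (rule sum_norm_le)
      fix n
      show "norm (1 / of_nat (n + 2) powr (s + of_nat k)) \<le> (1 / 2) ^ k * (1 / real (n + 2) powr Re s)"
        using inverse_powr_le[of "n + 2" "real k" "Re s"]
        by (simp only: norm_divide norm_one cmod_of_nat_powr) (simp add: powr_realpow)
    qed
    also have "\<dots> \<le> (1 / 2) ^ k * B"
      unfolding B_def sum_distrib_left[symmetric]
      by (intro mult_left_mono sum_le_suminf smB) auto
    finally have 1: "cmod (\<Sum>n<N. 1 / of_nat (n + 2) powr (s + of_nat k)) \<le> (1 / 2) ^ k * B" .
    have "cmod (c k) \<le> cmod (s - 1) * pochhammer (cmod s) k / fact k"
      unfolding c_def norm_mult norm_divide norm_fact
      by (intro frac_le mult_left_mono mult_nonneg_nonneg cmod_pochhammer_le p0 fact_mono) auto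
    hence "cmod (a k N) \<le> cmod (s - 1) * pochhammer (cmod s) k / fact k * ((1 / 2) ^ k * B)"
      unfolding a_def norm_mult using 1
      using p0 by (intro mult_mono) auto
    thus ?thesis by (simp add: P_def mult_ac)
  qed
  have smM: "summable (\<lambda>k. cmod (s - 1) * B * P k)"
    unfolding P_def by (intro summable_mult pochhammer_summable)
  have lim_a: "(\<lambda>N. a k N) \<longlonglongrightarrow> c k * (zeta_series (s + of_nat k) - 1)" for k
    unfolding a_def using zeta_series_minus_1[of "s + of_nat k"] s
    by (intro tendsto_mult_left) (simp add: sums_def)
  \<comment> \<open>Summing over \<open>n < N\<close> first leaves a single limit to be exchanged with the sum over \<open>k\<close>.\<close>
  have T: "((\<lambda>N. \<Sum>k. a k N) \<longlongrightarrow> (\<Sum>k. c k * (zeta_series (s + of_nat k) - 1))) sequentially"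
    using tannerys_theorem[where a = a and M = "\<lambda>k. cmod (s - 1) * B * P k" and F = sequentially, OF lim_a _ smM]
      bound by (auto intro!: always_eventually)
  have eq: "(\<Sum>k. a k N) = 1 - of_nat (Suc N) powr (1 - s)" for N
  proof -
    have "(\<lambda>k. \<Sum>n<N. c k * (1 / of_nat (n + 2) powr (s + of_nat k)))
        sums (\<Sum>n<N. of_nat (n + 2 - 1) powr (1 - s) - of_nat (n + 2) powr (1 - s))"
      unfolding c_def by (intro sums_sum binomial_telescope) auto
    moreover have "(\<Sum>n<N. of_nat (n + 2 - 1) powr (1 - s) - of_nat (n + 2) powr (1 - s)) = 1 - (of_nat (Suc N) powr (1 - s) :: complex)"
      using sum_lessThan_telescope'[of "\<lambda>n. of_nat (Suc n) powr (1 - s) :: complex" N] by simp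
    ultimately show ?thesis by (simp add: a_def sum_distrib_left sums_iff)
  qed
  have "(\<lambda>N. of_nat (Suc N) powr (1 - s)) \<longlonglongrightarrow> (0::complex)"
  proof (rule tendsto_norm_zero_cancel)
    have "(\<lambda>N. real (Suc N) powr (1 - Re s)) \<longlonglongrightarrow> 0" using s by real_asymp
    thus "(\<lambda>N. cmod (of_nat (Suc N) powr (1 - s))) \<longlonglongrightarrow> 0" by (simp add: cmod_of_nat_powr del: of_nat_Suc)
  qed
  hence "(\<lambda>N. \<Sum>k. a k N) \<longlonglongrightarrow> 1 - 0" unfolding eq by (intro tendsto_intros)
  with T have "(\<Sum>k. c k * (zeta_series (s + of_nat k) - 1)) = 1" using LIMSEQ_unique by fastforce
  moreover have "summable (\<lambda>k. c k * (zeta_series (s + of_nat k) - 1))"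
  proof (rule summable_comparison_test'[OF smM])
    fix k show "norm (c k * (zeta_series (s + of_nat k) - 1)) \<le> cmod (s - 1) * B * P k"
      by (rule Lim_norm_ubound[OF _ lim_a]) (use bound in auto)
  qed
  ultimately show ?thesis by (simp add: c_def sums_iff)
qed

text \<open>
  Solving the relation for \<open>(s - 1) \<zeta>(s)\<close>, the term \<open>k = 0\<close>, expresses it by the values of zeta at
  \<open>s + 1, s + 2, \<dots>\<close> and thereby extends the half-plane of definition by 1.  Working with
  \<open>(s - 1) \<zeta>(s)\<close> avoids all poles: the coefficient of \<open>\<zeta>(s + k)\<close> contains the factor
  \<open>s + k - 1\<close>.
\<close>

lemma zeta_continuation_step:
  assumes hol: "Z holomorphic_on {s. Re s > c}" and c: "c \<le> 1"
    and Z: "\<And>s. Re s > 1 \<Longrightarrow> Z s = (s - 1) * zeta_series s"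
  obtains Z' where "Z' holomorphic_on {s. Re s > c - 1}"
    "\<And>s. Re s > 1 \<Longrightarrow> Z' s = (s - 1) * zeta_series s"
proof -
  define t where "t k s = (s - 1) * pochhammer s k / fact (k + 2) * (Z (s + of_nat (Suc k)) - (s + of_nat k))" for k s
  have t_eq: "t k s = (s - 1) * pochhammer s (Suc k) / fact (Suc (Suc k)) * (zeta_series (s + of_nat (Suc k)) - 1)"
    if "Re (s + of_nat (Suc k)) > 1" for k s
    unfolding t_def Z[OF that] by (simp add: pochhammer_Suc algebra_simps)
  define S where "S = {s. Re s > c - 1}"
  have holt: "t k holomorphic_on S" for k
  proof -
    have "(Z \<circ> (\<lambda>s. s + of_nat (Suc k))) holomorphic_on S"
      by (rule holomorphic_on_compose_gen[OF _ hol]) (auto intro!: holomorphic_intros simp: S_def)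
    thus ?thesis unfolding t_def o_def by (intro holomorphic_intros) auto
  qed
  have "(\<lambda>s. \<Sum>k. t k s) holomorphic_on S"
  proof (rule holomorphic_suminf(1)[OF _ holt])
    show "open S" unfolding S_def by (rule open_Re_gt)
    fix s0 assume "s0 \<in> S"
    define r where "r = cmod s0 + 1"
    define h where "h k = (r + 1) * (2 powr (r + 1) * 2 * zeta2) * (pochhammer r (Suc k) / fact (Suc k) * (1 / 2) ^ Suc k)" for k
    have "summable h" unfolding h_def
      using summable_mult[OF iffD2[OF summable_Suc_iff, OF pochhammer_summable]] by blast
    moreover have "cmod (t k s) \<le> h k" if k: "k \<ge> nat \<lceil>r\<rceil> + 1" and s: "s \<in> ball s0 1" for k s
    proof -
      have sr: "cmod s \<le> r" using s norm_triangle_ineq2[of s s0] by (simp add: r_def dist_norm norm_minus_commute)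
      hence re: "\<bar>Re s\<bar> \<le> r" using abs_Re_le_cmod order_trans by blast
      have kr: "r + 1 \<le> real k" using k by linarith
      have p0: "0 \<le> pochhammer r (Suc k)"
        by (rule order_trans[OF norm_ge_zero cmod_pochhammer_le[OF sr]])
      have z0: "0 \<le> zeta2" unfolding zeta2_def
        using summable_ignore_initial_segment[OF summable_inverse_powr[of 2], of 1]
        by (intro suminf_nonneg) (auto simp: add.commute)
      have 1: "cmod (zeta_series (s + of_nat (Suc k)) - 1) \<le> 2 powr (r + 1) * 2 * zeta2 * (1 / 2) ^ Suc k"
      proof -
        have "cmod (zeta_series (s + of_nat (Suc k)) - 1) \<le> (1 / 2) powr (Re (s + of_nat (Suc k)) - 2) * zeta2"
          by (rule cmod_zeta_series_minus_1) (use kr re in auto)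
        also have "Re (s + of_nat (Suc k)) - 2 = (Re s - 2) + real (Suc k)" by simp
        also have "(1 / 2::real) powr ((Re s - 2) + real (Suc k)) = 2 powr (2 - Re s) * (1 / 2) ^ Suc k"
          by (simp add: powr_add powr_realpow powr_divide powr_diff del: power_Suc)
            (simp add: powr_minus field_simps)
        also have "2 powr (2 - Re s) \<le> 2 powr ((r + 1) + 1)" using re by (intro powr_mono) auto
        also have "\<dots> = 2 powr (r + 1) * 2" by (simp only: powr_add[of 2 "r + 1" 1] powr_one)
        finally show ?thesis using z0 by (simp add: mult_right_mono mult_left_mono mult_ac)
      qed
      have gt: "Re (s + of_nat (Suc k)) > 1" using kr re by simp
      have "cmod (t k s) = cmod (s - 1) * cmod (pochhammer s (Suc k)) / fact (Suc (Suc k)) * cmod (zeta_series (s + of_nat (Suc k)) - 1)"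
        unfolding t_eq[OF gt] norm_mult norm_divide norm_fact ..
      also have "\<dots> \<le> (r + 1) * pochhammer r (Suc k) / fact (Suc k) * (2 powr (r + 1) * 2 * zeta2 * (1 / 2) ^ Suc k)"
      proof (intro mult_mono frac_le 1 cmod_pochhammer_le sr)
        show "cmod (s - 1) \<le> r + 1" using norm_triangle_ineq4[of s 1] sr by simp
        show "fact (Suc k) \<le> (fact (Suc (Suc k)) :: real)" by (rule fact_mono) simp
      qed (use p0 in \<open>auto simp: r_def\<close>)
      also have "\<dots> = h k" unfolding h_def by (simp only: times_divide_eq_left times_divide_eq_right mult_ac)
      finally show ?thesis .
    qed
    ultimately show "\<exists>d h. 0 < d \<and> summable h \<and> (\<forall>\<^sub>F n in sequentially. \<forall>y\<in>ball s0 d \<inter> S. cmod (t n y) \<le> h n)"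
      by (intro exI[of _ 1] exI[of _ h] conjI eventually_sequentiallyI[of "nat \<lceil>r\<rceil> + 1"]) auto
  qed
  hence "(\<lambda>s. s - (\<Sum>k. t k s)) holomorphic_on S" by (intro holomorphic_intros)
  moreover have "s - (\<Sum>k. t k s) = (s - 1) * zeta_series s" if s: "Re s > 1" for s
  proof -
    have "(\<lambda>k. (s - 1) * pochhammer s (Suc k) / fact (Suc (Suc k)) * (zeta_series (s + of_nat (Suc k)) - 1))
       sums (1 - (s - 1) * pochhammer s 0 / fact (Suc 0) * (zeta_series (s + of_nat 0) - 1))"
      using sum_zeta_series_eq_1[OF s] by (subst sums_Suc_iff) (simp only: diff_add_cancel)
    hence "(\<lambda>k. t k s) sums (1 - (s - 1) * pochhammer s 0 / fact (Suc 0) * (zeta_series (s + of_nat 0) - 1))"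
      using s by (simp only: t_eq[symmetric] plus_complex.simps of_nat_0_le_iff complex_Re_of_nat add_strict_increasing2)
    thus ?thesis by (simp add: sums_iff algebra_simps)
  qed
  ultimately show ?thesis using that by (auto simp: S_def)
qed

lemma zeta_continuation_strip:
  "\<exists>Z. Z holomorphic_on {s. Re s > 1 - real m} \<and> (\<forall>s. Re s > 1 \<longrightarrow> Z s = (s - 1) * zeta_series s)"
proof (induction m)
  case 0
  have "(\<lambda>s. (s - 1) * zeta_series s) holomorphic_on {s. Re s > 1}"
    by (intro holomorphic_intros zeta_series_holomorphic)
  thus ?case by auto
next
  case (Suc m)
  then obtain Z where Z: "Z holomorphic_on {s. Re s > 1 - real m}" "\<And>s. Re s > 1 \<Longrightarrow> Z s = (s - 1) * zeta_series s"
    by blast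
  from zeta_continuation_step[OF Z(1) _ Z(2)]
  obtain Z' where "Z' holomorphic_on {s. Re s > 1 - real m - 1}"
    "\<And>s. Re s > 1 \<Longrightarrow> Z' s = (s - 1) * zeta_series s" by auto
  thus ?case by (intro exI[of _ Z']) (auto simp: algebra_simps)
qed

text \<open>
  By the identity theorem the continuations to the half-planes agree with each other.
\<close>

lemma zeta_continuation_entire:
  "\<exists>Z. Z holomorphic_on UNIV \<and> (\<forall>s. Re s > 1 \<longrightarrow> Z s = (s - 1) * zeta_series s)"
proof -
  define H where "H m = {s::complex. Re s > 1 - real m}" for m :: nat
  obtain Z where Z: "\<And>m. Z m holomorphic_on H m" "\<And>m s. Re s > 1 \<Longrightarrow> Z m s = (s - 1) * zeta_series s"
    using zeta_continuation_strip unfolding H_def by metis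
  have op: "open (H m)" for m unfolding H_def by (rule open_Re_gt)
  have agree: "Z m s = Z m' s" if "s \<in> H m" "m \<le> m'" for m m' s
  proof (rule analytic_continuation_open[of "{s. Re s > 1}" "H m" "Z m" "Z m'"])
    show "{s::complex. 1 < Re s} \<noteq> {}" by (auto intro: exI[of _ 2])
    show "Z m z = Z m' z" if "z \<in> {s. Re s > 1}" for z using that Z by simp
    show "connected (H m)" unfolding H_def by (intro convex_connected convex_halfspace_Re_gt)
    show "Z m' holomorphic_on H m"
      by (rule holomorphic_on_subset[OF Z(1)]) (use that in \<open>auto simp: H_def\<close>)
  qed (use that Z op open_Re_gt in \<open>auto simp: H_def\<close>)
  define m where "m s = nat (\<lceil>1 - Re s\<rceil> + 1)" for s
  have m: "s \<in> H (m s)" for s unfolding H_def m_def by simp linarith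
  define Y where "Y s = Z (m s) s" for s
  have Y: "Y s = Z k s" if "s \<in> H k" for s k
  proof (cases "k \<le> m s")
    case True
    thus ?thesis unfolding Y_def using agree[OF that] by metis
  next
    case False
    thus ?thesis unfolding Y_def using agree[OF m[of s]] by (meson nle_le)
  qed
  have "Y holomorphic_on H k" for k
    using Z(1)[of k] by (rule holomorphic_transform) (simp add: Y)
  hence "Y holomorphic_on (\<Union>k. H k)" using op by (intro holomorphic_on_UN_open) auto
  also have "(\<Union>k. H k) = UNIV" using m by blast
  finally have "Y holomorphic_on UNIV" .
  moreover have "Y s = (s - 1) * zeta_series s" if "Re s > 1" for s
    using Y[of s 0] Z(2)[of s 0] that by (simp add: H_def)
  ultimately show ?thesis by blast
qed

lemma zeta_characterization:
  "zeta holomorphic_on (- {1})" "\<And>s. Re s > 1 \<Longrightarrow> zeta s = zeta_series s"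
proof -
  define P where "P f \<longleftrightarrow> f holomorphic_on (- {1}) \<and>
                  (\<forall>s. Re s > 1 \<longrightarrow> f s = (\<Sum>n. 1 / of_nat (Suc n) powr s)) \<and> f 1 = 0" for f
  obtain Z where Z: "Z holomorphic_on UNIV" "\<And>s. Re s > 1 \<Longrightarrow> Z s = (s - 1) * zeta_series s"
    using zeta_continuation_entire by blast
  define F where "F s = Z s / (s - 1)" for s
  have "F holomorphic_on (- {1})" unfolding F_def
    by (intro holomorphic_intros holomorphic_on_subset[OF Z(1)]) auto
  moreover have "F s = zeta_series s" if "Re s > 1" for s
    using Z(2)[OF that] that by (auto simp: F_def)
  ultimately have PF: "P F" by (auto simp: P_def F_def zeta_series_def)
  have "f = F" if f: "P f" for f
  proof
    fix s show "f s = F s"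
    proof (cases "s = 1")
      case False
      show ?thesis
      proof (rule analytic_continuation_open[of "{s. Re s > 1}" "- {1}" f F])
        show "{s::complex. 1 < Re s} \<noteq> {}" by (auto intro: exI[of _ 2])
        show "f z = F z" if "z \<in> {s. Re s > 1}" for z using that f PF by (simp add: P_def)
        show "connected (- {1::complex})" by (rule connected_punctured_universe) simp
      qed (use False f PF open_Re_gt in \<open>auto simp: P_def\<close>)
    qed (use f PF in \<open>auto simp: P_def\<close>)
  qed
  hence "zeta = F" unfolding zeta_def P_def[symmetric] using PF by blast
  thus "zeta holomorphic_on (- {1})" "\<And>s. Re s > 1 \<Longrightarrow> zeta s = zeta_series s"
    using PF by (auto simp: P_def zeta_series_def)
qed

section \<open>A conditionally convergent series for the zeta function\<close>

text \<open>
  The coefficients of \<open>(1 - k\<^bsup>1 - w\<^esup>) \<zeta>(w)\<close> as a Dirichlet series, divided by the argument; for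
  \<open>k = 2\<close> this is the alternating eta function.  The value at \<open>m = 0\<close> is 0.
\<close>

definition eta_coeff :: "nat \<Rightarrow> nat \<Rightarrow> real" where
  "eta_coeff k m = (1 - (if k dvd m then real k else 0)) / real m"

lemma cmod_powr_diff_le:
  assumes x: "0 < x" "x \<le> y" and s: "Re s \<le> 1"
  shows "cmod (of_real y powr s - of_real x powr s) \<le> cmod s * x powr (Re s - 1) * (y - x)"
proof -
  have "cmod (of_real y powr s - of_real x powr s) \<le> (cmod s * x powr (Re s - 1)) * cmod (of_real y - of_real x)"
  proof (rule field_differentiable_bound[where S = "closed_segment (of_real x) (of_real y :: complex)" and f' = "\<lambda>z. s * z powr (s - 1)"])
    fix z :: complex assume "z \<in> closed_segment (of_real x) (of_real y)"
    hence "z \<in> of_real ` closed_segment x y" by (simp only: closed_segment_of_real)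
    then obtain t where t: "z = of_real t" "x \<le> t" using x(2)
      unfolding closed_segment_eq_real_ivl by auto
    show "((\<lambda>z. z powr s) has_field_derivative s * z powr (s - 1)) (at z within closed_segment (of_real x) (of_real y))"
    proof (rule has_field_derivative_at_within, rule has_field_derivative_powr)
      show "z \<notin> \<real>\<^sub>\<le>\<^sub>0" using t x(1) by (auto simp: complex_nonpos_Reals_iff)
    qed
    have "t powr (Re s - 1) \<le> x powr (Re s - 1)" using t x s by (intro powr_mono2') auto
    thus "norm (s * z powr (s - 1)) \<le> cmod s * x powr (Re s - 1)"
      using t x by (auto simp: norm_mult norm_powr_real_powr intro!: mult_left_mono)
  qed auto
  also have "cmod (of_real y - of_real x) = y - x" using x by (metis abs_of_nonneg diff_ge_0_iff_ge norm_of_real of_real_diff)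
  finally show ?thesis .
qed

text \<open>
  The terms with \<open>k m < n \<le> k m + k\<close> taken together: the \<open>k\<close>-fold negative last term is
  distributed over the block, so that only differences of nearby powers occur and the
  sum over blocks converges absolutely for \<open>Re w > 0\<close>.
\<close>

definition eta_block :: "nat \<Rightarrow> nat \<Rightarrow> complex \<Rightarrow> complex" where
  "eta_block k m w = (\<Sum>i=1..k. of_nat (k * m + i) powr (- w) - of_nat (k * m + k) powr (- w))"

lemma cmod_eta_block_le:
  assumes "k \<ge> 1" "Re w > 0" 
  shows "cmod (eta_block k m w) \<le> real k ^ 2 * cmod w * real (Suc m) powr (- Re w - 1)"
proof -
  have "cmod (eta_block k m w) \<le> (\<Sum>i=1..k. real k * cmod w * real (Suc m) powr (- Re w - 1))"
    unfolding eta_block_def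
  proof (rule sum_norm_le)
    fix i assume i: "i \<in> {1..k}"
    have "m \<le> k * m" using assms(1) by simp
    hence "Suc m \<le> k * m + i" using i by (metis Suc_eq_plus1 add_mono atLeastAtMost_iff)
    hence le: "real (Suc m) \<le> real (k * m + i)" by (simp only: of_nat_le_iff)
    have "cmod (of_real (real (k * m + k)) powr (- w) - of_real (real (k * m + i)) powr (- w))
       \<le> cmod (- w) * real (k * m + i) powr (Re (- w) - 1) * (real (k * m + k) - real (k * m + i))"
      using i assms le by (intro cmod_powr_diff_le) (auto intro: less_le_trans[OF _ le])
    also have "\<dots> \<le> cmod w * real (Suc m) powr (- Re w - 1) * real k"
      using le assms i by (intro mult_mono mult_left_mono) (auto intro!: powr_mono2')
    finally show "norm (of_nat (k * m + i) powr (- w) - of_nat (k * m + k) powr (- w)) \<le> real k * cmod w * real (Suc m) powr (- Re w - 1)"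
      by (simp add: norm_minus_commute mult_ac)
  qed
  thus ?thesis by (simp add: power2_eq_square mult_ac)
qed

lemma eta_blocks_sums_zeta:
  assumes k: "k \<ge> 1" and w: "Re w > 1"
  shows "(\<lambda>m. eta_block k m w) sums ((1 - of_nat k powr (1 - w)) * zeta_series w)"
proof -
  have z: "(\<lambda>n. of_nat (Suc n) powr (- w)) sums zeta_series w"
    using zeta_series_summable(2)[OF w] by (simp add: powr_minus_divide del: of_nat_Suc)
  have "(\<lambda>m. \<Sum>n\<in>{m*k..<m*k+k}. of_nat (Suc n) powr (- w)) sums zeta_series w"
    by (rule sums_group[OF z]) (use k in auto)
  moreover have "(\<Sum>n\<in>{m*k..<m*k+k}. of_nat (Suc n) powr (- w)) = (\<Sum>i=1..k. of_nat (k * m + i) powr (- w))" for m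
    by (rule sum.reindex_bij_witness[of _ "\<lambda>i. m * k + i - 1" "\<lambda>n. Suc n - m * k"]) (auto simp: algebra_simps)
  ultimately have 1: "(\<lambda>m. \<Sum>i=1..k. of_nat (k * m + i) powr (- w)) sums zeta_series w" by simp
  have "(\<lambda>m. of_nat k * of_nat k powr (- w) * of_nat (Suc m) powr (- w)) sums (of_nat k * of_nat k powr (- w) * zeta_series w)"
    by (rule sums_mult[OF z])
  also have "of_nat k * of_nat k powr (- w) = (of_nat k powr (1 - w) :: complex)"
    using k by (simp add: powr_diff powr_minus field_simps)
  also have "(\<lambda>m. of_nat k powr (1 - w) * of_nat (Suc m) powr (- w)) = (\<lambda>m. \<Sum>i=1..k. of_nat (k * m + k) powr (- w) :: complex)"
  proof
    fix m
    have "of_nat (k * m + k) powr (- w) = (of_nat k * of_nat (Suc m)) powr (- w)" by (simp add: algebra_simps)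
    also have "\<dots> = of_nat k powr (- w) * of_nat (Suc m) powr (- w)" by (rule powr_times_real) auto
    finally show "of_nat k powr (1 - w) * of_nat (Suc m) powr (- w) = (\<Sum>i=1..k. of_nat (k * m + k) powr (- w) :: complex)"
      using k by (simp add: powr_diff powr_minus field_simps del: of_nat_Suc of_nat_add of_nat_mult)
  qed
  finally have 2: "(\<lambda>m. \<Sum>i=1..k. of_nat (k * m + k) powr (- w)) sums (of_nat k powr (1 - w) * zeta_series w)" .
  show ?thesis using sums_diff[OF 1 2] by (simp add: eta_block_def sum_subtractf algebra_simps)
qed

text \<open>
  Both sides are holomorphic on the punctured right half-plane and agree for \<open>Re w > 1\<close>.
\<close>

lemma eta_blocks_sums:
  assumes k: "k \<ge> 1" and w: "Re w > 0" "w \<noteq> 1"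
  shows "(\<lambda>m. eta_block k m w) sums ((1 - of_nat k powr (1 - w)) * zeta w)"
proof -
  define S where "S = {w. Re w > 0}"
  have op: "open S" unfolding S_def by (rule open_Re_gt)
  have hol: "eta_block k m holomorphic_on S" for m
    unfolding eta_block_def[abs_def] by (intro holomorphic_intros) (use k in \<open>auto simp del: of_nat_add\<close>)
  have bound: "\<exists>d h. 0 < d \<and> summable h \<and>
                   (\<forall>\<^sub>F n in sequentially. \<forall>y\<in>ball x d \<inter> S. norm (eta_block k n y) \<le> h n)" if "x \<in> S" for x
  proof (intro exI conjI always_eventually allI ballI)
    define d where "d = Re x / 2"
    show d: "d > 0" using that by (simp add: d_def S_def)
    show "summable (\<lambda>m. real k ^ 2 * (cmod x + d) * (1 / real (Suc m) powr (1 + d)))"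
      by (intro summable_mult summable_inverse_powr) (use d in simp)
    fix m y assume y: "y \<in> ball x d \<inter> S"
    have "\<bar>Re x - Re y\<bar> < d" using y abs_Re_le_cmod[of "x - y"] by (auto simp: dist_norm)
    hence re: "d < Re y" by (simp add: d_def abs_if field_simps split: if_splits)
    have cm: "cmod y \<le> cmod x + d" using y norm_triangle_ineq2[of y x] by (auto simp: dist_norm norm_minus_commute)
    have "norm (eta_block k m y) \<le> real k ^ 2 * cmod y * real (Suc m) powr (- Re y - 1)"
      by (rule cmod_eta_block_le) (use k y in \<open>auto simp: S_def\<close>)
    also have "\<dots> \<le> real k ^ 2 * (cmod x + d) * real (Suc m) powr (- (1 + d))"
      using cm re d by (intro mult_mono powr_mono) auto
    finally show "norm (eta_block k m y) \<le> real k ^ 2 * (cmod x + d) * (1 / real (Suc m) powr (1 + d))"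
      by (simp only: powr_minus_divide)
  qed
  note * = holomorphic_suminf[OF op hol bound]
  have "(\<Sum>m. eta_block k m w) = (1 - of_nat k powr (1 - w)) * zeta w"
  proof (rule analytic_continuation_open[of "{w. Re w > 1}" "S - {1}" "\<lambda>w. \<Sum>m. eta_block k m w" "\<lambda>w. (1 - of_nat k powr (1 - w)) * zeta w"])
    show "{s::complex. 1 < Re s} \<noteq> {}" by (auto intro: exI[of _ 2])
    show "connected (S - {1})"
      by (intro connected_open_delete op convex_connected) (auto simp: S_def convex_halfspace_Re_gt)
    show "(\<lambda>w. \<Sum>m. eta_block k m w) holomorphic_on S - {1}"
      by (rule holomorphic_on_subset[OF *(1)]) auto
    show "(\<lambda>w. (1 - of_nat k powr (1 - w)) * zeta w) holomorphic_on S - {1}"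
      by (intro holomorphic_intros holomorphic_on_subset[OF zeta_characterization(1)]) (use k in auto)
    show "(\<Sum>m. eta_block k m z) = (1 - of_nat k powr (1 - z)) * zeta z" if "z \<in> {w. Re w > 1}" for z
      using that eta_blocks_sums_zeta[OF k, of z] by (simp add: sums_iff zeta_characterization(2))
  qed (use w op open_Re_gt in \<open>auto simp: S_def\<close>)
  with *(2)[of w] w show ?thesis by (simp add: S_def sums_iff)
qed

lemma eta_coeff_powr_sums_imp:
  fixes w S :: complex
  assumes k: "k \<ge> 1" and w: "Re w > 0" "w \<noteq> 1"
    and S: "(\<lambda>m. of_real (eta_coeff k m) * of_nat m powr (1 - w)) sums S"
  shows "S = (1 - of_nat k powr (1 - w)) * zeta w"
proof -
  define f :: "nat \<Rightarrow> complex" where "f m = of_real (eta_coeff k m) * of_nat m powr (1 - w)" for m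
  have f: "f n = of_nat n powr (- w) - (if k dvd n then of_nat k * of_nat n powr (- w) else 0)" if "n \<ge> 1" for n
    using that by (auto simp: f_def eta_coeff_def powr_diff powr_minus field_simps)
  have "f 0 = 0" by (simp add: f_def)
  hence "(\<lambda>n. f (Suc n)) sums S" using S by (subst sums_Suc_iff) (simp add: f_def[abs_def])
  from sums_group[OF this, of k] k
  have "(\<lambda>m. \<Sum>n\<in>{m*k..<m*k+k}. f (Suc n)) sums S" by simp
  moreover have "(\<Sum>n\<in>{m*k..<m*k+k}. f (Suc n)) = eta_block k m w" for m
  proof -
    have "(\<Sum>n\<in>{m*k..<m*k+k}. f (Suc n)) = (\<Sum>i=1..k. f (k * m + i))"
      by (rule sum.reindex_bij_witness[of _ "\<lambda>i. m * k + i - 1" "\<lambda>n. Suc n - m * k"]) (auto simp: algebra_simps)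
    also have "\<dots> = (\<Sum>i=1..k. of_nat (k * m + i) powr (- w) - (if i = k then of_nat k * of_nat (k * m + k) powr (- w) else 0))"
    proof (rule sum.cong)
      fix i assume i: "i \<in> {1..k}"
      hence "k dvd k * m + i \<longleftrightarrow> i = k" using dvd_imp_le[of k i] by (auto simp: dvd_add_right_iff)
      thus "f (k * m + i) = of_nat (k * m + i) powr (- w) - (if i = k then of_nat k * of_nat (k * m + k) powr (- w) else 0)"
        using i by (subst f) auto
    qed simp
    also have "\<dots> = eta_block k m w" using k by (simp add: eta_block_def sum_subtractf)
    finally show ?thesis .
  qed
  ultimately have "(\<lambda>m. eta_block k m w) sums S" by simp
  thus ?thesis using eta_blocks_sums[OF k w] by (rule sums_unique2)
qed

section \<open>The orthogonal complement in terms of summatory functions\<close>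

lemma power_series_summable:
  fixes c :: "nat \<Rightarrow> complex"
  assumes b: "\<And>n. cmod (c n) \<le> B" and z: "cmod z < 1"
  shows "summable (\<lambda>n. cmod (c n * z ^ n))"
proof (rule summable_comparison_test')
  show "summable (\<lambda>n. B * cmod z ^ n)" using z by (intro summable_mult summable_geometric) auto
  show "norm (cmod (c n * z ^ n)) \<le> B * cmod z ^ n" for n
    using b[of n] by (simp add: norm_mult norm_power mult_right_mono)
qed

lemma taylor_coeff_sums:
  assumes "f holomorphic_on unit_disk" "z \<in> unit_disk"
  shows "(\<lambda>n. taylor_coeff f n * z ^ n) sums f z"
  using holomorphic_power_series[of f 0 1 z] assms by (simp add: taylor_coeff_def)

lemma taylor_coeff_unique:
  assumes "\<And>z. z \<in> unit_disk \<Longrightarrow> (\<lambda>n. c n * z ^ n) sums f z"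
  shows "f holomorphic_on unit_disk" "taylor_coeff f n = c n"
proof -
  show hol: "f holomorphic_on unit_disk"
    by (rule power_series_holomorphic[of 0 1 c]) (use assms in auto)
  define F where "F = Abs_fps c"
  define G where "G = Abs_fps (taylor_coeff f)"
  have "f has_fps_expansion F" "f has_fps_expansion G"
  proof -
    have *: "f has_fps_expansion Abs_fps d" if d: "\<And>z. z \<in> unit_disk \<Longrightarrow> (\<lambda>n. d n * z ^ n) sums f z" for d
    proof -
      have "conv_radius d \<ge> 1"
      proof (rule conv_radius_geI_ex)
        fix r :: real assume r: "0 < r" "ereal r < 1"
        show "\<exists>z. norm z = r \<and> summable (\<lambda>n. d n * z ^ n)"
          using d[of "of_real r"] r by (intro exI[of _ "of_real r"]) (auto simp: sums_iff)
      qed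
      hence "fps_conv_radius (Abs_fps d) > 0" by (simp add: fps_conv_radius_def) (metis less_le_trans zero_less_one ereal_less(2) one_ereal_def)
      moreover have "eventually (\<lambda>z. eval_fps (Abs_fps d) z = f z) (nhds 0)"
        unfolding eventually_nhds
        by (intro exI[of _ unit_disk]) (use d in \<open>auto simp: eval_fps_def sums_iff\<close>)
      ultimately show ?thesis by (simp add: has_fps_expansion_def)
    qed
    show "f has_fps_expansion F" "f has_fps_expansion G"
      unfolding F_def G_def by (intro * assms taylor_coeff_sums hol; simp)+
  qed
  hence "F = G" by (rule fps_expansion_unique_complex)
  thus "taylor_coeff f n = c n" by (simp add: F_def G_def fps_eq_iff)
qed

definition disk_fun :: "(nat \<Rightarrow> complex) \<Rightarrow> complex \<Rightarrow> complex" where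
  "disk_fun c = (\<lambda>z. if z \<in> unit_disk then \<Sum>n. c n * z ^ n else 0)"

lemma square_summable_bounded:
  assumes "square_summable c" obtains B where "\<And>n. cmod (c n) \<le> B"
proof -
  have "Bseq c" using square_summable_imp_tendsto_0[OF assms] by (intro convergent_imp_Bseq convergentI)
  thus ?thesis using that by (auto simp: Bseq_def)
qed

lemma
  assumes "square_summable c"
  shows disk_fun_in_H2: "disk_fun c \<in> H2"
    and taylor_coeff_disk_fun: "taylor_coeff (disk_fun c) n = c n"
proof -
  obtain B where B: "\<And>n. cmod (c n) \<le> B" using square_summable_bounded[OF assms] by blast
  have *: "(\<lambda>n. c n * z ^ n) sums disk_fun c z" if "z \<in> unit_disk" for z
    using summable_sums[OF summable_norm_cancel[OF power_series_summable[of c B z]]] B that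
    by (simp add: disk_fun_def)
  show tc: "taylor_coeff (disk_fun c) n = c n" for n by (rule taylor_coeff_unique(2)[OF *])
  show "disk_fun c \<in> H2"
    using assms taylor_coeff_unique(1)[OF *]
    unfolding H2_def mem_Collect_eq tc square_summable_def by (auto simp: disk_fun_def)
qed

lemma H2_imp_square_summable: "f \<in> H2 \<Longrightarrow> square_summable (taylor_coeff f)"
  by (simp add: H2_def square_summable_def)

lemma disk_fun_taylor_coeff:
  assumes "f \<in> H2" shows "disk_fun (taylor_coeff f) = f"
proof
  fix z show "disk_fun (taylor_coeff f) z = f z"
    using taylor_coeff_sums[of f z] assms by (auto simp: disk_fun_def H2_def sums_iff)
qed

lemma holomorphic_on_disk_add: "f holomorphic_on unit_disk \<Longrightarrow> g holomorphic_on unit_disk \<Longrightarrow> (f + g) holomorphic_on unit_disk"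
  unfolding plus_fun_def by (intro holomorphic_intros)

lemma holomorphic_on_disk_scale: "f holomorphic_on unit_disk \<Longrightarrow> fun_scale a f holomorphic_on unit_disk"
  unfolding fun_scale_def by (intro holomorphic_intros)

lemma taylor_coeff_add:
  assumes "f holomorphic_on unit_disk" "g holomorphic_on unit_disk"
  shows "taylor_coeff (f + g) n = taylor_coeff f n + taylor_coeff g n"
proof (rule taylor_coeff_unique(2))
  fix z assume "z \<in> unit_disk"
  thus "(\<lambda>n. (taylor_coeff f n + taylor_coeff g n) * z ^ n) sums (f + g) z"
    using sums_add[OF taylor_coeff_sums[OF assms(1)] taylor_coeff_sums[OF assms(2)]]
    by (simp add: algebra_simps)
qed

lemma taylor_coeff_scale:
  assumes "f holomorphic_on unit_disk"
  shows "taylor_coeff (fun_scale a f) n = a * taylor_coeff f n"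
proof (rule taylor_coeff_unique(2))
  fix z assume "z \<in> unit_disk"
  thus "(\<lambda>n. a * taylor_coeff f n * z ^ n) sums fun_scale a f z"
    using sums_mult[OF taylor_coeff_sums[OF assms], of z a]
    by (simp add: fun_scale_def mult.assoc)
qed

text \<open>
  Two branches of the same logarithm have a difference \<open>D\<close> with \<open>exp D = 1\<close>; differentiating
  shows that \<open>D\<close> is constant on the disk.
\<close>

lemma h_log_eq:
  assumes k: "k \<ge> 1" and z: "z \<in> unit_disk"
  shows "h_log k z = Ln (1 - z ^ k) - Ln (1 - z) - of_real (ln (real k))"
proof -
  define L where "L z = (if z \<in> unit_disk then Ln (1 - z ^ k) - Ln (1 - z) - of_real (ln (real k)) else 0)" for z :: complex
  define P where "P L \<longleftrightarrow> L holomorphic_on unit_disk \<and>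
                     (\<forall>z\<in>unit_disk. exp (L z) = (\<Sum>j<k. z ^ j) / of_nat k) \<and>
                     L 0 = of_real (- ln (real k)) \<and>
                     (\<forall>z. z \<notin> unit_disk \<longrightarrow> L z = 0)" for L
  have nonpos: "1 - z \<notin> \<real>\<^sub>\<le>\<^sub>0" if "cmod z < 1" for z
    using complex_Re_le_cmod[of z] that by (auto simp: complex_nonpos_Reals_iff)
  have pk: "cmod (z ^ k) < 1" if "cmod z < 1" for z :: complex
    using that k by (simp add: norm_power power_less_one_iff)
  have hol: "(\<lambda>z. Ln (1 - z ^ k) - Ln (1 - z) - of_real (ln (real k))) holomorphic_on unit_disk"
    by (intro holomorphic_intros nonpos pk) auto
  have holL: "L holomorphic_on unit_disk"
    by (rule holomorphic_transform[OF hol]) (simp add: L_def)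
  have expL: "exp (L z) = (\<Sum>j<k. z ^ j) / of_nat k" if "z \<in> unit_disk" for z
  proof -
    have nz: "1 - z \<noteq> 0" "1 - z ^ k \<noteq> 0" using that nonpos[of z] nonpos[OF pk, of z] by auto
    have "exp (L z) = (1 - z ^ k) / (1 - z) / of_nat k"
      using that nz k by (simp add: L_def exp_diff exp_of_real)
    also have "1 - z ^ k = (1 - z) * (\<Sum>j<k. z ^ j)" by (rule one_diff_power_eq)
    finally show ?thesis using nz by simp
  qed
  have L0: "L 0 = of_real (- ln (real k))" using k by (simp add: L_def power_0_left)
  have PL: "P L" unfolding P_def using holL expL L0 by (simp add: L_def)
  have "M = L" if M: "P M" for M
  proof -
    define D where "D z = M z - L z" for z
    have D: "D holomorphic_on unit_disk" unfolding D_def using holL M by (intro holomorphic_intros) (auto simp: P_def)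
    have expD: "exp (D z) = 1" if "z \<in> unit_disk" for z
    proof -
      have "exp (M z) = exp (L z)" using M expL that by (simp add: P_def)
      thus ?thesis by (simp add: D_def exp_diff)
    qed
    have "D constant_on unit_disk"
    proof (rule has_field_derivative_0_imp_constant_on)
      fix z assume z: "z \<in> unit_disk"
      have der: "(D has_field_derivative deriv D z) (at z)"
        using D z by (intro holomorphic_derivI) auto
      have "((\<lambda>z. exp (D z)) has_field_derivative exp (D z) * deriv D z) (at z)"
        by (rule DERIV_fun_exp[OF der])
      moreover have "((\<lambda>z. exp (D z)) has_field_derivative 0) (at z)"
        by (rule has_field_derivative_transform_within_open[of "\<lambda>_. 1" _ _ unit_disk]) (use z expD in auto)
      ultimately have "exp (D z) * deriv D z = 0" by (rule DERIV_unique)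
      thus "(D has_field_derivative 0) (at z)" using der by simp
    qed auto
    moreover have "D 0 = 0" using M L0 by (simp add: D_def P_def)
    ultimately have "D z = 0" if "z \<in> unit_disk" for z
      using that by (auto simp: constant_on_def)
    thus "M = L" using M by (auto simp: fun_eq_iff D_def P_def L_def)
  qed
  hence "h_log k = L" unfolding h_log_def P_def[symmetric] using PL by blast
  thus ?thesis using z by (simp add: L_def)
qed

text \<open>
  The Taylor coefficients of \<open>h\<^sub>k\<close>: division by \<open>1 - z\<close> turns coefficients into partial sums.
\<close>

definition h_coeff :: "nat \<Rightarrow> nat \<Rightarrow> real" where
  "h_coeff k n = - ln (real k) + (\<Sum>m\<le>n. eta_coeff k m)"

lemma abs_eta_coeff_le: assumes "k \<ge> 1" shows "\<bar>eta_coeff k m\<bar> \<le> real k"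
proof (cases "m = 0")
  case False
  have "\<bar>1 - (if k dvd m then real k else 0)\<bar> \<le> real k" using assms by auto
  also have "\<dots> \<le> real k * real m" using False mult_left_mono[of 1 "real m" "real k"] by simp
  finally show ?thesis using False by (simp add: eta_coeff_def divide_le_eq)
qed (simp add: eta_coeff_def)

lemma h_fun_sums:
  assumes k: "k \<ge> 1" and z: "z \<in> unit_disk"
  shows "(\<lambda>n. of_real (h_coeff k n) * z ^ n) sums h_fun k z"
proof -
  have z1: "cmod z < 1" using z by simp
  hence pk: "cmod (z ^ k) < 1" using k by (simp add: norm_power power_less_one_iff)
  have Ln1: "(\<lambda>n. - (x ^ n) / of_nat n) sums Ln (1 - x)" if "cmod x < 1" for x
    using Ln_series'[of "- x"] that by simp
  define f where "f m = (if k dvd m then - (of_nat k * z ^ m) / of_nat m else 0)" for m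
  have "(\<lambda>n. f (k * n)) sums Ln (1 - z ^ k)"
  proof -
    have "f (k * n) = - ((z ^ k) ^ n) / of_nat n" for n using k by (simp add: f_def power_mult field_simps)
    thus ?thesis using Ln1[OF pk] by simp
  qed
  hence "f sums Ln (1 - z ^ k)"
    by (subst (asm) sums_mono_reindex) (use k in \<open>auto simp: f_def strict_mono_def\<close>)
  from sums_diff[OF this Ln1[OF z1]]
  have 1: "(\<lambda>m. of_real (eta_coeff k m) * z ^ m) sums (Ln (1 - z ^ k) - Ln (1 - z))"
    by (rule back_subst[of "\<lambda>f. f sums _"]) (auto simp: f_def eta_coeff_def fun_eq_iff field_simps diff_divide_distrib)
  define \<beta> where "\<beta> m = of_real (if m = 0 then - ln (real k) else eta_coeff k m) * z ^ m" for m
  have "(\<lambda>m. if m = 0 then of_real (- ln (real k)) else 0) sums (of_real (- ln (real k)) :: complex)"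
    using sums_single[of 0 "\<lambda>_. of_real (- ln (real k)) :: complex"] by simp
  from sums_add[OF 1 this] have "\<beta> sums (Ln (1 - z ^ k) - Ln (1 - z) + of_real (- ln (real k)))"
    by (rule back_subst[of "\<lambda>f. f sums _"]) (auto simp: \<beta>_def eta_coeff_def)
  hence \<beta>: "\<beta> sums h_log k z" using h_log_eq[OF k z] by simp
  have sm\<beta>: "summable (\<lambda>m. cmod (\<beta> m))" unfolding \<beta>_def
    by (rule power_series_summable[OF _ z1, of _ "real k + \<bar>ln (real k)\<bar>"])
      (use abs_eta_coeff_le[OF k] in \<open>auto intro: order_trans[of _ "real k"]\<close>)
  have smg: "summable (\<lambda>n. cmod (z ^ n))" using z1 by (simp add: norm_power summable_geometric)
  have "(\<lambda>n. \<Sum>i\<le>n. \<beta> i * z ^ (n - i)) sums ((\<Sum>n. \<beta> n) * (\<Sum>n. z ^ n))"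
    by (rule Cauchy_product_sums[OF sm\<beta> smg])
  also have "(\<Sum>n. \<beta> n) * (\<Sum>n. z ^ n) = h_fun k z"
    using \<beta> z z1 suminf_geometric[of z] by (simp add: sums_iff h_fun_def)
  also have "(\<lambda>n. \<Sum>i\<le>n. \<beta> i * z ^ (n - i)) = (\<lambda>n. of_real (h_coeff k n) * z ^ n)"
  proof
    fix n
    have "(\<Sum>i\<le>n. \<beta> i * z ^ (n - i)) = (\<Sum>i\<le>n. of_real (if i = 0 then - ln (real k) else eta_coeff k i) * z ^ n)"
    proof (rule sum.cong)
      fix i assume "i \<in> {..n}"
      hence "z ^ i * z ^ (n - i) = z ^ n" by (simp flip: power_add)
      thus "\<beta> i * z ^ (n - i) = of_real (if i = 0 then - ln (real k) else eta_coeff k i) * z ^ n"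
        by (simp only: \<beta>_def mult.assoc)
    qed simp
    also have "\<dots> = of_real (\<Sum>i\<le>n. (if i = 0 then - ln (real k) else 0) + eta_coeff k i) * z ^ n"
      unfolding of_real_sum sum_distrib_right by (rule sum.cong) (auto simp: eta_coeff_def)
    also have "(\<Sum>i\<le>n. (if i = 0 then - ln (real k) else 0) + eta_coeff k i) = h_coeff k n"
      by (simp add: sum.distrib h_coeff_def)
    finally show "(\<Sum>i\<le>n. \<beta> i * z ^ (n - i)) = of_real (h_coeff k n) * z ^ n" .
  qed
  finally show ?thesis .
qed

lemma h_fun_holomorphic: "k \<ge> 1 \<Longrightarrow> h_fun k holomorphic_on unit_disk"
  and taylor_coeff_h_fun: "k \<ge> 1 \<Longrightarrow> taylor_coeff (h_fun k) n = of_real (h_coeff k n)"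
  using taylor_coeff_unique[OF h_fun_sums] by blast+

lemma abs_harm_minus_ln_le:
  "\<bar>harm n - ln (real n + 1) - euler_mascheroni\<bar> \<le> 1 / (real n + 1)"
proof (cases "n = 0")
  case True
  have "euler_mascheroni \<le> (1::real)"
    using euler_mascheroni_bounds[of 1] ln2_ge_two_thirds by (simp add: harm_expand inverse_eq_divide)
  thus ?thesis using True euler_mascheroni_pos by (simp add: harm_def)
next
  case False
  hence n: "n \<ge> 1" by simp
  have "inverse (real (2 * n)) \<le> 1 / (real n + 1)" using n by (simp add: field_simps)
  moreover have "0 \<le> inverse (real (2 * (n + 1)))" "0 \<le> 1 / (real n + 1)" by simp_all
  moreover have "harm n - ln (real n + 1) + inverse (real (2 * (n + 1))) \<le> euler_mascheroni"
    "euler_mascheroni \<le> harm n - ln (real n + 1) + inverse (real (2 * n))"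
    using euler_mascheroni_bounds[OF n] by (simp_all add: add.commute)
  ultimately show ?thesis by linarith
qed

lemma sum_eta_coeff_eq_harm:
  assumes "k \<ge> 1"
  shows "(\<Sum>m\<le>n. eta_coeff k m) = harm n - harm (n div k)"
proof (induction n)
  case 0
  then show ?case by (simp add: eta_coeff_def harm_def)
next
  case (Suc n)
  show ?case
  proof (cases "k dvd Suc n")
    case True
    then obtain q where q: "Suc n = k * q" by blast
    hence "q > 0" using assms by (cases q) auto
    moreover have "Suc n div k = Suc (n div k)" using True by (simp add: div_Suc dvd_eq_mod_eq_0)
    moreover have "Suc n div k = q" using q assms by simp
    moreover have "real k / real (Suc n) = 1 / real q" unfolding q using assms by simp
    ultimately have "harm (Suc n div k) = harm (n div k) + real k / real (Suc n)"
      by (metis harm_Suc inverse_eq_divide)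
    thus ?thesis using True Suc by (simp add: harm_Suc eta_coeff_def diff_divide_distrib inverse_eq_divide)
  next
    case False
    hence "Suc n div k = n div k" by (simp add: div_Suc dvd_eq_mod_eq_0)
    thus ?thesis using False Suc by (simp add: harm_Suc eta_coeff_def inverse_eq_divide)
  qed
qed

text \<open>
  The coefficient is \<open>H\<^sub>n - H\<^bsub>n div k\<^esub> - log k\<close> with harmonic numbers, each of which is
  a logarithm plus Euler's constant up to \<open>O(1 / n)\<close>.
\<close>

lemma abs_h_coeff_le:
  assumes k: "k \<ge> 1"
  shows "\<bar>h_coeff k n\<bar> \<le> (2 * real k + 1) / (real n + 1)"
proof -
  define q where "q = n div k"
  have "n + 1 \<le> k * (q + 1)" "k * (q + 1) \<le> n + k"
    using k dividend_less_div_times[of k n] by (auto simp: q_def algebra_simps)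
  hence "real (n + 1) \<le> real (k * (q + 1))" "real (k * (q + 1)) \<le> real (n + k)" by (simp_all only: of_nat_le_iff)
  hence xy: "real n + 1 \<le> real k * (real q + 1)" "real k * (real q + 1) \<le> real n + real k" by (simp_all add: algebra_simps)
  have kq: "1 / (real q + 1) \<le> real k / (real n + 1)" using xy by (simp add: field_simps)
  define y where "y = real k * (real q + 1) / (real n + 1)"
  have "y \<le> (real n + 1 + real k) / (real n + 1)"
    unfolding y_def using xy by (intro divide_right_mono) auto
  also have "\<dots> = 1 + real k / (real n + 1)" by (simp add: add_divide_distrib)
  finally have y: "1 \<le> y" "y \<le> 1 + real k / (real n + 1)" using xy by (auto simp: y_def)
  have "ln (real n + 1) - ln (real q + 1) - ln (real k) = - ln y"
    using k by (simp add: y_def ln_div ln_mult add_pos_nonneg)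
  moreover have "0 \<le> ln y" "ln y \<le> y - 1" using y ln_le_minus_one[of y] by auto
  ultimately have "\<bar>ln (real n + 1) - ln (real q + 1) - ln (real k)\<bar> \<le> real k / (real n + 1)" using y by simp
  moreover have "h_coeff k n = (harm n - ln (real n + 1) - euler_mascheroni)
      - (harm q - ln (real q + 1) - euler_mascheroni) + (ln (real n + 1) - ln (real q + 1) - ln (real k))"
    by (simp add: h_coeff_def sum_eta_coeff_eq_harm[OF k] q_def)
  ultimately have "\<bar>h_coeff k n\<bar> \<le> 1 / (real n + 1) + real k / (real n + 1) + real k / (real n + 1)"
    using abs_harm_minus_ln_le[of n] abs_harm_minus_ln_le[of q] kq by linarith
  also have "\<dots> = (2 * real k + 1) / (real n + 1)" by (simp add: add_divide_distrib)
  finally show ?thesis .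
qed

lemma square_summable_h_coeff:
  assumes "k \<ge> 1" shows "square_summable (\<lambda>n. of_real (h_coeff k n))"
  unfolding square_summable_def
proof (rule summable_comparison_test')
  show "summable (\<lambda>n. (2 * real k + 1)\<^sup>2 * (1 / real (Suc n) powr 2))"
    by (intro summable_mult summable_inverse_powr) simp
  fix n
  have "\<bar>h_coeff k n\<bar>\<^sup>2 \<le> ((2 * real k + 1) / (real n + 1))\<^sup>2"
    by (rule power_mono[OF abs_h_coeff_le[OF assms]]) simp
  thus "norm ((cmod (of_real (h_coeff k n)))\<^sup>2) \<le> (2 * real k + 1)\<^sup>2 * (1 / real (Suc n) powr 2)"
    by (simp add: power_divide add.commute)
qed

lemma square_summable_mult_summable:
  assumes "square_summable c" "square_summable d"
  shows "summable (\<lambda>n. c n * d n)"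
proof (rule summable_comparison_test')
  show "summable (\<lambda>n. (cmod (c n))\<^sup>2 + (cmod (d n))\<^sup>2)"
    using assms by (intro summable_add) (auto simp: square_summable_def)
  fix n
  have "0 \<le> (cmod (c n) - cmod (d n))\<^sup>2" by simp
  hence "2 * (cmod (c n) * cmod (d n)) \<le> (cmod (c n))\<^sup>2 + (cmod (d n))\<^sup>2" by (simp add: power2_diff)
  moreover have "0 \<le> cmod (c n) * cmod (d n)" by simp
  ultimately show "norm (c n * d n) \<le> (cmod (c n))\<^sup>2 + (cmod (d n))\<^sup>2" unfolding norm_mult by linarith
qed

definition summatory :: "(complex \<Rightarrow> complex) \<Rightarrow> nat \<Rightarrow> complex" where
  "summatory f n = (\<Sum>j<n. taylor_coeff f j)"

text \<open>
  The boundary term of the summation by parts is \<open>O(1 / N) * o(\<surd>N)\<close>.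
\<close>

lemma h_coeff_abel_summation:
  assumes k: "k \<ge> 1" and c: "square_summable c"
  shows "(\<lambda>m. of_real (eta_coeff k m) * (\<Sum>j<m. c j)) sums (- (\<Sum>n. c n * of_real (h_coeff k n)))"
proof -
  define G where "G m = (\<Sum>j<m. c j)" for m
  have abel: "(\<Sum>n<N. c n * of_real (h_coeff k n)) = of_real (h_coeff k N) * G N - (\<Sum>m<Suc N. of_real (eta_coeff k m) * G m)" for N
  proof (induction N)
    case (Suc N)
    have "of_real (h_coeff k (Suc N)) = (of_real (h_coeff k N) + of_real (eta_coeff k (Suc N)) :: complex)"
      by (simp add: h_coeff_def)
    moreover have "G (Suc N) = G N + c N" by (simp add: G_def)
    ultimately show ?case using Suc by (simp add: algebra_simps)
  qed (simp add: G_def)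
  have "(\<lambda>N. of_real (h_coeff k N) * G N) \<longlonglongrightarrow> 0"
  proof (rule Lim_null_comparison)
    have "(\<lambda>N. cmod (G N / of_real (sqrt (real N)))) \<longlonglongrightarrow> 0"
      using square_summable_partial_sums[OF c] by (simp only: G_def tendsto_norm_zero_iff)
    thus "(\<lambda>N. (2 * real k + 1) * cmod (G N / of_real (sqrt (real N)))) \<longlonglongrightarrow> 0"
      by (rule tendsto_mult_right_zero)
    show "\<forall>\<^sub>F N in sequentially. norm (of_real (h_coeff k N) * G N) \<le> (2 * real k + 1) * cmod (G N / of_real (sqrt (real N)))"
    proof (rule eventually_sequentiallyI[of 1])
      fix N :: nat assume N: "N \<ge> 1"
      have "sqrt (real N) \<le> real N + 1" using N real_sqrt_le_mono[of "real N" "(real N)\<^sup>2"] by (simp add: power2_eq_square)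
      hence "(2 * real k + 1) / (real N + 1) \<le> (2 * real k + 1) / sqrt (real N)"
        using N by (intro divide_left_mono) auto
      with abs_h_coeff_le[OF k, of N] have "\<bar>h_coeff k N\<bar> \<le> (2 * real k + 1) / sqrt (real N)" by linarith
      from mult_right_mono[OF this, of "cmod (G N)"]
      show "norm (of_real (h_coeff k N) * G N) \<le> (2 * real k + 1) * cmod (G N / of_real (sqrt (real N)))"
        by (simp add: norm_mult norm_divide)
    qed
  qed
  moreover have "(\<lambda>N. \<Sum>n<N. c n * of_real (h_coeff k n)) \<longlonglongrightarrow> (\<Sum>n. c n * of_real (h_coeff k n))"
    using summable_LIMSEQ[OF square_summable_mult_summable[OF c square_summable_h_coeff[OF k]]] .
  ultimately have "(\<lambda>N. of_real (h_coeff k N) * G N - (\<Sum>n<N. c n * of_real (h_coeff k n))) \<longlonglongrightarrow> 0 - (\<Sum>n. c n * of_real (h_coeff k n))"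
    by (rule tendsto_diff)
  hence "(\<lambda>N. \<Sum>m<Suc N. of_real (eta_coeff k m) * G m) \<longlonglongrightarrow> - (\<Sum>n. c n * of_real (h_coeff k n))"
    unfolding abel by simp
  hence "(\<lambda>m. of_real (eta_coeff k m) * G m) sums (- (\<Sum>n. c n * of_real (h_coeff k n)))"
    unfolding sums_def by (rule LIMSEQ_imp_Suc)
  thus ?thesis by (simp only: G_def)
qed

text \<open>
  The summatory functions of the elements of the orthogonal complement.
\<close>

definition eta_annihilator :: "(nat \<Rightarrow> complex) set" where
  "eta_annihilator = {G. G 0 = 0 \<and> square_summable (incr G) \<and>
     (\<forall>k\<ge>2. (\<lambda>m. of_real (eta_coeff k m) * G m) sums 0)}"

lemma H2_inner_h_fun:
  "k \<ge> 1 \<Longrightarrow> H2_inner f (h_fun k) = (\<Sum>n. taylor_coeff f n * of_real (h_coeff k n))"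
  by (simp add: H2_inner_def taylor_coeff_h_fun)

lemma summatory_eta_annihilator_iff:
  assumes f: "f \<in> H2"
  shows "summatory f \<in> eta_annihilator \<longleftrightarrow> (\<forall>k\<ge>2. H2_inner f (h_fun k) = 0)"
proof -
  have incr: "incr (summatory f) = taylor_coeff f" by (auto simp: summatory_def)
  have ss: "square_summable (taylor_coeff f)" by (rule H2_imp_square_summable[OF f])
  have "(\<lambda>m. of_real (eta_coeff k m) * summatory f m) sums 0 \<longleftrightarrow> H2_inner f (h_fun k) = 0" if "k \<ge> 2" for k
  proof -
    have "(\<lambda>m. of_real (eta_coeff k m) * summatory f m) sums (- H2_inner f (h_fun k))"
      using h_coeff_abel_summation[OF _ ss, of k] that by (simp add: H2_inner_h_fun summatory_def[abs_def])
    thus ?thesis by (metis neg_equal_0_iff_equal sums_unique2)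
  qed
  thus ?thesis by (auto simp: eta_annihilator_def incr ss summatory_def[of f 0])
qed

lemma H2_orthogonal_N_space_iff:
  "f \<in> H2_orthogonal N_space \<longleftrightarrow> f \<in> H2 \<and> summatory f \<in> eta_annihilator"
proof (intro iffI conjI)
  assume "f \<in> H2_orthogonal N_space"
  hence f: "f \<in> H2" "\<And>g. g \<in> N_space \<Longrightarrow> H2_inner f g = 0" by (auto simp: H2_orthogonal_def)
  have "h_fun k \<in> N_space" if "k \<ge> 2" for k
    unfolding N_space_def using that by (intro fun_vs.span_base) auto
  thus "f \<in> H2" "summatory f \<in> eta_annihilator" using f by (auto simp: summatory_eta_annihilator_iff)
next
  assume "f \<in> H2 \<and> summatory f \<in> eta_annihilator"
  hence f: "f \<in> H2" and h: "\<And>k. k \<ge> 2 \<Longrightarrow> H2_inner f (h_fun k) = 0"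
    by (auto simp: summatory_eta_annihilator_iff)
  define P where "P g \<longleftrightarrow> g holomorphic_on unit_disk \<and> (\<lambda>n. taylor_coeff f n * cnj (taylor_coeff g n)) sums 0" for g
  have "P g" if "g \<in> N_space" for g
    using that unfolding N_space_def
  proof (induction rule: fun_vs.span_induct_alt)
    case base
    have "taylor_coeff 0 n = 0" for n by (rule taylor_coeff_unique(2)) auto
    thus ?case by (simp add: P_def zero_fun_def)
  next
    case (step c g1 g2)
    then obtain k where k: "k \<ge> 2" "g1 = h_fun k" by auto
    have hol: "g1 holomorphic_on unit_disk" using k h_fun_holomorphic[of k] by simp
    have "(\<lambda>n. taylor_coeff f n * cnj (taylor_coeff g1 n)) sums 0"
      using h[OF k(1)] square_summable_mult_summable[OF H2_imp_square_summable[OF f] square_summable_h_coeff[of k]] k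
      by (simp add: H2_inner_def taylor_coeff_h_fun sums_iff)
    from sums_add[OF sums_mult[OF this, of "cnj c"]] step.IH hol
    have "(\<lambda>n. cnj c * (taylor_coeff f n * cnj (taylor_coeff g1 n)) + taylor_coeff f n * cnj (taylor_coeff g2 n)) sums 0"
      by (fastforce simp: P_def)
    moreover have hol': "fun_scale c g1 holomorphic_on unit_disk" "g2 holomorphic_on unit_disk"
      using hol step.IH by (auto simp: P_def holomorphic_on_disk_scale)
    have "taylor_coeff f n * cnj (taylor_coeff (fun_scale c g1 + g2) n)
        = cnj c * (taylor_coeff f n * cnj (taylor_coeff g1 n)) + taylor_coeff f n * cnj (taylor_coeff g2 n)" for n
      unfolding taylor_coeff_add[OF hol'] taylor_coeff_scale[OF hol] by (simp add: algebra_simps)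
    ultimately show ?case using holomorphic_on_disk_add[OF hol'] unfolding P_def by (simp only: simp_thms)
  qed
  thus "f \<in> H2_orthogonal N_space" using f by (auto simp: H2_orthogonal_def H2_inner_def P_def sums_iff)
qed

lemma disk_fun_incr_in_orthogonal:
  assumes "G \<in> eta_annihilator"
  shows "disk_fun (incr G) \<in> H2_orthogonal N_space" "summatory (disk_fun (incr G)) = G"
proof -
  have ss: "square_summable (incr G)" and G0: "G 0 = 0" using assms by (auto simp: eta_annihilator_def)
  show *: "summatory (disk_fun (incr G)) = G"
    using G0 by (simp add: summatory_def fun_eq_iff taylor_coeff_disk_fun[OF ss] sum_lessThan_telescope)
  show "disk_fun (incr G) \<in> H2_orthogonal N_space"
    unfolding H2_orthogonal_N_space_iff * using assms disk_fun_in_H2[OF ss] by simp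
qed

lemma square_summable_incr_dilate:
  assumes "square_summable (incr G)" and n: "n \<ge> 1"
  shows "square_summable (incr (\<lambda>m. G (n * m)))"
proof -
  have "summable (\<lambda>j. (cmod (incr G j))\<^sup>2)" using assms by (simp add: square_summable_def)
  from sums_group[OF summable_sums[OF this], of n] n
  have "summable (\<lambda>m. \<Sum>j\<in>{m*n..<m*n+n}. (cmod (incr G j))\<^sup>2)" by (auto simp: sums_iff)
  hence sm: "summable (\<lambda>m. real n * (\<Sum>j\<in>{m*n..<m*n+n}. (cmod (incr G j))\<^sup>2))" by (rule summable_mult)
  show ?thesis unfolding square_summable_def
  proof (rule summable_comparison_test'[OF sm])
    fix m
    have "G (n * Suc m) - G (n * m) = (\<Sum>j\<in>{m*n..<m*n+n}. incr G j)"
      using sum_Suc_diff'[of "m*n" "m*n+n" G] by (simp add: algebra_simps)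
    hence "cmod (G (n * Suc m) - G (n * m)) \<le> (\<Sum>j\<in>{m*n..<m*n+n}. cmod (incr G j))"
      by (simp add: norm_sum)
    also have "\<dots> \<le> sqrt (real n) * sqrt (\<Sum>j\<in>{m*n..<m*n+n}. (cmod (incr G j))\<^sup>2)"
      using sum_cmod_le_sqrt_card[of "{m*n..<m*n+n}" "incr G"] by simp
    finally have "(cmod (G (n * Suc m) - G (n * m)))\<^sup>2 \<le> (sqrt (real n) * sqrt (\<Sum>j\<in>{m*n..<m*n+n}. (cmod (incr G j))\<^sup>2))\<^sup>2"
      by (intro power_mono) auto
    thus "norm ((cmod (G (n * Suc m) - G (n * m)))\<^sup>2) \<le> real n * (\<Sum>j\<in>{m*n..<m*n+n}. (cmod (incr G j))\<^sup>2)"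
      by (simp add: power_mult_distrib sum_nonneg)
  qed
qed

text \<open>
  The function \<open>eta_coeff (n * k) - eta_coeff n\<close> is supported on the multiples of \<open>n\<close> and takes
  the value \<open>eta_coeff k m\<close> at \<open>n * m\<close>.
\<close>

lemma eta_annihilator_dilate:
  assumes G: "G \<in> eta_annihilator" and n: "n \<ge> 1"
  shows "(\<lambda>m. G (n * m)) \<in> eta_annihilator"
proof -
  have ss: "square_summable (incr G)" and G0: "G 0 = 0"
    and S: "\<And>k. k \<ge> 2 \<Longrightarrow> (\<lambda>m. of_real (eta_coeff k m) * G m) sums 0"
    using G by (auto simp: eta_annihilator_def)
  \<comment> \<open>The case \<open>k = 1\<close> is trivial but needed, since \<open>n\<close> may be 1.\<close>
  have S1: "(\<lambda>m. of_real (eta_coeff k m) * G m) sums 0" if "k \<ge> 1" for k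
  proof (cases "k = 1")
    case True thus ?thesis by (simp add: eta_coeff_def)
  qed (use S[of k] that in auto)
  have "(\<lambda>m. of_real (eta_coeff k m) * G (n * m)) sums 0" if k: "k \<ge> 2" for k
  proof -
    define f where "f m = of_real (eta_coeff (n * k) m - eta_coeff n m) * G m" for m
    have "f sums (0 - 0)"
      using sums_diff[OF S1[of "n * k"] S1[of n]] n k by (simp add: f_def[abs_def] left_diff_distrib)
    hence "f sums 0" by simp
    moreover have "f m = 0" if "m \<notin> range ((*) n)" for m
    proof -
      have "\<not> n dvd m" using that by (auto simp: image_iff dvd_def)
      hence "\<not> n * k dvd m" using dvd_mult_left by blast
      thus ?thesis using \<open>\<not> n dvd m\<close> by (simp add: f_def eta_coeff_def)
    qed
    moreover have "strict_mono ((*) n)" using n by (auto simp: strict_mono_def)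
    ultimately have "(\<lambda>m. f (n * m)) sums 0" by (subst sums_mono_reindex) auto
    moreover have "f (n * m) = of_real (eta_coeff k m) * G (n * m)" for m
    proof -
      have "eta_coeff (n * k) (n * m) - eta_coeff n (n * m) = eta_coeff k m"
        using n by (cases "m = 0") (auto simp: eta_coeff_def field_simps)
      thus ?thesis by (simp only: f_def)
    qed
    ultimately show ?thesis by simp
  qed
  thus ?thesis using G0 square_summable_incr_dilate[OF ss n] by (auto simp: eta_annihilator_def)
qed

lemma eta_annihilator_add:
  assumes "G \<in> eta_annihilator" "H \<in> eta_annihilator"
  shows "(\<lambda>n. G n + H n) \<in> eta_annihilator"
proof -
  have "(\<lambda>m. of_real (eta_coeff k m) * (G m + H m)) sums 0" if "k \<ge> 2" for k
    using sums_add[of "\<lambda>m. of_real (eta_coeff k m) * G m" 0 "\<lambda>m. of_real (eta_coeff k m) * H m" 0] assms that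
    by (auto simp: eta_annihilator_def distrib_left)
  moreover have "square_summable (\<lambda>n. incr G n + incr H n)"
    using assms by (intro square_summable_add) (auto simp: eta_annihilator_def)
  hence "square_summable (incr (\<lambda>n. G n + H n))" by (simp add: algebra_simps)
  ultimately show ?thesis using assms by (simp add: eta_annihilator_def)
qed

lemma eta_annihilator_scale:
  assumes "G \<in> eta_annihilator"
  shows "(\<lambda>n. a * G n) \<in> eta_annihilator"
proof -
  have "(\<lambda>m. of_real (eta_coeff k m) * (a * G m)) sums 0" if "k \<ge> 2" for k
    using sums_mult[of "\<lambda>m. of_real (eta_coeff k m) * G m" 0 a] assms that
    by (auto simp: eta_annihilator_def mult.left_commute)
  moreover have "square_summable (\<lambda>n. a * incr G n)"
    using assms by (intro square_summable_scale) (auto simp: eta_annihilator_def)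
  ultimately show ?thesis using assms by (simp add: eta_annihilator_def right_diff_distrib)
qed

lemma H2_add:
  assumes "f \<in> H2" "g \<in> H2"
  shows "f + g \<in> H2" "summatory (f + g) = (\<lambda>n. summatory f n + summatory g n)"
proof -
  have hol: "f holomorphic_on unit_disk" "g holomorphic_on unit_disk" using assms by (auto simp: H2_def)
  have "summable (\<lambda>n. (cmod (taylor_coeff (f + g) n))\<^sup>2)"
    using square_summable_add[OF assms[THEN H2_imp_square_summable]]
    by (simp add: taylor_coeff_add[OF hol] square_summable_def)
  thus "f + g \<in> H2" using assms holomorphic_on_disk_add[OF hol] unfolding H2_def by simp
  show "summatory (f + g) = (\<lambda>n. summatory f n + summatory g n)"
    by (simp add: fun_eq_iff summatory_def taylor_coeff_add[OF hol] sum.distrib)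
qed

lemma H2_scale:
  assumes "f \<in> H2"
  shows "fun_scale a f \<in> H2" "summatory (fun_scale a f) = (\<lambda>n. a * summatory f n)"
proof -
  have hol: "f holomorphic_on unit_disk" using assms by (auto simp: H2_def)
  have "summable (\<lambda>n. (cmod (taylor_coeff (fun_scale a f) n))\<^sup>2)"
    using square_summable_scale[OF H2_imp_square_summable[OF assms], of a]
    by (simp add: taylor_coeff_scale[OF hol] square_summable_def)
  thus "fun_scale a f \<in> H2" using assms holomorphic_on_disk_scale[OF hol, of a]
    unfolding H2_def by (simp add: fun_scale_def)
  show "summatory (fun_scale a f) = (\<lambda>n. a * summatory f n)"
    by (simp add: fun_eq_iff summatory_def taylor_coeff_scale[OF hol] sum_distrib_left)
qed

lemma H2_zero: "0 \<in> H2" "summatory 0 = (\<lambda>n. 0)"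
proof -
  have tc: "taylor_coeff 0 n = 0" for n by (rule taylor_coeff_unique(2)) auto
  show "0 \<in> H2" unfolding H2_def mem_Collect_eq tc by (simp add: zero_fun_def)
  show "summatory 0 = (\<lambda>n. 0)" by (simp add: summatory_def fun_eq_iff tc)
qed

lemma H2_eqI:
  assumes "f \<in> H2" "g \<in> H2" "summatory f = summatory g"
  shows "f = g"
proof -
  have "taylor_coeff f n = taylor_coeff g n" for n
    using assms(3) by (simp add: summatory_def fun_eq_iff) (metis add_left_cancel sum.lessThan_Suc)
  thus ?thesis using disk_fun_taylor_coeff assms(1,2) by (metis ext)
qed

lemma H2_orthogonal_subspace: "fun_vs.subspace (H2_orthogonal N_space)"
proof (rule fun_vs.subspaceI)
  show "0 \<in> H2_orthogonal N_space"
    unfolding H2_orthogonal_N_space_iff H2_zero by (simp add: H2_zero eta_annihilator_def square_summable_def)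
qed (auto simp: H2_orthogonal_N_space_iff H2_add H2_scale eta_annihilator_add eta_annihilator_scale)

lemma H2_linear_combination:
  assumes "finite I" "\<And>i. i \<in> I \<Longrightarrow> f i \<in> H2"
  shows "(\<Sum>i\<in>I. fun_scale (c i) (f i)) \<in> H2 \<and>
    summatory (\<Sum>i\<in>I. fun_scale (c i) (f i)) = (\<lambda>n. \<Sum>i\<in>I. c i * summatory (f i) n)"
  using assms
proof (induction I rule: finite_induct)
  case empty
  show ?case by (simp only: sum.empty H2_zero simp_thms)
next
  case (insert i I)
  have IH: "(\<Sum>i\<in>I. fun_scale (c i) (f i)) \<in> H2"
    "summatory (\<Sum>i\<in>I. fun_scale (c i) (f i)) = (\<lambda>n. \<Sum>i\<in>I. c i * summatory (f i) n)"
    using insert by auto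
  have fi: "f i \<in> H2" using insert.prems by simp
  show ?case
    unfolding sum.insert[OF insert.hyps] H2_add[OF H2_scale(1)[OF fi] IH(1)] IH H2_scale(2)[OF fi]
    by (intro conjI refl H2_add(1)[OF H2_scale(1)[OF fi] IH(1)])
qed

section \<open>Common eigenvectors of commuting operators\<close>

lemma (in vector_space) finite_dim_sequence_dependent:
  assumes B: "finite B" and v: "\<And>n::nat. v n \<in> span B"
  shows "\<exists>c d. (\<exists>i\<le>d. c i \<noteq> 0) \<and> (\<Sum>i\<le>d. scale (c i) (v i)) = 0"
proof (cases "inj_on v {..card B}")
  case True
  have "dependent (v ` {..card B})"
  proof (rule ccontr)
    assume "\<not> dependent (v ` {..card B})"
    from independent_span_bound[OF B this] v have "card (v ` {..card B}) \<le> card B" by blast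
    thus False using card_image[OF True] by simp
  qed
  then obtain u w where u: "w \<in> v ` {..card B}" "u w \<noteq> 0" "(\<Sum>w\<in>v ` {..card B}. scale (u w) w) = 0"
    by (subst (asm) dependent_finite) auto
  have "(\<Sum>i\<le>card B. scale (u (v i)) (v i)) = 0"
    using u(3) by (subst (asm) sum.reindex[OF True]) (simp add: o_def)
  thus ?thesis using u by (intro exI[of _ "\<lambda>i. u (v i)"] exI[of _ "card B"]) auto
next
  case False
  then obtain i j where ij: "i \<le> card B" "j \<le> card B" "i \<noteq> j" "v i = v j" by (auto simp: inj_on_def)
  define c where "c l = (if l = i then 1 else if l = j then - 1 else 0 :: 'a)" for l
  have "(\<Sum>l\<le>card B. scale (c l) (v l)) = (\<Sum>l\<in>{i, j}. scale (c l) (v l))"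
    using ij by (intro sum.mono_neutral_right) (auto simp: c_def)
  also have "\<dots> = 0" using ij by (simp add: c_def)
  finally show ?thesis using ij by (intro exI[of _ c] exI[of _ "card B"]) (auto simp: c_def intro!: exI[of _ i])
qed

text \<open>
  Choose \<open>p\<close> of least degree with \<open>p(T) x = 0\<close> and split off a root \<open>a\<close>, \<open>p = (X - a) q\<close>: then
  \<open>q(T) x\<close> is an eigenvector.
\<close>

lemma eigenvector_exists:
  fixes scale :: "complex \<Rightarrow> 'b::ab_group_add \<Rightarrow> 'b" and T :: "'b \<Rightarrow> 'b"
  assumes vs: "vector_space scale"
    and V: "module.subspace scale V" and x: "x \<in> V" "x \<noteq> 0"
    and B: "finite B" "V \<subseteq> module.span scale B"
    and TV: "\<And>v. v \<in> V \<Longrightarrow> T v \<in> V"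
    and add: "\<And>v w. v \<in> V \<Longrightarrow> w \<in> V \<Longrightarrow> T (v + w) = T v + T w"
    and hom: "\<And>a v. v \<in> V \<Longrightarrow> T (scale a v) = scale a (T v)"
  shows "\<exists>v\<in>V. v \<noteq> 0 \<and> (\<exists>a. T v = scale a v)"
proof -
  interpret vector_space scale by (rule vs)
  define P where "P p v = (\<Sum>i\<le>degree p. scale (coeff p i) ((T ^^ i) v))" for p v
  have P_alt: "P p v = (\<Sum>i\<le>n. scale (coeff p i) ((T ^^ i) v))" if "degree p \<le> n" for p v n
    unfolding P_def using that by (intro sum.mono_neutral_left) (auto simp: coeff_eq_0)
  have pow: "(T ^^ i) v \<in> V" if "v \<in> V" for i v by (induction i) (auto simp: that TV)
  have P_in: "P p v \<in> V" if "v \<in> V" for p v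
    unfolding P_def by (intro subspace_sum[OF V] subspace_scale[OF V] pow that)
  have T_sum: "T (\<Sum>i\<in>I. f i) = (\<Sum>i\<in>I. T (f i))" if "\<And>i. i \<in> I \<Longrightarrow> f i \<in> V" "finite I" for f and I :: "nat set"
    using that(2,1)
  proof (induction I rule: finite_induct)
    case empty
    have "T (0 + 0) = T 0 + T 0" by (rule add[OF subspace_0[OF V] subspace_0[OF V]])
    hence "T 0 = T 0 + T 0" by (simp only: add_0_left)
    hence "T 0 = 0" by (rule add_cancel_right_right[THEN iffD1])
    thus ?case by simp
  next
    case (insert i I)
    thus ?case by (simp add: add subspace_sum[OF V])
  qed
  have P_lin: "P ([:-a, 1:] * q) v = T (P q v) - scale a (P q v)" if v: "v \<in> V" for a q v
  proof -
    define n where "n = degree q"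
    have TP: "T (P q v) = (\<Sum>i\<le>n. scale (coeff q i) ((T ^^ Suc i) v))"
      unfolding P_def n_def
      by (subst T_sum) (auto intro!: subspace_scale[OF V] pow v simp: hom pow v)
    have "degree ([:-a, 1:] * q) \<le> Suc n" using degree_mult_le[of "[:-a,1:]" q] by (simp add: n_def)
    hence "P ([:-a, 1:] * q) v = (\<Sum>i\<le>Suc n. scale (coeff ([:-a, 1:] * q) i) ((T ^^ i) v))" by (rule P_alt)
    also have "\<dots> = (\<Sum>i\<le>Suc n. scale (coeff (pCons 0 q) i) ((T ^^ i) v) - scale (a * coeff q i) ((T ^^ i) v))"
    proof (rule sum.cong)
      fix i
      have "coeff ([:-a, 1:] * q) i = coeff (pCons 0 q) i - a * coeff q i" by simp
      thus "scale (coeff ([:-a, 1:] * q) i) ((T ^^ i) v) = scale (coeff (pCons 0 q) i) ((T ^^ i) v) - scale (a * coeff q i) ((T ^^ i) v)"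
        by (simp only: scale_left_diff_distrib)
    qed simp
    also have "\<dots> = (\<Sum>i\<le>Suc n. scale (coeff (pCons 0 q) i) ((T ^^ i) v)) - (\<Sum>i\<le>Suc n. scale (a * coeff q i) ((T ^^ i) v))"
      by (rule sum_subtractf)
    also have "(\<Sum>i\<le>Suc n. scale (coeff (pCons 0 q) i) ((T ^^ i) v)) = T (P q v)"
      unfolding TP by (subst sum.atMost_Suc_shift) simp
    also have "(\<Sum>i\<le>Suc n. scale (a * coeff q i) ((T ^^ i) v)) = scale a (P q v)"
      by (subst P_alt[of q "Suc n"]) (simp_all only: n_def scale_sum_right scale_scale le_SucI order_refl)
    finally show ?thesis .
  qed
  have "\<exists>p. p \<noteq> 0 \<and> P p x = 0"
  proof -
    have "(T ^^ n) x \<in> span B" for n using pow[OF x(1)] B(2) by blast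
    from finite_dim_sequence_dependent[OF B(1), of "\<lambda>n. (T ^^ n) x", OF this]
    obtain c d where cd: "(\<exists>i\<le>d. c i \<noteq> 0) \<and> (\<Sum>i\<le>d. scale (c i) ((T ^^ i) x)) = 0"
      by (elim exE) (rule that)
    define p where "p = (\<Sum>i\<le>d. monom (c i) i)"
    have co: "coeff p i = (if i \<le> d then c i else 0)" for i
      by (simp add: p_def coeff_sum if_distrib cong: if_cong)
    hence "p \<noteq> 0" using cd[THEN conjunct1] by (auto simp: poly_eq_iff)
    moreover have "degree p \<le> d" by (rule degree_le) (simp add: co)
    hence "P p x = (\<Sum>i\<le>d. scale (coeff p i) ((T ^^ i) x))" by (rule P_alt)
    moreover have "\<dots> = (\<Sum>i\<le>d. scale (c i) ((T ^^ i) x))" by (intro sum.cong) (auto simp: co)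
    ultimately show ?thesis using cd[THEN conjunct2] by (intro exI[of _ p]) simp
  qed
  then obtain p where p: "p \<noteq> 0" "P p x = 0" "\<And>q. q \<noteq> 0 \<Longrightarrow> P q x = 0 \<Longrightarrow> degree p \<le> degree q"
    using ex_has_least_nat[of "\<lambda>p. p \<noteq> 0 \<and> P p x = 0" _ degree] by metis
  have "degree p \<noteq> 0"
  proof
    assume "degree p = 0"
    then obtain a where "p = [:a:]" by (metis degree_eq_zeroE)
    thus False using p x by (simp add: P_def)
  qed
  hence "\<exists>i\<in>{1..degree p}. coeff p i \<noteq> 0" using p(1) by (intro bexI[of _ "degree p"]) auto
  then obtain a where "(\<Sum>i\<le>degree p. coeff p i * a ^ i) = 0"
    using fundamental_theorem_of_algebra[of "coeff p" "degree p"] by metis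
  hence "poly p a = 0" by (simp only: poly_altdef)
  hence "[:-a, 1:] dvd p" by (rule poly_eq_0_iff_dvd[THEN iffD1])
  then obtain q where q: "p = [:-a, 1:] * q" by (rule dvdE)
  have "q \<noteq> 0" using q p by auto
  hence "degree q < degree p" unfolding q by (subst degree_mult_eq) auto
  hence "P q x \<noteq> 0" using p(3)[of q] \<open>q \<noteq> 0\<close> by auto
  moreover have "T (P q x) = scale a (P q x)" using P_lin[OF x(1), of a q] p(2) q by simp
  ultimately show ?thesis using P_in[OF x(1)] by blast
qed

text \<open>
  In an invariant non-zero subspace \<open>U\<close> of least dimension every operator has an eigenspace, which
  is again invariant as the operators commute, and is therefore all of \<open>U\<close>.  So every
  non-zero vector of \<open>U\<close> is a common eigenvector.
\<close>

lemma common_eigenvector_exists: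
  fixes scale :: "complex \<Rightarrow> 'b::ab_group_add \<Rightarrow> 'b" and T :: "'i \<Rightarrow> 'b \<Rightarrow> 'b"
  assumes vs: "vector_space scale"
    and V: "module.subspace scale V" and x: "x \<in> V" "x \<noteq> 0"
    and B: "finite B" "V \<subseteq> module.span scale B"
    and TV: "\<And>i v. v \<in> V \<Longrightarrow> T i v \<in> V"
    and add: "\<And>i v w. v \<in> V \<Longrightarrow> w \<in> V \<Longrightarrow> T i (v + w) = T i v + T i w"
    and hom: "\<And>i a v. v \<in> V \<Longrightarrow> T i (scale a v) = scale a (T i v)"
    and comm: "\<And>i j v. v \<in> V \<Longrightarrow> T i (T j v) = T j (T i v)"
  shows "\<exists>v\<in>V. v \<noteq> 0 \<and> (\<forall>i. \<exists>a. T i v = scale a v)"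
proof -
  interpret vector_space scale by (rule vs)
  define Inv where "Inv U \<longleftrightarrow> subspace U \<and> U \<subseteq> V \<and> (\<exists>x\<in>U. x \<noteq> 0) \<and> (\<forall>i. \<forall>v\<in>U. T i v \<in> U)" for U
  have "Inv V" using V x TV by (auto simp: Inv_def)
  then obtain U where U: "Inv U" "\<And>U'. Inv U' \<Longrightarrow> dim U \<le> dim U'"
    using ex_has_least_nat[of Inv V dim] by metis
  have subU: "subspace U" "U \<subseteq> V" and invU: "\<And>i v. v \<in> U \<Longrightarrow> T i v \<in> U" using U by (auto simp: Inv_def)
  obtain y where y: "y \<in> U" "y \<noteq> 0" using U by (auto simp: Inv_def)
  have "\<exists>a. T i y = scale a y" for i
  proof -
    have "\<exists>v\<in>U. v \<noteq> 0 \<and> (\<exists>a. T i v = scale a v)"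
    proof (rule eigenvector_exists[OF vs subU(1) y B(1)])
      show "U \<subseteq> span B" using subU(2) B(2) by (rule order_trans)
      show "T i v \<in> U" if "v \<in> U" for v using that by (rule invU)
      show "T i (v + w) = T i v + T i w" if "v \<in> U" "w \<in> U" for v w
        using that subU(2) by (intro add) auto
      show "T i (scale a v) = scale a (T i v)" if "v \<in> U" for v a
        using that subU(2) by (intro hom) auto
    qed
    then obtain v a where v: "v \<in> U" "v \<noteq> 0" "T i v = scale a v" by blast
    define E where "E = {v \<in> U. T i v = scale a v}"
    have "Inv E" unfolding Inv_def
    proof (intro conjI allI ballI)
      show "subspace E" unfolding subspace_def E_def
      proof (intro conjI ballI allI; (elim CollectE conjE)?)
        have "T i (0 + 0) = T i 0 + T i 0" by (rule add[OF subspace_0[OF V] subspace_0[OF V]])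
        hence "T i 0 = T i 0 + T i 0" by (simp only: add_0_left)
        hence "T i 0 = 0" by (rule add_cancel_right_right[THEN iffD1])
        thus "0 \<in> {v \<in> U. T i v = scale a v}" using subspace_0[OF subU(1)] by simp
      next
        fix v w assume "v \<in> U" "T i v = scale a v" "w \<in> U" "T i w = scale a w"
        thus "v + w \<in> {v \<in> U. T i v = scale a v}"
          using subU add by (auto simp: subspace_add scale_right_distrib subset_iff)
      next
        fix c v assume "v \<in> U" "T i v = scale a v"
        thus "scale c v \<in> {v \<in> U. T i v = scale a v}"
          using subU hom by (auto simp: subspace_scale subset_iff mult.commute)
      qed
      show "E \<subseteq> V" using subU by (auto simp: E_def)
      show "\<exists>x\<in>E. x \<noteq> 0" using v by (auto simp: E_def)
      fix j w assume w: "w \<in> E"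
      have "T i (T j w) = T j (T i w)" using w subU(2) by (intro comm) (auto simp: E_def)
      also have "\<dots> = T j (scale a w)" using w by (simp add: E_def)
      also have "\<dots> = scale a (T j w)" using w subU by (intro hom) (auto simp: E_def)
      finally show "T j w \<in> E" using w invU by (auto simp: E_def)
    qed
    have "y \<in> E"
    proof (rule ccontr)
      assume "y \<notin> E"
      obtain C where C: "C \<subseteq> E" "independent C" "E \<subseteq> span C" "card C = dim E" using basis_exists[of E] by blast
      have "span C \<subseteq> E" using \<open>Inv E\<close> C(1) by (auto simp: Inv_def span_minimal)
      hence "y \<notin> span C" using \<open>y \<notin> E\<close> by blast
      hence ind: "independent (insert y C)" using C(2) by (rule independent_insertI)
      have "insert y C \<subseteq> U" using C(1) y by (auto simp: E_def)
      have UB: "U \<subseteq> span B" by (rule order_trans[OF subU(2) B(2)])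
      have fin: "finite (insert y C)"
        using independent_span_bound[OF B(1) ind order_trans[OF \<open>insert y C \<subseteq> U\<close> UB]] by (rule conjunct1)
      have "dim U \<ge> card (insert y C)"
      proof -
        obtain D where D: "insert y C \<subseteq> D" "D \<subseteq> U" "independent D" "U \<subseteq> span D"
          by (rule maximal_independent_subset_extend[OF \<open>insert y C \<subseteq> U\<close> ind])
        have "finite D"
          using independent_span_bound[OF B(1) D(3) order_trans[OF D(2) UB]] by (rule conjunct1)
        thus ?thesis using D basis_card_eq_dim[OF D(2,4,3)] card_mono[OF \<open>finite D\<close> D(1)] by simp
      qed
      moreover have "y \<notin> C" using \<open>y \<notin> span C\<close> span_base by blast
      ultimately have "dim U \<ge> Suc (dim E)" using fin C(4) by simp
      thus False using U(2)[OF \<open>Inv E\<close>] by simp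
    qed
    thus ?thesis by (auto simp: E_def)
  qed
  thus ?thesis using y subU by blast
qed

section \<open>Independence of characters\<close>

text \<open>
  Dedekind's argument: replacing \<open>n\<close> by \<open>m * n\<close> in a relation and subtracting a multiple of the
  original eliminates one character.
\<close>

lemma characters_independent:
  fixes ch :: "'i \<Rightarrow> nat \<Rightarrow> complex"
  assumes "finite I"
    and "\<And>i m n. i \<in> I \<Longrightarrow> m \<ge> 1 \<Longrightarrow> n \<ge> 1 \<Longrightarrow> ch i (m * n) = ch i m * ch i n"
    and "\<And>i. i \<in> I \<Longrightarrow> ch i 1 = 1"
    and "\<And>i j. i \<in> I \<Longrightarrow> j \<in> I \<Longrightarrow> i \<noteq> j \<Longrightarrow> \<exists>n\<ge>1. ch i n \<noteq> ch j n"
    and "\<And>n. n \<ge> 1 \<Longrightarrow> (\<Sum>i\<in>I. c i * ch i n) = 0"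
  shows "\<forall>i\<in>I. c i = 0"
  using assms
proof (induction I arbitrary: c rule: finite_induct)
  case (insert j I)
  note mult = insert.prems(1) and one = insert.prems(2) and dist = insert.prems(3) and zero = insert.prems(4)
  have "c i = 0" if i: "i \<in> I" for i
  proof -
    have "i \<noteq> j" using i insert.hyps by auto
    then obtain m where m: "m \<ge> 1" "ch i m \<noteq> ch j m" using dist[of i j] i by auto
    have "\<forall>l\<in>I. c l * (ch l m - ch j m) = 0"
    proof (rule insert.IH)
      fix n :: nat assume n: "n \<ge> 1"
      have "(\<Sum>l\<in>insert j I. c l * ch l (m * n)) - ch j m * (\<Sum>l\<in>insert j I. c l * ch l n) = 0"
        using zero[of "m * n"] zero[OF n] m n by simp
      also have "(\<Sum>l\<in>insert j I. c l * ch l (m * n)) = (\<Sum>l\<in>insert j I. c l * (ch l m * ch l n))"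
        using m n by (intro sum.cong) (auto simp: mult)
      finally have "(\<Sum>l\<in>insert j I. c l * (ch l m - ch j m) * ch l n) = 0"
        by (simp add: sum_distrib_left sum_subtractf[symmetric] algebra_simps del: sum.insert)
      thus "(\<Sum>l\<in>I. c l * (ch l m - ch j m) * ch l n) = 0" using insert.hyps by simp
    qed (use mult one dist in auto)
    thus ?thesis using i m by auto
  qed
  moreover from this have "c j = 0" using zero[of 1] one insert.hyps by simp
  ultimately show ?case by blast
qed simp

text \<open>
  The quotient of the powers has value 1 at all \<open>n\<close>, and since \<open>log (n + 1) - log n\<close> tends to 0,
  the values at large consecutive \<open>n\<close> detect the exponent without ambiguity by periods of exp.
\<close>

lemma powr_characters_distinct:
  assumes "\<And>n::nat. n \<ge> 1 \<Longrightarrow> of_nat n powr s = (of_nat n powr t :: complex)"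
  shows "s = t"
proof -
  define u where "u = s - t"
  have one: "exp (u * of_real (ln (real n))) = 1" if "n \<ge> 1" for n :: nat
  proof -
    have "of_nat n powr s = exp (s * of_real (ln (real n)))" "of_nat n powr t = exp (t * of_real (ln (real n)))"
      using that by (simp_all add: powr_def Ln_of_nat)
    thus ?thesis using assms[OF that] by (simp add: u_def left_diff_distrib exp_diff)
  qed
  have "(\<lambda>n. cmod u * (ln (real (Suc n)) - ln (real n))) \<longlonglongrightarrow> 0" by real_asymp
  then obtain n where n: "n \<ge> 1" "cmod u * (ln (real (Suc n)) - ln (real n)) < 1"
    using order_tendstoD(2)[of "\<lambda>n. cmod u * (ln (real (Suc n)) - ln (real n))" 0 sequentially 1]
    by (auto simp: eventually_sequentially) (metis le_SucI le_refl le_add1 plus_1_eq_Suc add.commute)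
  define z where "z = u * of_real (ln (real (Suc n)) - ln (real n))"
  have pos: "ln (real (Suc n)) - ln (real n) > 0" using n by simp
  have "exp z = 1" using one[of n] one[of "Suc n"] n by (simp add: z_def right_diff_distrib exp_diff)
  moreover have "cmod z < 1" using n pos by (simp add: z_def norm_mult del: of_real_diff)
  hence "\<bar>Im z\<bar> < 1" using abs_Im_le_cmod[of z] by linarith
  ultimately have "z = 0" using pi_gt3 Ln_exp[of z] by auto
  thus "s = t" using pos by (simp add: z_def u_def del: of_real_diff)
qed

section \<open>Zeros of zeta and elements of the orthogonal complement\<close>

lemma eta_coeff_sums: assumes "k \<ge> 1" shows "(\<lambda>m. eta_coeff k m) sums ln (real k)"
proof -
  have "(\<lambda>n. h_coeff k n) \<longlonglongrightarrow> 0"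
    using square_summable_imp_tendsto_0[OF square_summable_h_coeff[OF assms]] tendsto_of_real_iff[of _ 0] by fastforce
  hence "(\<lambda>n. h_coeff k n + ln (real k)) \<longlonglongrightarrow> 0 + ln (real k)" by (intro tendsto_intros)
  thus ?thesis unfolding sums_def_le by (simp add: h_coeff_def)
qed

lemma cmod_powr_incr_le:
  assumes n: "n \<ge> 1" and s: "Re s \<le> 1"
  shows "cmod (of_nat (Suc n) powr s - of_nat n powr s) \<le> cmod s * real n powr (Re s - 1)"
proof -
  have "cmod (of_real (real (Suc n)) powr s - of_real (real n) powr s)
     \<le> cmod s * real n powr (Re s - 1) * (real (Suc n) - real n)"
    by (rule cmod_powr_diff_le) (use n s in auto)
  thus ?thesis by simp
qed

lemma square_summable_incr_powr:
  assumes s: "Re s < 1 / 2"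
  shows "square_summable (incr (\<lambda>n. of_nat n powr s))"
  unfolding square_summable_def
proof (rule summable_comparison_test)
  have "summable (\<lambda>n. real n powr (2 * Re s - 2))" using s by (subst summable_real_powr_iff) auto
  thus "summable (\<lambda>n. (cmod s)\<^sup>2 * real n powr (2 * Re s - 2))" by (rule summable_mult)
  show "\<exists>N. \<forall>n\<ge>N. norm ((cmod (of_nat (Suc n) powr s - of_nat n powr s))\<^sup>2) \<le> (cmod s)\<^sup>2 * real n powr (2 * Re s - 2)"
  proof (intro exI[of _ 1] allI impI)
    fix n :: nat assume n: "n \<ge> 1"
    have "(cmod (of_nat (Suc n) powr s - of_nat n powr s))\<^sup>2 \<le> (cmod s * real n powr (Re s - 1))\<^sup>2"
      by (intro power_mono cmod_powr_incr_le n) (use s in auto)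
    also have "\<dots> = (cmod s)\<^sup>2 * real n powr (2 * Re s - 2)"
      using n by (simp add: power_mult_distrib power2_eq_square[of "_ powr _"] powr_add[symmetric])
    finally show "norm ((cmod (of_nat (Suc n) powr s - of_nat n powr s))\<^sup>2) \<le> (cmod s)\<^sup>2 * real n powr (2 * Re s - 2)"
      by simp
  qed
qed

lemma eta_annihilator_eq_summable:
  assumes "G 0 = 0" "square_summable (incr G)" "k \<ge> 1"
  shows "\<exists>S. (\<lambda>m. of_real (eta_coeff k m) * G m) sums S"
proof -
  have "(\<Sum>j<m. incr G j) = G m" for m using assms(1) sum_lessThan_telescope[of G m] by simp
  thus ?thesis using h_coeff_abel_summation[OF assms(3,2)] by auto
qed

lemma zeta_zero_imp_powr_in_annihilator:
  assumes \<rho>: "zeta \<rho> = 0" "1 / 2 < Re \<rho>" "\<rho> \<noteq> 1"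
  shows "(\<lambda>n. of_nat n powr (1 - \<rho>)) \<in> eta_annihilator"
proof -
  have ss: "square_summable (incr (\<lambda>n. of_nat n powr (1 - \<rho>)))"
    by (rule square_summable_incr_powr) (use \<rho> in simp)
  have "(\<lambda>m. of_real (eta_coeff k m) * of_nat m powr (1 - \<rho>)) sums 0" if k: "k \<ge> 2" for k
  proof -
    obtain S where S: "(\<lambda>m. of_real (eta_coeff k m) * of_nat m powr (1 - \<rho>)) sums S"
      using eta_annihilator_eq_summable[OF _ ss, of k] k by auto
    from eta_coeff_powr_sums_imp[OF _ _ _ this] k \<rho> have "S = 0" by simp
    with S show ?thesis by simp
  qed
  thus ?thesis using ss by (simp add: eta_annihilator_def)
qed

lemma powr_mult_of_nat:
  "of_nat (m * n) powr s = of_nat m powr s * (of_nat n powr s :: complex)"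
  by (simp add: powr_times_real)

text \<open>
  A zero \<open>\<rho>\<close> is taken to the function with summatory function \<open>n\<^bsup>1 - \<rho>\<^esup>\<close>; finite sets of these
  functions are independent because their summatory functions are distinct characters.
\<close>

lemma infinite_zeros_imp_cdim_infinite:
  assumes inf: "infinite {s. zeta s = 0 \<and> 1 / 2 < Re s \<and> Re s < 1}"
  shows "cdim (H2_orthogonal N_space) = \<infinity>"
proof -
  define V where "V = H2_orthogonal N_space"
  define Z where "Z = {s. zeta s = 0 \<and> 1 / 2 < Re s \<and> Re s < 1}"
  define F where "F \<rho> = disk_fun (incr (\<lambda>n. of_nat n powr (1 - \<rho>)))" for \<rho>
  have ann: "(\<lambda>n. of_nat n powr (1 - \<rho>)) \<in> eta_annihilator" if "\<rho> \<in> Z" for \<rho>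
    using that by (intro zeta_zero_imp_powr_in_annihilator) (auto simp: Z_def)
  have FV: "F \<rho> \<in> V" and sF: "summatory (F \<rho>) = (\<lambda>n. of_nat n powr (1 - \<rho>))" if "\<rho> \<in> Z" for \<rho>
    using disk_fun_incr_in_orthogonal[OF ann[OF that]] by (auto simp: F_def V_def)
  have FH2: "F \<rho> \<in> H2" if "\<rho> \<in> Z" for \<rho> using FV[OF that] by (auto simp: V_def H2_orthogonal_def)
  have "False" if B: "finite B" "V \<subseteq> fun_vs.span B" for B
  proof -
    obtain I where I: "I \<subseteq> Z" "finite I" "card I = Suc (card B)"
      using inf infinite_arbitrarily_large[of Z "Suc (card B)"] by (auto simp: Z_def)
    have distinct: "\<exists>n\<ge>1. of_nat n powr (1 - \<rho>) \<noteq> (of_nat n powr (1 - \<rho>') :: complex)"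
      if "\<rho> \<noteq> \<rho>'" for \<rho> \<rho>'
      using powr_characters_distinct[of "1 - \<rho>" "1 - \<rho>'"] that by auto
    have inj: "inj_on F I"
    proof (rule inj_onI, rule ccontr)
      fix \<rho> \<rho>' assume "\<rho> \<in> I" "\<rho>' \<in> I" "F \<rho> = F \<rho>'" "\<rho> \<noteq> \<rho>'"
      thus False using distinct[of \<rho> \<rho>'] sF[of \<rho>] sF[of \<rho>'] I by (metis subsetD)
    qed
    have "\<not> fun_vs.dependent (F ` I)"
    proof
      assume "fun_vs.dependent (F ` I)"
      then obtain u where u: "\<exists>v\<in>F ` I. u v \<noteq> 0" "(\<Sum>v\<in>F ` I. fun_scale (u v) v) = 0"
        using fun_vs.dependent_finite[of "F ` I"] I by auto
      hence zero: "(\<Sum>\<rho>\<in>I. fun_scale (u (F \<rho>)) (F \<rho>)) = 0"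
        by (subst (asm) sum.reindex[OF inj]) (simp add: o_def)
      have "\<forall>\<rho>\<in>I. u (F \<rho>) = 0"
      proof (rule characters_independent[where ch = "\<lambda>\<rho> n. of_nat n powr (1 - \<rho>)"])
        fix n :: nat
        have "summatory (\<Sum>\<rho>\<in>I. fun_scale (u (F \<rho>)) (F \<rho>)) = (\<lambda>n. \<Sum>\<rho>\<in>I. u (F \<rho>) * summatory (F \<rho>) n)"
          using H2_linear_combination[OF I(2), of F "\<lambda>\<rho>. u (F \<rho>)"] I(1) FH2 by blast
        hence "(\<Sum>\<rho>\<in>I. u (F \<rho>) * summatory (F \<rho>) n) = 0"
          unfolding zero H2_zero by metis
        moreover have "(\<Sum>\<rho>\<in>I. u (F \<rho>) * summatory (F \<rho>) n) = (\<Sum>\<rho>\<in>I. u (F \<rho>) * of_nat n powr (1 - \<rho>))"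
          using I sF by (intro sum.cong) auto
        ultimately show "(\<Sum>\<rho>\<in>I. u (F \<rho>) * of_nat n powr (1 - \<rho>)) = 0" by simp
      qed (use I distinct in \<open>simp_all only: powr_mult_of_nat of_nat_1 powr_one_eq_one\<close>)
      thus False using u(1) by auto
    qed
    moreover have "F ` I \<subseteq> fun_vs.span B" using FV I B(2) by blast
    ultimately have "card (F ` I) \<le> card B" using fun_vs.independent_span_bound[OF B(1)] by blast
    thus False using card_image[OF inj] I by simp
  qed
  thus ?thesis unfolding cdim_def V_def[symmetric] by auto
qed

text \<open>
  A common eigenvector of the dilations, normalised by \<open>lam 1 = 1\<close>, is of the form \<open>n\<^sup>s\<close> with
  \<open>\<zeta>(1 - s) = 0\<close>.  The constant function 1 is ruled out separately (\<open>not1\<close>), as it corresponds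
  to the pole of zeta: its sums are \<open>log k\<close> instead of 0.
\<close>

lemma multiplicative_annihilator_imp_zero:
  assumes G: "lam \<in> eta_annihilator"
    and mult: "\<And>m n. m \<ge> 1 \<Longrightarrow> n \<ge> 1 \<Longrightarrow> lam (m * n) = lam m * lam n"
    and one: "lam 1 = 1"
  obtains \<rho> where "zeta \<rho> = 0" "1 / 2 < Re \<rho>" "\<rho> \<noteq> 1"
proof -
  have ss: "square_summable (incr lam)" and lam0: "lam 0 = 0"
    and S: "\<And>k. k \<ge> 2 \<Longrightarrow> (\<lambda>m. of_real (eta_coeff k m) * lam m) sums 0"
    using G by (auto simp: eta_annihilator_def)
  \<comment> \<open>The pole of zeta: for \<open>lam = 1\<close> the series sums to \<open>log 2\<close> for \<open>k = 2\<close>.\<close>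
  have not1: False if "\<And>n. n \<ge> 1 \<Longrightarrow> lam n = 1"
  proof -
    have "(\<lambda>m. of_real (eta_coeff 2 m) * lam m) = (\<lambda>m. of_real (eta_coeff 2 m))"
    proof
      fix m show "of_real (eta_coeff 2 m) * lam m = of_real (eta_coeff 2 m)"
        using that[of m] by (cases "m = 0") (auto simp: eta_coeff_def)
    qed
    hence "(\<lambda>m. of_real (eta_coeff 2 m) :: complex) sums 0" using S[of 2] by simp
    moreover have "(\<lambda>m. of_real (eta_coeff 2 m) :: complex) sums of_real (ln 2)"
      using sums_of_real[OF eta_coeff_sums[of 2]] by simp
    ultimately have "complex_of_real (ln 2) = 0" by (rule sums_unique2[symmetric])
    thus False by simp
  qed
  have big: "cmod (lam n) \<ge> 1" if n: "n \<ge> 1" for n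
  proof (rule ccontr)
    assume "\<not> cmod (lam n) \<ge> 1"
    hence "summable (\<lambda>n. cmod (lam n) / real n)"
      using summable_of_cmod_less_1[OF mult ss n] by simp
    hence sm: "summable (\<lambda>n. cmod (lam n / of_nat n))" by (simp add: norm_divide)
    define f where "f n = lam n / of_nat n" for n
    have L0: "(\<Sum>n. f n) \<noteq> 0"
      by (rule sum_multiplicative_neq_0) (use mult one sm in \<open>auto simp: f_def\<close>)
    have f: "f sums (\<Sum>n. f n)" using summable_sums[OF summable_norm_cancel[OF sm]] by (simp add: f_def[abs_def])
    have lam_k: "lam k = 1" if k: "k \<ge> 2" for k
    proof -
      \<comment> \<open>By multiplicativity the sum of \<open>k f(m)\<close> over the multiples of \<open>k\<close> is \<open>lam k\<close> times the full sum.\<close>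
      define g where "g m = (if k dvd m then of_nat k * f m else 0)" for m
      have "(\<lambda>m. lam k * f m) sums (lam k * (\<Sum>n. f n))" by (rule sums_mult[OF f])
      also have "(\<lambda>m. lam k * f m) = (\<lambda>m. g (k * m))"
      proof
        fix m show "lam k * f m = g (k * m)"
          using k mult[of k m] by (cases "m = 0") (auto simp: g_def f_def)
      qed
      finally have "g sums (lam k * (\<Sum>n. f n))"
        by (subst (asm) sums_mono_reindex) (use k in \<open>auto simp: g_def strict_mono_def\<close>)
      from sums_diff[OF f this]
      have "(\<lambda>m. f m - g m) sums ((\<Sum>n. f n) - lam k * (\<Sum>n. f n))" .
      also have "(\<lambda>m. f m - g m) = (\<lambda>m. of_real (eta_coeff k m) * lam m)"
        by (auto simp: fun_eq_iff f_def g_def eta_coeff_def left_diff_distrib diff_divide_distrib)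
      finally have "(\<Sum>n. f n) - lam k * (\<Sum>n. f n) = 0" using S[OF k] by (rule sums_unique2)
      hence "(1 - lam k) * (\<Sum>n. f n) = 0" by (simp add: algebra_simps)
      thus "lam k = 1" using L0 by simp
    qed
    have "lam n = 1" if "n \<ge> 1" for n using lam_k[of n] one that by (cases "n = 1") auto
    thus False by (rule not1)
  qed
  have "\<exists>s. \<forall>n\<ge>1. lam n = of_nat n powr s"
  proof (rule ratio_continuous_imp_powr[OF _ mult one])
    show "lam n \<noteq> 0" if "n \<ge> 1" for n using big[OF that] by auto
    fix \<epsilon> :: real assume "\<epsilon> > 0"
    from ratio_tendsto_1[OF big mult ss this]
    show "\<exists>\<delta>>0. \<forall>a b. 1 \<le> b \<longrightarrow> b \<le> a \<longrightarrow> real a \<le> (1 + \<delta>) * real b \<longrightarrow> cmod (lam a / lam b - 1) \<le> \<epsilon>"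
      by metis
  qed
  then obtain s where s: "\<And>n. n \<ge> 1 \<Longrightarrow> lam n = of_nat n powr s" by blast
  have s0: "s \<noteq> 0" using not1 s by auto
  have "Re s < 1 / 2"
  proof (rule ccontr)
    assume "\<not> Re s < 1 / 2"
    have "(\<lambda>N. cmod ((\<Sum>n<N. incr lam n) / of_real (sqrt (real N)))) \<longlonglongrightarrow> 0"
      using square_summable_partial_sums[OF ss] by (simp only: tendsto_norm_zero_iff)
    moreover have "(\<Sum>n<N. incr lam n) = lam N" for N using lam0 sum_lessThan_telescope[of lam N] by simp
    ultimately have lim: "(\<lambda>N. cmod (lam N) / sqrt (real N)) \<longlonglongrightarrow> 0" by (simp add: norm_divide)
    have "\<forall>\<^sub>F N in sequentially. 1 \<le> cmod (lam N) / sqrt (real N)"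
    proof (rule eventually_sequentiallyI[of 1])
      fix N :: nat assume N: "N \<ge> 1"
      have "real N powr (1 / 2) \<le> real N powr Re s" using N \<open>\<not> Re s < 1 / 2\<close> by (intro powr_mono) auto
      thus "1 \<le> cmod (lam N) / sqrt (real N)" using N by (simp add: s cmod_of_nat_powr powr_half_sqrt)
    qed
    hence "1 \<le> (0::real)" by (rule tendsto_lowerbound[OF lim]) simp
    thus False by simp
  qed
  define \<rho> where "\<rho> = 1 - s"
  have "(1 - of_nat k powr (1 - \<rho>)) * zeta \<rho> = 0" if k: "k \<ge> 2" for k
  proof -
    have "(\<lambda>m. of_real (eta_coeff k m) * lam m) = (\<lambda>m. of_real (eta_coeff k m) * of_nat m powr (1 - \<rho>))"
    proof
      fix m show "of_real (eta_coeff k m) * lam m = of_real (eta_coeff k m) * of_nat m powr (1 - \<rho>)"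
        using s[of m] by (cases "m = 0") (auto simp: eta_coeff_def \<rho>_def)
    qed
    hence "(\<lambda>m. of_real (eta_coeff k m) * of_nat m powr (1 - \<rho>)) sums 0" using S[OF k] by simp
    from eta_coeff_powr_sums_imp[OF _ _ _ this] show ?thesis
      using k s0 \<open>Re s < 1 / 2\<close> by (simp add: \<rho>_def)
  qed
  hence "zeta \<rho> = 0 \<or> (\<forall>k\<ge>2. of_nat k powr s = (1::complex))" by (auto simp: \<rho>_def)
  moreover have "\<not> (\<forall>k\<ge>2. of_nat k powr s = (1::complex))"
  proof
    assume *: "\<forall>k\<ge>2. of_nat k powr s = (1::complex)"
    have "lam n = 1" if "n \<ge> 1" for n using * one s[OF that] that by (cases "n = 1") auto
    thus False by (rule not1)
  qed
  ultimately show thesis using that[of \<rho>] s0 \<open>Re s < 1 / 2\<close> by (auto simp: \<rho>_def)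
qed

lemma zero_off_line_imp_not_RH:
  assumes "zeta \<rho> = 0" "1 / 2 < Re \<rho>" "\<rho> \<noteq> 1"
  shows "\<not> riemann_hypothesis"
proof -
  have "nontrivial_zeta_zero \<rho>" unfolding nontrivial_zeta_zero_def using assms by auto
  thus ?thesis using assms unfolding riemann_hypothesis_def by auto
qed

theorem theorem21:
  assumes "RHF_conjecture"
  shows "cdim (H2_orthogonal N_space) = 0 \<or> cdim (H2_orthogonal N_space) = \<infinity>"
proof (cases "H2_orthogonal N_space \<subseteq> {0}")
  case True
  hence "H2_orthogonal N_space \<subseteq> fun_vs.span {}" by simp
  moreover from this have "fun_vs.dim (H2_orthogonal N_space) = 0"
    using fun_vs.dim_le_card[of _ "{}"] by simp
  moreover have "finite ({} :: (complex \<Rightarrow> complex) set)" by simp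
  ultimately have "cdim (H2_orthogonal N_space) = enat 0" unfolding cdim_def by metis
  thus ?thesis by (simp add: zero_enat_def)
next
  case False
  define V where "V = H2_orthogonal N_space"
  obtain x where x: "x \<in> V" "x \<noteq> 0" using False by (auto simp: V_def)
  have V_iff: "f \<in> V \<longleftrightarrow> f \<in> H2 \<and> summatory f \<in> eta_annihilator" for f
    unfolding V_def by (rule H2_orthogonal_N_space_iff)
  have sub: "fun_vs.subspace V" unfolding V_def by (rule H2_orthogonal_subspace)
  show ?thesis
  proof (cases "\<exists>B. finite B \<and> V \<subseteq> fun_vs.span B")
    case False
    hence "cdim (H2_orthogonal N_space) = \<infinity>" unfolding cdim_def V_def by (rule if_not_P)
    thus ?thesis ..
  next
    case True
    then obtain B where B: "finite B" "V \<subseteq> fun_vs.span B" by blast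
    define T where "T i f = disk_fun (incr (\<lambda>m. summatory f (Suc i * m)))" for i :: nat and f
    have T: "T i f \<in> V" "summatory (T i f) = (\<lambda>m. summatory f (Suc i * m))" if "f \<in> V" for i f
    proof -
      have "(\<lambda>m. summatory f (Suc i * m)) \<in> eta_annihilator"
        using that by (intro eta_annihilator_dilate) (auto simp: V_iff)
      from disk_fun_incr_in_orthogonal[OF this]
      show "T i f \<in> V" "summatory (T i f) = (\<lambda>m. summatory f (Suc i * m))" by (simp_all add: T_def V_def)
    qed
    have eqI: "f = g" if "f \<in> V" "g \<in> V" "summatory f = summatory g" for f g
      using that by (intro H2_eqI) (auto simp: V_iff)
    have sum_add: "summatory (f + g) = (\<lambda>n. summatory f n + summatory g n)" if "f \<in> V" "g \<in> V" for f g
      using that by (intro H2_add) (auto simp: V_iff)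
    have sum_scale: "summatory (fun_scale a f) = (\<lambda>n. a * summatory f n)" if "f \<in> V" for a f
      using that by (intro H2_scale) (auto simp: V_iff)
    note V_add = fun_vs.subspace_add[OF sub] and V_scale = fun_vs.subspace_scale[OF sub]
    have "\<exists>v\<in>V. v \<noteq> 0 \<and> (\<forall>i. \<exists>a. T i v = fun_scale a v)"
    proof (rule common_eigenvector_exists[OF fun_vs.vector_space_axioms sub x B])
      show "T i v \<in> V" if "v \<in> V" for i v using T(1)[OF that] .
      show "T i (v + w) = T i v + T i w" if "v \<in> V" "w \<in> V" for i v w
        by (rule eqI) (simp_all add: T V_add that sum_add)
      show "T i (fun_scale a v) = fun_scale a (T i v)" if "v \<in> V" for i a v
        by (rule eqI) (simp_all add: T V_scale that sum_scale)
      show "T i (T j v) = T j (T i v)" if "v \<in> V" for i j v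
        by (rule eqI) (simp_all only: T that mult.left_commute)
    qed
    then obtain v where v: "v \<in> V" "v \<noteq> 0" "\<And>i. \<exists>a. T i v = fun_scale a v" by blast
    define G where "G = summatory v"
    have G: "G \<in> eta_annihilator" "G 0 = 0" using v(1) by (auto simp: V_iff G_def eta_annihilator_def)
    have dil: "\<exists>a. \<forall>m. G (n * m) = a * G m" if "n \<ge> 1" for n
    proof -
      obtain a where "T (n - 1) v = fun_scale a v" using v(3) by blast
      hence "summatory (T (n - 1) v) = summatory (fun_scale a v)" by simp
      hence "G (n * m) = a * G m" for m
        using T(2)[OF v(1), of "n - 1"] sum_scale[OF v(1), of a] that by (simp add: G_def fun_eq_iff)
      thus ?thesis by blast
    qed
    have G1: "G 1 \<noteq> 0"
    proof
      assume "G 1 = 0"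
      have "G n = 0" for n
      proof (cases "n = 0")
        case False
        then obtain a where "\<forall>m. G (n * m) = a * G m" using dil[of n] by auto
        hence "G (n * 1) = a * G 1" by blast
        thus ?thesis using \<open>G 1 = 0\<close> by simp
      qed (use G in simp)
      hence "summatory v = summatory 0" by (simp add: G_def H2_zero fun_eq_iff)
      hence "v = 0" using v(1) by (intro H2_eqI) (auto simp: V_iff H2_zero)
      thus False using v(2) by simp
    qed
    define lam where "lam n = G n / G 1" for n
    have "lam \<in> eta_annihilator"
      using eta_annihilator_scale[OF G(1), of "1 / G 1"] by (simp add: lam_def[abs_def])
    moreover have "lam (m * n) = lam m * lam n" if m: "m \<ge> 1" and "n \<ge> 1" for m n
    proof -
      obtain a where a: "\<forall>l. G (m * l) = a * G l" using dil[OF m] by blast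
      have "G (m * 1) = a * G 1" "G (m * n) = a * G n" using a by blast+
      thus ?thesis using G1 by (simp add: lam_def)
    qed
    moreover have "lam 1 = 1" using G1 by (simp add: lam_def)
    ultimately obtain \<rho> where \<rho>: "zeta \<rho> = 0" "1 / 2 < Re \<rho>" "\<rho> \<noteq> 1"
      by (rule multiplicative_annihilator_imp_zero)
    hence "infinite {s. zeta s = 0 \<and> 1 / 2 < Re s \<and> Re s < 1}"
      using assms zero_off_line_imp_not_RH[OF \<rho>] unfolding RHF_conjecture_def by blast
    hence "cdim (H2_orthogonal N_space) = \<infinity>" by (rule infinite_zeros_imp_cdim_infinite)
    thus ?thesis ..
  qed
qed

end
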